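(* Let $(E,T)$ be an invariant affine reflection algebra over a field $\mathbb K$ of characteristic $0$, with set of roots $R$ and $X=\operatorname{Span}_{\mathbb K}(R)\subset T^*$, and let $(\cdot|\cdot)_X$, $R^{\rm an}$, $R^0$ be as in the context. Then: (AR2) for every $\alpha\in R^{\rm an}$ there exists an integrable $\mathfrak{sl}_2$-triple $(e_\alpha,h_\alpha,f_\alpha)\in E_\alpha\times T\times E_{-\alpha}$ such that $(\beta|\alpha)_X=\frac{(\alpha|\alpha)_X}{2}\beta(h_\alpha)$ for all $\beta\in R$; (AR3) for every $\alpha\in R^0$ there exists a triple $(e_\alpha,t_\alpha,f_\alpha)\in E_\alpha\times T\times E_{-\alpha}$ with $[e_\alpha,f_\alpha]=-t_\alpha$ such that $(\beta|\alpha)_X=\beta(t_\alpha)$ for all $\beta\in R$; and, with respect to $s_\alpha(x)=x-\frac{2(x|\alpha)_X}{(\alpha|\alpha)_X}\alpha$ for $\alpha\in R^{\rm an}$ and $s_\alpha=\mathrm{Id}$ for $\alpha\in R^0$, $(R,X)$ is a symmetric affine reflection system with $R^{\rm re}=R^{\rm an}=R^{\rm int}$ and $R^0=R^{\rm im}$. Moreover: (a) If $(E,T)$ is tame, then $R$ is tame. (b) Let $K=E_c$ be the core. The centreless core $L=E_{cc}=K/\mathrm{Z}(K)$, with the grading described in the context, is a predivision-$(S,\Lambda)$-graded Lie algebra, which is invariant with respect to the form induced from $(\cdot|\cdot)|_{K\times K}$ by the canonical epimorphism $K\to L$.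
   Context: **Toral pairs.** A toral pair $(E,T)$ is a non-zero Lie algebra $E$ over $\mathbb K$ with a subspace $T\subset E$ such that $E=\bigoplus_{\alpha\in T^*}E_\alpha$, $E_\alpha=\{x\in E:[t,x]=\alpha(t)x\ \forall t\in T\}$. Its set of roots is $R=\{\alpha\in T^*:E_\alpha\neq0\}$. An $\mathfrak{sl}_2$-triple is a non-zero triple $(e,h,f)$ with $[e,f]=-h$, $[h,e]=2e$, $[h,f]=-2f$. An $\mathfrak{sl}_2$-triple $(e_\alpha,h_\alpha,f_\alpha)\in E_\alpha\times T\times E_{-\alpha}$ is integrable if $\operatorname{ad}e_\alpha,\operatorname{ad}f_\alpha$ are locally nilpotent on $E$; $R^{\rm int}$ is the set of roots $\alpha$ for which such a triple exists. **Invariant affine reflection algebras.** A toral pair $(E,T)$ is an invariant affine reflection algebra (IARA) if: (IA1) $E$ has an invariant nondegenerate symmetric bilinear form $(\cdot|\cdot)$ (invariant: $([a,b]|c)=(a|[b,c])$) whose restriction $(\cdot|\cdot)_T$ to $T\times T$ is nondegenerate and such that for every $\alpha\in R$ there is a (unique) $t_\alpha\in T$ with $(t_\alpha|t)=\alpha(t)$ for all $t\in T$. Define $(\cdot|\cdot)_X$ on $X$ by $(\alpha|\beta)_X=(t_\alpha|t_\beta)$, and $R^0=\{\alpha\in R:(\alpha|\alpha)_X=0\}$, $R^{\rm an}=R\setminus R^0$. (IA2) For every $0\ne\alpha\in R$ there are $e_{\pm\alpha}\in E_{\pm\alpha}$ with $0\neq[e_\alpha,e_{-\alpha}]\in T$.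 (IA3) $\operatorname{ad}x_\alpha$ is locally nilpotent on $E$ for all $\alpha\in R^{\rm an}$, $x_\alpha\in E_\alpha$. **Reflection systems.** A pre-reflection system $(R,X,s)$ consists of a subset $R$ of a $\mathbb K$-vector space $X$ and a map $s\colon R\to\mathrm{GL}(X)$, $\alpha\mapsto s_\alpha$, such that: $0\in R$, $R$ spans $X$, and for all $\alpha\in R$ the fixed space of $s_\alpha$ has codimension $\le1$ and $s_\alpha^2=\mathrm{Id}$; with $R^{\rm re}=\{\alpha\in R:s_\alpha\ne\mathrm{Id}\}$ and $R^{\rm im}=R\setminus R^{\rm re}$, one has $s_\alpha(\alpha)=-\alpha\neq\alpha$ for $\alpha\in R^{\rm re}$, and $s_\alpha(R^{\rm re})=R^{\rm re}$, $s_\alpha(R^{\rm im})=R^{\rm im}$ for all $\alpha\in R$. For $\alpha\in R^{\rm re}$, $\alpha^\vee\in X^*$ is defined by $s_\alpha(x)=x-\langle x,\alpha^\vee\rangle\alpha$; $\alpha^\vee=0$ for $\alpha\in R^{\rm im}$. A morphism $(R,X,s)\to(S,Y,s)$ is a linear map $f\colon X\to Y$ with $f(R)\subset S$ and $f(s_\alpha\beta)=s_{f(\alpha)}f(\beta)$; it is an extension if $f(R^{\rm im})=S^{\rm im}$ and $f(R^{\rm re})=S^{\rm re}$. A locally finite root system is a pre-reflection system $(S,Y)$ with $\langle S,S^\vee\rangle\subset\mathbb Z$, $S=S^{\rm re}\cup\{0\}$ and $|S\cap V|<\infty$ for every finite-dimensional subspace $V\subset Y$. Put $S^\times=S\setminus\{0\}$,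 $S_{\rm ind}=\{0\}\cup\{\alpha\in S:\alpha/2\notin S\}$ (a subsystem, i.e. it contains $0$ and is stable under its reflections), $\mathcal Q(S)=\operatorname{Span}_{\mathbb Z}S$. An affine reflection system is a pre-reflection system $R$ admitting an extension $f\colon R\to S$ onto a locally finite root system $S$; $S$ is then unique up to unique isomorphism and called the quotient root system. $R$ is symmetric if $R=-R$, and tame if $R^{\rm im}\subset R^{\rm re}+R^{\rm re}$. **Core, tameness and grading.** The core $K=E_c$ is the subalgebra of $E$ generated by $\{E_\alpha:\alpha\in R^{\rm re}\}$, where $R^{\rm re}=R^{\rm an}$. $(E,T)$ is tame if the centralizer of $E_c$ in $E$ is contained in $E_c$. Let $f\colon(R,X)\to(S,Y)$ be the extension onto the quotient root system, and $g\colon Y\to X$, $\xi\mapsto\dot\xi$, a partial section over $S_{\rm ind}$, i.e. a linear map with $f\circ g=\mathrm{Id}_Y$ that is a morphism $(S_{\rm ind},Y)\to(R,X)$ (such $g$ exists). Put $\Lambda_\xi=\{\lambda\in\operatorname{Ker}f:\dot\xi+\lambda\in R\}$ and let $\Lambda$ be the subgroup of $\operatorname{Ker} f$ generated by $\bigcup_{\xi\in S}\Lambda_\xi$. Then $K=\bigoplus_{\xi\in S,\lambda\in\Lambda}K_\xi^\lambda$ is graded by $K_\xi^\lambda=E_{\dot\xi\oplus\lambda}$ ($\xi\neq0$), $K_0^\lambda=\sum_{\tau\in S^\times,\mu\in\Lambda}[E_{\dot\tau\oplus\mu},E_{-\dot\tau\oplus(\lambda-\mu)}]$; $\mathrm Z(K)$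 is a graded ideal and $L=K/\mathrm Z(K)$ carries the quotient grading. **Root-graded Lie algebras.** Let $L=\bigoplus_{q\in\mathcal Q(S),\lambda\in\Lambda}L_q^\lambda$ be a $(\mathcal Q(S)\oplus\Lambda)$-graded Lie algebra, $L_q=\bigoplus_\lambda L_q^\lambda$, $L^\lambda=\bigoplus_qL_q^\lambda$. A non-zero $e\in L_\alpha^\lambda$ ($\alpha\in S^\times$) is invertible, with inverse $f\in L_{-\alpha}^{-\lambda}$, if $h=[f,e]$ satisfies $[h,x]=\langle q,\alpha^\vee\rangle x$ for all $q\in\mathcal Q(S)$, $x\in L_q$. $L$ is predivision-$(S,\Lambda)$-graded if (RG1) $L_q=0$ for $q\notin S$; (RG2) every $L_\alpha^0$, $\alpha\in S_{\rm ind}\setminus\{0\}$, contains an invertible element; (RG3) $L_0=\sum_{0\ne\alpha\in S}[L_\alpha,L_{-\alpha}]$; and every non-zero $L_\alpha^\lambda$, $\alpha\in S^\times$, contains an invertible element. It is invariant with respect to a bilinear form $(\cdot|\cdot)_L$ if this form is invariant, nondegenerate, symmetric and $\Lambda$-graded ($(L^\lambda|L^\mu)_L=0$ for $\lambda+\mu\neq0$), and for some choice of invertible elements $e_\alpha\in L_\alpha^0$, $\alpha\in S_{\rm ind}\setminus\{0\}$, with inverses $f_\alpha$, its restriction to $\operatorname{Span}\{[e_\alpha,f_\alpha]:0\ne\alpha\in S_{\rm ind}\}$ is nondegenerate. *)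

theory Defs
  imports Complex_Main "HOL-Library.Function_Algebras" "HOL-Computational_Algebra.Group_Closure"
begin

text \<open>Every vector space below is a subspace (possibly \<open>UNIV\<close>) of an ambient vector space
  carried by a type; \<open>sc\<close> denotes scalar multiplication and \<open>br\<close> a Lie bracket.\<close>

section \<open>Linear algebra\<close>

definition linear_on ::
    "('k::field \<Rightarrow> 'a::ab_group_add \<Rightarrow> 'a) \<Rightarrow> ('k \<Rightarrow> 'b::ab_group_add \<Rightarrow> 'b) \<Rightarrow> 'a set \<Rightarrow> ('a \<Rightarrow> 'b) \<Rightarrow> bool"
  where "linear_on sc1 sc2 V f \<longleftrightarrow>
    (\<forall>x\<in>V. \<forall>y\<in>V. f (x + y) = f x + f y) \<and> (\<forall>c. \<forall>x\<in>V. f (sc1 c x) = sc2 c (f x))"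

definition direct_sum ::
    "('k::field \<Rightarrow> 'a::ab_group_add \<Rightarrow> 'a) \<Rightarrow> 'a set \<Rightarrow> 'i set \<Rightarrow> ('i \<Rightarrow> 'a set) \<Rightarrow> bool"
  where "direct_sum sc V I F \<longleftrightarrow>
    (\<forall>i\<in>I. module.subspace sc (F i)) \<and> V = module.span sc (\<Union>i\<in>I. F i) \<and>
    (\<forall>J x. finite J \<and> J \<subseteq> I \<and> (\<forall>i\<in>J. x i \<in> F i) \<and> (\<Sum>i\<in>J. x i) = 0 \<longrightarrow> (\<forall>i\<in>J. x i = 0))"

definition bilinear_form_on ::
    "('k::field \<Rightarrow> 'a::ab_group_add \<Rightarrow> 'a) \<Rightarrow> 'a set \<Rightarrow> ('a \<Rightarrow> 'a \<Rightarrow> 'k) \<Rightarrow> bool"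
  where "bilinear_form_on sc V B \<longleftrightarrow>
    (\<forall>x\<in>V. linear_on sc (*) V (B x)) \<and> (\<forall>y\<in>V. linear_on sc (*) V (\<lambda>x. B x y))"

definition symmetric_on :: "'a set \<Rightarrow> ('a \<Rightarrow> 'a \<Rightarrow> 'k) \<Rightarrow> bool"
  where "symmetric_on V B \<longleftrightarrow> (\<forall>x\<in>V. \<forall>y\<in>V. B x y = B y x)"

definition nondegenerate_on :: "'a::zero set \<Rightarrow> ('a \<Rightarrow> 'a \<Rightarrow> 'k::zero) \<Rightarrow> bool"
  where "nondegenerate_on V B \<longleftrightarrow> (\<forall>x\<in>V. (\<forall>y\<in>V. B x y = 0) \<longrightarrow> x = 0)"

definition locally_nilpotent :: "('a::zero \<Rightarrow> 'a) \<Rightarrow> bool"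
  where "locally_nilpotent u \<longleftrightarrow> (\<forall>x. \<exists>n. (u ^^ n) x = 0)"

definition fun_sc :: "'k::times \<Rightarrow> ('e \<Rightarrow> 'k) \<Rightarrow> 'e \<Rightarrow> 'k"
  where "fun_sc c \<alpha> = (\<lambda>t. c * \<alpha> t)"

text \<open>A linear form on the subspace \<open>T\<close> is represented by its extension by \<open>0\<close> outside \<open>T\<close>,
  so that \<open>T\<^sup>*\<close> is a subspace of a function space with its pointwise operations.\<close>

definition dual :: "('k::field \<Rightarrow> 'e::ab_group_add \<Rightarrow> 'e) \<Rightarrow> 'e set \<Rightarrow> ('e \<Rightarrow> 'k) set"
  where "dual sc T = {\<alpha>. linear_on sc (*) T \<alpha> \<and> (\<forall>x. x \<notin> T \<longrightarrow> \<alpha> x = 0)}"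


section \<open>Lie algebras\<close>

definition lie_algebra ::
    "('k::field \<Rightarrow> 'e::ab_group_add \<Rightarrow> 'e) \<Rightarrow> 'e set \<Rightarrow> ('e \<Rightarrow> 'e \<Rightarrow> 'e) \<Rightarrow> bool"
  where "lie_algebra sc L br \<longleftrightarrow>
    vector_space sc \<and> module.subspace sc L \<and>
    (\<forall>x\<in>L. \<forall>y\<in>L. br x y \<in> L) \<and>
    (\<forall>x\<in>L. linear_on sc sc L (br x)) \<and> (\<forall>y\<in>L. linear_on sc sc L (\<lambda>x. br x y)) \<and>
    (\<forall>x\<in>L. br x x = 0) \<and>
    (\<forall>x\<in>L. \<forall>y\<in>L. \<forall>z\<in>L. br x (br y z) + br y (br z x) + br z (br x y) = 0)"

definition invariant_on :: "'e set \<Rightarrow> ('e \<Rightarrow> 'e \<Rightarrow> 'e) \<Rightarrow> ('e \<Rightarrow> 'e \<Rightarrow> 'k) \<Rightarrow> bool"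
  where "invariant_on L br B \<longleftrightarrow> (\<forall>a\<in>L. \<forall>b\<in>L. \<forall>c\<in>L. B (br a b) c = B a (br b c))"

definition subalgebra_generated ::
    "('k::field \<Rightarrow> 'e::ab_group_add \<Rightarrow> 'e) \<Rightarrow> ('e \<Rightarrow> 'e \<Rightarrow> 'e) \<Rightarrow> 'e set \<Rightarrow> 'e set"
  where "subalgebra_generated sc br A =
    \<Inter>{M. module.subspace sc M \<and> (\<forall>x\<in>M. \<forall>y\<in>M. br x y \<in> M) \<and> A \<subseteq> M}"

definition centralizer :: "('e \<Rightarrow> 'e \<Rightarrow> 'e::zero) \<Rightarrow> 'e set \<Rightarrow> 'e set"
  where "centralizer br A = {x. \<forall>y\<in>A. br x y = 0}"

definition centre :: "('e \<Rightarrow> 'e \<Rightarrow> 'e::zero) \<Rightarrow> 'e set \<Rightarrow> 'e set"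
  where "centre br K = {z \<in> K. \<forall>x\<in>K. br z x = 0}"

text \<open>\<open>L\<close>, together with the canonical epimorphism \<open>\<pi>\<close>, is the quotient Lie algebra \<open>K / Z\<close>. Since
  a quotient has no canonical carrier inside a type, it is described up to unique isomorphism.\<close>

definition lie_quotient ::
    "('k::field \<Rightarrow> 'e::ab_group_add \<Rightarrow> 'e) \<Rightarrow> 'e set \<Rightarrow> ('e \<Rightarrow> 'e \<Rightarrow> 'e) \<Rightarrow> 'e set \<Rightarrow>
     ('k \<Rightarrow> 'l::ab_group_add \<Rightarrow> 'l) \<Rightarrow> 'l set \<Rightarrow> ('l \<Rightarrow> 'l \<Rightarrow> 'l) \<Rightarrow> ('e \<Rightarrow> 'l) \<Rightarrow> bool"
  where "lie_quotient sc K br Z scL L brL \<pi> \<longleftrightarrow>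
    lie_algebra scL L brL \<and> linear_on sc scL K \<pi> \<and> \<pi> ` K = L \<and>
    (\<forall>x\<in>K. \<forall>y\<in>K. \<pi> (br x y) = brL (\<pi> x) (\<pi> y)) \<and>
    {x \<in> K. \<pi> x = 0} = Z"

text \<open>Quotients by the centre exist, realised by the adjoint representation.\<close>

lemma lie_quotient_centre_exists:
  fixes sc :: "'k::field \<Rightarrow> 'e::ab_group_add \<Rightarrow> 'e"
  assumes K: "lie_algebra sc K br"
  shows "\<exists>(scL :: 'k \<Rightarrow> ('e \<Rightarrow> 'e) \<Rightarrow> 'e \<Rightarrow> 'e) L brL \<pi>. lie_quotient sc K br (centre br K) scL L brL \<pi>"
proof -
  interpret V: vector_space sc using K by (simp add: lie_algebra_def)
  have sub: "module.subspace sc K" and cl: "\<And>x y. x \<in> K \<Longrightarrow> y \<in> K \<Longrightarrow> br x y \<in> K"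
    and addr: "\<And>x y z. x \<in> K \<Longrightarrow> y \<in> K \<Longrightarrow> z \<in> K \<Longrightarrow> br x (y + z) = br x y + br x z"
    and addl: "\<And>x y z. x \<in> K \<Longrightarrow> y \<in> K \<Longrightarrow> z \<in> K \<Longrightarrow> br (x + y) z = br x z + br y z"
    and scr: "\<And>c x y. x \<in> K \<Longrightarrow> y \<in> K \<Longrightarrow> br x (sc c y) = sc c (br x y)"
    and scl: "\<And>c x y. x \<in> K \<Longrightarrow> y \<in> K \<Longrightarrow> br (sc c x) y = sc c (br x y)"
    and alt: "\<And>x. x \<in> K \<Longrightarrow> br x x = 0"
    and jac: "\<And>x y z. x \<in> K \<Longrightarrow> y \<in> K \<Longrightarrow> z \<in> K \<Longrightarrow> br x (br y z) + br y (br z x) + br z (br x y) = 0"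
    using K by (auto simp: lie_algebra_def linear_on_def)
  have K0: "0 \<in> K" and Kadd: "\<And>x y. x \<in> K \<Longrightarrow> y \<in> K \<Longrightarrow> x + y \<in> K"
    and Ksc: "\<And>c x. x \<in> K \<Longrightarrow> sc c x \<in> K"
    using sub by (auto simp: V.subspace_def)
  have anti: "br x y = - br y x" if "x \<in> K" "y \<in> K" for x y
  proof -
    have "0 = br (x + y) (x + y)" using that by (simp add: alt Kadd)
    also have "\<dots> = br x y + br y x" using that by (subst addl; simp add: addr Kadd alt)
    finally show ?thesis by (simp add: eq_neg_iff_add_eq_0)
  qed
  define \<pi> where "\<pi> x = (\<lambda>y. if y \<in> K then br x y else 0)" for x
  define scL :: "'k \<Rightarrow> ('e \<Rightarrow> 'e) \<Rightarrow> 'e \<Rightarrow> 'e" where "scL c u = (\<lambda>y. sc c (u y))" for c u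
  define j where "j u = (SOME x. x \<in> K \<and> \<pi> x = u)" for u
  define brL where "brL u v = \<pi> (br (j u) (j v))" for u v
  have j: "j (\<pi> x) \<in> K" "\<pi> (j (\<pi> x)) = \<pi> x" if "x \<in> K" for x
    using someI[of "\<lambda>z. z \<in> K \<and> \<pi> z = \<pi> x" x] that by (auto simp: j_def)
  have \<pi>eq: "\<pi> x = \<pi> x' \<longleftrightarrow> (\<forall>y\<in>K. br x y = br x' y)" for x x'
    by (auto simp: \<pi>_def fun_eq_iff)
  have cong: "\<pi> (br x y) = \<pi> (br x' y')"
    if "x \<in> K" "x' \<in> K" "y \<in> K" "y' \<in> K" "\<pi> x = \<pi> x'" "\<pi> y = \<pi> y'" for x x' y y'
  proof -
    have "br x y = br x' y" using that by (auto simp: \<pi>eq)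
    also have "\<dots> = br x' y'" using that by (metis \<pi>eq anti)
    finally show ?thesis by simp
  qed
  have hom: "brL (\<pi> x) (\<pi> y) = \<pi> (br x y)" if "x \<in> K" "y \<in> K" for x y
    unfolding brL_def by (rule cong) (use that j in auto)
  have \<pi>add: "\<pi> (x + y) = \<pi> x + \<pi> y" if "x \<in> K" "y \<in> K" for x y
    using that by (auto simp: \<pi>_def fun_eq_iff addl)
  have \<pi>sc: "\<pi> (sc c x) = scL c (\<pi> x)" if "x \<in> K" for c x
    using that by (auto simp: \<pi>_def fun_eq_iff scl scL_def)
  have \<pi>0: "\<pi> 0 = 0" using \<pi>add[OF K0 K0] by simp
  have vs: "vector_space scL"
    by unfold_locales (auto simp: scL_def fun_eq_iff V.scale_right_distrib V.scale_left_distrib)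
  then interpret W: vector_space scL .
  have "W.subspace (\<pi> ` K)"
    unfolding W.subspace_def
    by (auto simp: \<pi>add[symmetric] \<pi>sc[symmetric] Kadd Ksc intro: image_eqI[where x = 0 and f = \<pi>, OF \<pi>0[symmetric] K0])
  then have "lie_algebra scL (\<pi> ` K) brL"
    unfolding lie_algebra_def linear_on_def
    by (simp add: vs hom \<pi>add[symmetric] \<pi>sc[symmetric] Kadd Ksc cl addl addr scl scr alt jac \<pi>0)
  moreover have "{x \<in> K. \<pi> x = 0} = centre br K"
    by (auto simp: centre_def \<pi>_def fun_eq_iff)
  ultimately have "lie_quotient sc K br (centre br K) scL (\<pi> ` K) brL \<pi>"
    by (auto simp: lie_quotient_def linear_on_def hom \<pi>add \<pi>sc)
  then show ?thesis by blast
qed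


section \<open>Toral pairs\<close>

definition weight_space ::
    "('k \<Rightarrow> 'e \<Rightarrow> 'e) \<Rightarrow> ('e \<Rightarrow> 'e \<Rightarrow> 'e) \<Rightarrow> 'e set \<Rightarrow> ('e \<Rightarrow> 'k) \<Rightarrow> 'e set"
  where "weight_space sc br T \<alpha> = {x. \<forall>t\<in>T. br t x = sc (\<alpha> t) x}"

definition toral_pair ::
    "('k::field \<Rightarrow> 'e::ab_group_add \<Rightarrow> 'e) \<Rightarrow> ('e \<Rightarrow> 'e \<Rightarrow> 'e) \<Rightarrow> 'e set \<Rightarrow> bool"
  where "toral_pair sc br T \<longleftrightarrow>
    lie_algebra sc UNIV br \<and> (\<exists>x::'e. x \<noteq> 0) \<and> module.subspace sc T \<and>
    direct_sum sc UNIV (dual sc T) (weight_space sc br T)"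

definition roots ::
    "('k::field \<Rightarrow> 'e::ab_group_add \<Rightarrow> 'e) \<Rightarrow> ('e \<Rightarrow> 'e \<Rightarrow> 'e) \<Rightarrow> 'e set \<Rightarrow> ('e \<Rightarrow> 'k) set"
  where "roots sc br T = {\<alpha> \<in> dual sc T. weight_space sc br T \<alpha> \<noteq> {0}}"

definition sl2_triple ::
    "('k::field \<Rightarrow> 'e::ab_group_add \<Rightarrow> 'e) \<Rightarrow> ('e \<Rightarrow> 'e \<Rightarrow> 'e) \<Rightarrow> 'e \<Rightarrow> 'e \<Rightarrow> 'e \<Rightarrow> bool"
  where "sl2_triple sc br e h f \<longleftrightarrow>
    (e, h, f) \<noteq> (0, 0, 0) \<and> br e f = - h \<and> br h e = sc 2 e \<and> br h f = sc (- 2) f"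

definition integrable_sl2_triple ::
    "('k::field \<Rightarrow> 'e::ab_group_add \<Rightarrow> 'e) \<Rightarrow> ('e \<Rightarrow> 'e \<Rightarrow> 'e) \<Rightarrow> 'e set \<Rightarrow> ('e \<Rightarrow> 'k) \<Rightarrow> 'e \<Rightarrow> 'e \<Rightarrow> 'e \<Rightarrow> bool"
  where "integrable_sl2_triple sc br T \<alpha> e h f \<longleftrightarrow>
    e \<in> weight_space sc br T \<alpha> \<and> h \<in> T \<and> f \<in> weight_space sc br T (- \<alpha>) \<and>
    sl2_triple sc br e h f \<and> locally_nilpotent (br e) \<and> locally_nilpotent (br f)"

definition int_roots ::
    "('k::field \<Rightarrow> 'e::ab_group_add \<Rightarrow> 'e) \<Rightarrow> ('e \<Rightarrow> 'e \<Rightarrow> 'e) \<Rightarrow> 'e set \<Rightarrow> ('e \<Rightarrow> 'k) set"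
  where "int_roots sc br T = {\<alpha> \<in> roots sc br T. \<exists>e h f. integrable_sl2_triple sc br T \<alpha> e h f}"


section \<open>Invariant affine reflection algebras\<close>

definition repr_elt :: "'e set \<Rightarrow> ('e \<Rightarrow> 'e \<Rightarrow> 'k) \<Rightarrow> ('e \<Rightarrow> 'k) \<Rightarrow> 'e"
  where "repr_elt T B \<alpha> = (THE t. t \<in> T \<and> (\<forall>s\<in>T. B t s = \<alpha> s))"

text \<open>Meaningful on the span of the roots, where \<open>\<alpha> \<mapsto> t\<^sub>\<alpha>\<close> is defined and linear.\<close>

definition form_X :: "'e set \<Rightarrow> ('e \<Rightarrow> 'e \<Rightarrow> 'k) \<Rightarrow> ('e \<Rightarrow> 'k) \<Rightarrow> ('e \<Rightarrow> 'k) \<Rightarrow> 'k"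
  where "form_X T B \<alpha> \<beta> = B (repr_elt T B \<alpha>) (repr_elt T B \<beta>)"

definition null_roots ::
    "('k::field \<Rightarrow> 'e::ab_group_add \<Rightarrow> 'e) \<Rightarrow> ('e \<Rightarrow> 'e \<Rightarrow> 'e) \<Rightarrow> 'e set \<Rightarrow> ('e \<Rightarrow> 'e \<Rightarrow> 'k) \<Rightarrow> ('e \<Rightarrow> 'k) set"
  where "null_roots sc br T B = {\<alpha> \<in> roots sc br T. form_X T B \<alpha> \<alpha> = 0}"

definition anisotropic_roots ::
    "('k::field \<Rightarrow> 'e::ab_group_add \<Rightarrow> 'e) \<Rightarrow> ('e \<Rightarrow> 'e \<Rightarrow> 'e) \<Rightarrow> 'e set \<Rightarrow> ('e \<Rightarrow> 'e \<Rightarrow> 'k) \<Rightarrow> ('e \<Rightarrow> 'k) set"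
  where "anisotropic_roots sc br T B = roots sc br T - null_roots sc br T B"

definition invariant_affine_reflection_algebra ::
    "('k::field \<Rightarrow> 'e::ab_group_add \<Rightarrow> 'e) \<Rightarrow> ('e \<Rightarrow> 'e \<Rightarrow> 'e) \<Rightarrow> 'e set \<Rightarrow> ('e \<Rightarrow> 'e \<Rightarrow> 'k) \<Rightarrow> bool"
  where "invariant_affine_reflection_algebra sc br T B \<longleftrightarrow>
    toral_pair sc br T \<and>
    bilinear_form_on sc UNIV B \<and> symmetric_on UNIV B \<and> invariant_on UNIV br B \<and>
    nondegenerate_on UNIV B \<and> nondegenerate_on T B \<and>
    (\<forall>\<alpha>\<in>roots sc br T. \<exists>!t. t \<in> T \<and> (\<forall>s\<in>T. B t s = \<alpha> s)) \<and>
    (\<forall>\<alpha>\<in>roots sc br T. \<alpha> \<noteq> 0 \<longrightarrow>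
      (\<exists>e\<in>weight_space sc br T \<alpha>. \<exists>f\<in>weight_space sc br T (- \<alpha>). br e f \<noteq> 0 \<and> br e f \<in> T)) \<and>
    (\<forall>\<alpha>\<in>anisotropic_roots sc br T B. \<forall>x\<in>weight_space sc br T \<alpha>. locally_nilpotent (br x))"

definition root_reflection ::
    "('k::field \<Rightarrow> 'e::ab_group_add \<Rightarrow> 'e) \<Rightarrow> ('e \<Rightarrow> 'e \<Rightarrow> 'e) \<Rightarrow> 'e set \<Rightarrow> ('e \<Rightarrow> 'e \<Rightarrow> 'k) \<Rightarrow>
     ('e \<Rightarrow> 'k) \<Rightarrow> ('e \<Rightarrow> 'k) \<Rightarrow> ('e \<Rightarrow> 'k)"
  where "root_reflection sc br T B \<alpha> x =
    (if \<alpha> \<in> anisotropic_roots sc br T B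
     then x - fun_sc (2 * form_X T B x \<alpha> / form_X T B \<alpha> \<alpha>) \<alpha> else x)"

definition core ::
    "('k::field \<Rightarrow> 'e::ab_group_add \<Rightarrow> 'e) \<Rightarrow> ('e \<Rightarrow> 'e \<Rightarrow> 'e) \<Rightarrow> 'e set \<Rightarrow> ('e \<Rightarrow> 'e \<Rightarrow> 'k) \<Rightarrow> 'e set"
  where "core sc br T B =
    subalgebra_generated sc br (\<Union>\<alpha>\<in>anisotropic_roots sc br T B. weight_space sc br T \<alpha>)"

definition tame_algebra ::
    "('k::field \<Rightarrow> 'e::ab_group_add \<Rightarrow> 'e) \<Rightarrow> ('e \<Rightarrow> 'e \<Rightarrow> 'e) \<Rightarrow> 'e set \<Rightarrow> ('e \<Rightarrow> 'e \<Rightarrow> 'k) \<Rightarrow> bool"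
  where "tame_algebra sc br T B \<longleftrightarrow> centralizer br (core sc br T B) \<subseteq> core sc br T B"


section \<open>Reflection systems\<close>

text \<open>Only the values \<open>s \<alpha> x\<close> for \<open>\<alpha> \<in> R\<close> and \<open>x \<in> X\<close> matter.\<close>

definition real_roots :: "'x set \<Rightarrow> 'x set \<Rightarrow> ('x \<Rightarrow> 'x \<Rightarrow> 'x) \<Rightarrow> 'x set"
  where "real_roots R X s = {\<alpha> \<in> R. \<exists>x\<in>X. s \<alpha> x \<noteq> x}"

definition imag_roots :: "'x set \<Rightarrow> 'x set \<Rightarrow> ('x \<Rightarrow> 'x \<Rightarrow> 'x) \<Rightarrow> 'x set"
  where "imag_roots R X s = R - real_roots R X s"

definition pre_reflection_system ::
    "('k::field \<Rightarrow> 'x::ab_group_add \<Rightarrow> 'x) \<Rightarrow> 'x set \<Rightarrow> 'x set \<Rightarrow> ('x \<Rightarrow> 'x \<Rightarrow> 'x) \<Rightarrow> bool"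
  where "pre_reflection_system sc R X s \<longleftrightarrow>
    vector_space sc \<and> 0 \<in> R \<and> X = module.span sc R \<and>
    (\<forall>\<alpha>\<in>R. linear_on sc sc X (s \<alpha>) \<and> bij_betw (s \<alpha>) X X) \<and>
    \<comment> \<open>the fixed space of \<open>s \<alpha>\<close> has codimension at most 1 in \<open>X\<close>\<close>
    (\<forall>\<alpha>\<in>R. \<exists>v\<in>X. X = module.span sc (insert v {x \<in> X. s \<alpha> x = x})) \<and>
    (\<forall>\<alpha>\<in>R. \<forall>x\<in>X. s \<alpha> (s \<alpha> x) = x) \<and>
    (\<forall>\<alpha>\<in>real_roots R X s. s \<alpha> \<alpha> = - \<alpha> \<and> - \<alpha> \<noteq> \<alpha>) \<and>
    (\<forall>\<alpha>\<in>R. s \<alpha> ` real_roots R X s = real_roots R X s \<and> s \<alpha> ` imag_roots R X s = imag_roots R X s)"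

definition coroot_pairing ::
    "('k::field \<Rightarrow> 'x::ab_group_add \<Rightarrow> 'x) \<Rightarrow> 'x set \<Rightarrow> 'x set \<Rightarrow> ('x \<Rightarrow> 'x \<Rightarrow> 'x) \<Rightarrow> 'x \<Rightarrow> 'x \<Rightarrow> 'k"
  where "coroot_pairing sc R X s x \<alpha> =
    (if \<alpha> \<in> real_roots R X s then (THE c. s \<alpha> x = x - sc c \<alpha>) else 0)"

definition reflection_morphism ::
    "('k::field \<Rightarrow> 'x::ab_group_add \<Rightarrow> 'x) \<Rightarrow> 'x set \<Rightarrow> 'x set \<Rightarrow> ('x \<Rightarrow> 'x \<Rightarrow> 'x) \<Rightarrow>
     ('k \<Rightarrow> 'y::ab_group_add \<Rightarrow> 'y) \<Rightarrow> 'y set \<Rightarrow> 'y set \<Rightarrow> ('y \<Rightarrow> 'y \<Rightarrow> 'y) \<Rightarrow> ('x \<Rightarrow> 'y) \<Rightarrow> bool"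
  where "reflection_morphism scX R X s scY S Y sS f \<longleftrightarrow>
    linear_on scX scY X f \<and> f ` X \<subseteq> Y \<and> f ` R \<subseteq> S \<and>
    (\<forall>\<alpha>\<in>R. \<forall>\<beta>\<in>R. f (s \<alpha> \<beta>) = sS (f \<alpha>) (f \<beta>))"

definition reflection_extension ::
    "('k::field \<Rightarrow> 'x::ab_group_add \<Rightarrow> 'x) \<Rightarrow> 'x set \<Rightarrow> 'x set \<Rightarrow> ('x \<Rightarrow> 'x \<Rightarrow> 'x) \<Rightarrow>
     ('k \<Rightarrow> 'y::ab_group_add \<Rightarrow> 'y) \<Rightarrow> 'y set \<Rightarrow> 'y set \<Rightarrow> ('y \<Rightarrow> 'y \<Rightarrow> 'y) \<Rightarrow> ('x \<Rightarrow> 'y) \<Rightarrow> bool"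
  where "reflection_extension scX R X s scY S Y sS f \<longleftrightarrow>
    reflection_morphism scX R X s scY S Y sS f \<and>
    f ` imag_roots R X s = imag_roots S Y sS \<and> f ` real_roots R X s = real_roots S Y sS"

definition locally_finite_root_system ::
    "('k::field \<Rightarrow> 'y::ab_group_add \<Rightarrow> 'y) \<Rightarrow> 'y set \<Rightarrow> 'y set \<Rightarrow> ('y \<Rightarrow> 'y \<Rightarrow> 'y) \<Rightarrow> bool"
  where "locally_finite_root_system sc S Y s \<longleftrightarrow>
    pre_reflection_system sc S Y s \<and>
    (\<forall>\<alpha>\<in>S. \<forall>\<beta>\<in>S. coroot_pairing sc S Y s \<alpha> \<beta> \<in> \<int>) \<and>
    S = real_roots S Y s \<union> {0} \<and>
    (\<forall>A. finite A \<and> A \<subseteq> Y \<longrightarrow> finite (S \<inter> module.span sc A))"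

text \<open>An extension onto \<open>(S, Y)\<close> maps \<open>X\<close> onto \<open>Y\<close>, so \<open>Y\<close> is isomorphic to a complement of its
  kernel in \<open>X\<close>; hence it is no restriction to look for \<open>Y\<close> in the ambient space of \<open>X\<close>.\<close>

definition affine_reflection_system ::
    "('k::field \<Rightarrow> 'x::ab_group_add \<Rightarrow> 'x) \<Rightarrow> 'x set \<Rightarrow> 'x set \<Rightarrow> ('x \<Rightarrow> 'x \<Rightarrow> 'x) \<Rightarrow> bool"
  where "affine_reflection_system sc R X s \<longleftrightarrow>
    pre_reflection_system sc R X s \<and>
    (\<exists>(S::'x set) Y sS f. locally_finite_root_system sc S Y sS \<and> reflection_extension sc R X s sc S Y sS f)"

definition symmetric_roots :: "'x::uminus set \<Rightarrow> bool"
  where "symmetric_roots R \<longleftrightarrow> R = uminus ` R"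

definition tame_roots :: "'x::plus set \<Rightarrow> 'x set \<Rightarrow> ('x \<Rightarrow> 'x \<Rightarrow> 'x) \<Rightarrow> bool"
  where "tame_roots R X s \<longleftrightarrow>
    imag_roots R X s \<subseteq> {\<alpha> + \<beta> | \<alpha> \<beta>. \<alpha> \<in> real_roots R X s \<and> \<beta> \<in> real_roots R X s}"

definition indivisible_part :: "('k::field \<Rightarrow> 'y::ab_group_add \<Rightarrow> 'y) \<Rightarrow> 'y set \<Rightarrow> 'y set"
  where "indivisible_part sc S = {0} \<union> {\<alpha> \<in> S. sc (1 / 2) \<alpha> \<notin> S}"

definition partial_section ::
    "('k::field \<Rightarrow> 'x::ab_group_add \<Rightarrow> 'x) \<Rightarrow> 'x set \<Rightarrow> 'x set \<Rightarrow> ('x \<Rightarrow> 'x \<Rightarrow> 'x) \<Rightarrow>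
     ('k \<Rightarrow> 'y::ab_group_add \<Rightarrow> 'y) \<Rightarrow> 'y set \<Rightarrow> 'y set \<Rightarrow> ('y \<Rightarrow> 'y \<Rightarrow> 'y) \<Rightarrow> ('x \<Rightarrow> 'y) \<Rightarrow> ('y \<Rightarrow> 'x) \<Rightarrow> bool"
  where "partial_section scX R X s scY S Y sS f g \<longleftrightarrow>
    reflection_morphism scY (indivisible_part scY S) Y sS scX R X s g \<and> (\<forall>y\<in>Y. f (g y) = y)"


section \<open>The grading of the core\<close>

definition Lambda_at ::
    "'x::ab_group_add set \<Rightarrow> 'x set \<Rightarrow> ('x \<Rightarrow> 'y::ab_group_add) \<Rightarrow> ('y \<Rightarrow> 'x) \<Rightarrow> 'y \<Rightarrow> 'x set"
  where "Lambda_at R X f g \<xi> = {\<nu> \<in> X. f \<nu> = 0 \<and> g \<xi> + \<nu> \<in> R}"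

definition Lambda ::
    "'x::ab_group_add set \<Rightarrow> 'x set \<Rightarrow> 'y set \<Rightarrow> ('x \<Rightarrow> 'y::ab_group_add) \<Rightarrow> ('y \<Rightarrow> 'x) \<Rightarrow> 'x set"
  where "Lambda R X S f g = group_closure (\<Union>\<xi>\<in>S. Lambda_at R X f g \<xi>)"

text \<open>\<open>K\<^sub>q\<^sup>\<nu>\<close> for all \<open>q\<close> in the root lattice, being zero when \<open>q\<close> is not in \<open>S\<close>\<close>

definition core_component ::
    "('k::field \<Rightarrow> 'e::ab_group_add \<Rightarrow> 'e) \<Rightarrow> ('e \<Rightarrow> 'e \<Rightarrow> 'e) \<Rightarrow> 'e set \<Rightarrow>
     'y::ab_group_add set \<Rightarrow> ('y \<Rightarrow> 'e \<Rightarrow> 'k) \<Rightarrow> ('e \<Rightarrow> 'k) set \<Rightarrow> 'y \<Rightarrow> ('e \<Rightarrow> 'k) \<Rightarrow> 'e set"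
  where "core_component sc br T S g \<Lambda> q \<nu> =
    (if q \<in> S \<and> q \<noteq> 0 then weight_space sc br T (g q + \<nu>)
     else if q = 0 then module.span sc {br x y | x y \<tau> \<mu>. \<tau> \<in> S - {0} \<and> \<mu> \<in> \<Lambda> \<and>
        x \<in> weight_space sc br T (g \<tau> + \<mu>) \<and> y \<in> weight_space sc br T (- g \<tau> + (\<nu> - \<mu>))}
     else {0})"


section \<open>Root-graded Lie algebras\<close>

text \<open>The homogeneous component \<open>G q \<nu>\<close> matters only for \<open>q\<close> in the root lattice and \<open>\<nu> \<in> \<Lambda>\<close>.\<close>

abbreviation root_lattice :: "'y::ab_group_add set \<Rightarrow> 'y set"
  where "root_lattice S \<equiv> group_closure S"

definition graded_lie_algebra ::
    "('k::field \<Rightarrow> 'l::ab_group_add \<Rightarrow> 'l) \<Rightarrow> 'l set \<Rightarrow> ('l \<Rightarrow> 'l \<Rightarrow> 'l) \<Rightarrow>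
     'y::ab_group_add set \<Rightarrow> 'z::ab_group_add set \<Rightarrow> ('y \<Rightarrow> 'z \<Rightarrow> 'l set) \<Rightarrow> bool"
  where "graded_lie_algebra sc L br Q \<Lambda> G \<longleftrightarrow>
    lie_algebra sc L br \<and> direct_sum sc L (Q \<times> \<Lambda>) (\<lambda>(q, \<nu>). G q \<nu>) \<and>
    (\<forall>p\<in>Q. \<forall>q\<in>Q. \<forall>\<nu>\<in>\<Lambda>. \<forall>\<mu>\<in>\<Lambda>. \<forall>x\<in>G p \<nu>. \<forall>y\<in>G q \<mu>. br x y \<in> G (p + q) (\<nu> + \<mu>))"

definition root_component ::
    "('k::field \<Rightarrow> 'l::ab_group_add \<Rightarrow> 'l) \<Rightarrow> 'z set \<Rightarrow> ('y \<Rightarrow> 'z \<Rightarrow> 'l set) \<Rightarrow> 'y \<Rightarrow> 'l set"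
  where "root_component sc \<Lambda> G q = module.span sc (\<Union>\<nu>\<in>\<Lambda>. G q \<nu>)"

definition lambda_component ::
    "('k::field \<Rightarrow> 'l::ab_group_add \<Rightarrow> 'l) \<Rightarrow> 'y::ab_group_add set \<Rightarrow> ('y \<Rightarrow> 'z \<Rightarrow> 'l set) \<Rightarrow> 'z \<Rightarrow> 'l set"
  where "lambda_component sc S G \<nu> = module.span sc (\<Union>q\<in>root_lattice S. G q \<nu>)"

text \<open>\<open>e\<close> is an invertible element of \<open>G \<alpha> \<nu>\<close> with inverse \<open>f\<close>.\<close>

definition invertible_pair ::
    "('k::field \<Rightarrow> 'l::ab_group_add \<Rightarrow> 'l) \<Rightarrow> ('l \<Rightarrow> 'l \<Rightarrow> 'l) \<Rightarrow>
     ('k \<Rightarrow> 'y::ab_group_add \<Rightarrow> 'y) \<Rightarrow> 'y set \<Rightarrow> 'y set \<Rightarrow> ('y \<Rightarrow> 'y \<Rightarrow> 'y) \<Rightarrow>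
     'z::ab_group_add set \<Rightarrow> ('y \<Rightarrow> 'z \<Rightarrow> 'l set) \<Rightarrow> 'y \<Rightarrow> 'z \<Rightarrow> 'l \<Rightarrow> 'l \<Rightarrow> bool"
  where "invertible_pair sc br scY S Y s \<Lambda> G \<alpha> \<nu> e f \<longleftrightarrow>
    e \<in> G \<alpha> \<nu> \<and> e \<noteq> 0 \<and> f \<in> G (- \<alpha>) (- \<nu>) \<and>
    (\<forall>q\<in>root_lattice S. \<forall>x\<in>root_component sc \<Lambda> G q.
      br (br f e) x = sc (coroot_pairing scY S Y s q \<alpha>) x)"

definition predivision_graded ::
    "('k::field \<Rightarrow> 'l::ab_group_add \<Rightarrow> 'l) \<Rightarrow> 'l set \<Rightarrow> ('l \<Rightarrow> 'l \<Rightarrow> 'l) \<Rightarrow>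
     ('k \<Rightarrow> 'y::ab_group_add \<Rightarrow> 'y) \<Rightarrow> 'y set \<Rightarrow> 'y set \<Rightarrow> ('y \<Rightarrow> 'y \<Rightarrow> 'y) \<Rightarrow>
     'z::ab_group_add set \<Rightarrow> ('y \<Rightarrow> 'z \<Rightarrow> 'l set) \<Rightarrow> bool"
  where "predivision_graded sc L br scY S Y s \<Lambda> G \<longleftrightarrow>
    locally_finite_root_system scY S Y s \<and> group_closure \<Lambda> = \<Lambda> \<and>
    graded_lie_algebra sc L br (root_lattice S) \<Lambda> G \<and>
    (\<forall>q\<in>root_lattice S - S. root_component sc \<Lambda> G q = {0}) \<and>
    (\<forall>\<alpha>\<in>indivisible_part scY S - {0}. \<exists>e f. invertible_pair sc br scY S Y s \<Lambda> G \<alpha> 0 e f) \<and>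
    root_component sc \<Lambda> G 0 = module.span sc {br x y | x y \<alpha>. \<alpha> \<in> S - {0} \<and>
      x \<in> root_component sc \<Lambda> G \<alpha> \<and> y \<in> root_component sc \<Lambda> G (- \<alpha>)} \<and>
    (\<forall>\<alpha>\<in>S - {0}. \<forall>\<nu>\<in>\<Lambda>. G \<alpha> \<nu> \<noteq> {0} \<longrightarrow>
      (\<exists>e f. invertible_pair sc br scY S Y s \<Lambda> G \<alpha> \<nu> e f))"

definition invariant_root_graded ::
    "('k::field \<Rightarrow> 'l::ab_group_add \<Rightarrow> 'l) \<Rightarrow> 'l set \<Rightarrow> ('l \<Rightarrow> 'l \<Rightarrow> 'l) \<Rightarrow>
     ('k \<Rightarrow> 'y::ab_group_add \<Rightarrow> 'y) \<Rightarrow> 'y set \<Rightarrow> 'y set \<Rightarrow> ('y \<Rightarrow> 'y \<Rightarrow> 'y) \<Rightarrow>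
     'z::ab_group_add set \<Rightarrow> ('y \<Rightarrow> 'z \<Rightarrow> 'l set) \<Rightarrow> ('l \<Rightarrow> 'l \<Rightarrow> 'k) \<Rightarrow> bool"
  where "invariant_root_graded sc L br scY S Y s \<Lambda> G B \<longleftrightarrow>
    bilinear_form_on sc L B \<and> symmetric_on L B \<and> invariant_on L br B \<and> nondegenerate_on L B \<and>
    (\<forall>\<nu>\<in>\<Lambda>. \<forall>\<mu>\<in>\<Lambda>. \<nu> + \<mu> \<noteq> 0 \<longrightarrow>
      (\<forall>x\<in>lambda_component sc S G \<nu>. \<forall>y\<in>lambda_component sc S G \<mu>. B x y = 0)) \<and>
    (\<exists>e f. (\<forall>\<alpha>\<in>indivisible_part scY S - {0}. invertible_pair sc br scY S Y s \<Lambda> G \<alpha> 0 (e \<alpha>) (f \<alpha>)) \<and>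
      nondegenerate_on (module.span sc {br (e \<alpha>) (f \<alpha>) | \<alpha>. \<alpha> \<in> indivisible_part scY S - {0}}) B)"

end

theory Submission
  imports Defs "HOL-Library.FuncSet"
begin

text \<open>
  The proof starts in rank one. By invariance, a bracket \<open>[e, f] \<in> T\<close> with \<open>e \<in> E\<^sub>\<alpha>\<close>, \<open>f \<in> E\<^sub>-\<^sub>\<alpha>\<close> equals
  \<open>(e|f) t\<^sub>\<alpha>\<close>, so every root \<open>\<alpha>\<close> admits a pair with \<open>[e, f] = - t\<^sub>\<alpha>\<close> (\<open>root_pair\<close>). If \<open>\<alpha>\<close> is anisotropic,
  rescaling makes this pair an integrable \<open>sl\<^sub>2\<close>-triple, and lowest weight vectors produce integral,
  unbroken root strings (\<open>root_string\<close>). If \<open>\<alpha>\<close> is isotropic, the pair generates a Heisenberg algebra;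
  were \<open>(\<beta>|\<alpha>) \<noteq> 0\<close> for some root \<open>\<beta>\<close>, its action would make a whole ray \<open>\<gamma> \<plusminus> n\<alpha>\<close> consist of roots, whose
  Cartan integers with \<open>\<alpha>\<close> have the form \<open>1/(q \<plusminus> n)\<close> and cannot all be integers
  (\<open>isotropic_orthogonal\<close>). Hence the isotropic roots are exactly the roots in the radical of the form.

  Strings and the radical suffice for the combinatorics, which is developed for an arbitrary set of
  vectors with a form (locale \<open>root_string_form\<close>). A reflection moves a root inside its string, so it
  permutes the roots. Dividing by the radical gives the quotient root system; the point is its local
  finiteness. The form need not be definite, so the classical bound \<open>4 cos\<^sup>2\<close> for products of Cartan
  integers is replaced by an arithmetic one: a very long \<open>\<alpha>\<close>-string through \<open>\<beta>\<close> has a member \<open>\<gamma>\<close> near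
  its middle for which the integer \<open>\<langle>\<alpha>, \<gamma>\<^sup>\<or>\<rangle>\<close> would be nonzero and smaller than one in absolute value
  (\<open>cartan_integer_lower_bound\<close>). The roots in a finite-dimensional subspace are then told apart by
  finitely many Cartan integers of absolute value at most \<open>6\<close>.

  Tameness: if an isotropic root \<open>\<alpha> \<noteq> 0\<close> is not a sum of two anisotropic roots, then \<open>E\<^sub>\<alpha>\<close> and \<open>E\<^sub>-\<^sub>\<alpha>\<close>
  centralize the core; in a tame algebra they lie in the core and therefore commute, although
  \<open>[e, f] = - t\<^sub>\<alpha> \<noteq> 0\<close>.

  For the core \<open>K\<close>, all components of the grading are contained in weight spaces with distinct weights
  \<open>g q + \<nu>\<close>, so the grading by \<open>Q(S) \<oplus> \<Lambda>\<close> and its passage to \<open>K/Z(K)\<close> are consequences of the weight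
  decomposition. The kernel of the extension \<open>f\<close> pairs to zero with all coroots, hence \<open>h\<^sub>\<alpha>\<close> acts on the
  component of degree \<open>q\<close> by the Cartan number of \<open>q\<close>, and root vectors from \<open>sl\<^sub>2\<close>-triples become invertible
  elements. Finally \<open>K\<close> is a perfect ideal of \<open>E\<close>. Perfectness gives \<open>(Z(K)|K) = 0\<close>; the ideal property
  together with nondegeneracy on \<open>E\<close> gives the converse, that an element of \<open>K\<close> orthogonal to \<open>K\<close> is
  central. So the form descends to a nondegenerate form on \<open>K/Z(K)\<close>.
\<close>

section \<open>Reflection systems defined by a form\<close>

text \<open>Applied to the radical of a form: the image of the projection is a model of the quotient by the
  radical inside the given space.\<close>
lemma (in vector_space) linear_projection_along:
  assumes "subspace N" "N \<subseteq> span X"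
  obtains f where "module_hom scale scale f" "\<And>x. x \<in> span X \<Longrightarrow> f x - x \<in> N"
    "\<And>x. x \<in> N \<Longrightarrow> f x = 0"
proof -
  interpret P: vector_space_pair scale scale ..
  obtain C where C: "C \<subseteq> N" "independent C" "N \<subseteq> span C"
    by (rule maximal_independent_subset_extend[of "{}" N]) (auto simp: independent_empty)
  obtain D where D: "C \<subseteq> D" "independent D" "span X \<subseteq> span D"
    using maximal_independent_subset_extend[of C "span X"] C assms by (metis order_trans)
  define f where "f = P.construct D (\<lambda>d. if d \<in> C then 0 else d)"
  have lin: "module_hom scale scale f"
    using P.linear_construct[OF D(2)] by (simp add: f_def Vector_Spaces.linear_iff_module_hom)
  then interpret f: module_hom scale scale f .
  have fD: "f d = (if d \<in> C then 0 else d)" if "d \<in> D" for d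
    unfolding f_def by (rule P.construct_basis[OF D(2) that])
  have spanC: "span C = N" using C assms by (metis span_mono span_eq_iff subset_antisym)
  show thesis
  proof
    show "module_hom scale scale f" by (rule lin)
    fix x
    {
      assume "x \<in> span X"
      then have "x \<in> span D" using D by blast
      then show "f x - x \<in> N"
      proof (induction rule: span_induct_alt)
        case base
        then show ?case using assms by (simp add: subspace_0)
      next
        case (step c y z)
        have "f y - y \<in> N"
          using fD[OF step(1)] C(1) assms by (auto simp: subspace_0 subspace_neg)
        then have "scale c (f y - y) + (f z - z) \<in> N"
          using step assms by (simp add: subspace_add subspace_scale)
        then show ?case by (simp add: f.add f.scale algebra_simps)
      qed
    }
    {
      assume "x \<in> N"
      then have "x \<in> span C" using spanC by simp
      then show "f x = 0"
      proof (induction rule: span_induct_alt)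
        case (step c y z)
        then show ?case using fD[of y] D(1) by (auto simp: f.add f.scale)
      qed simp
    }
  qed
qed
text \<open>The two properties of the roots of an invariant affine reflection algebra that determine an affine
  reflection system: isotropic roots are orthogonal to all roots, and the string of an anisotropic
  root through any root extends from \<open>-m\<close> to \<open>n\<close> with \<open>m - n\<close> the Cartan integer. The axioms pass to images
  under maps that preserve the form, which is how the quotient root system is obtained.\<close>
locale root_string_form = vector_space sc
  for sc :: "'k::field_char_0 \<Rightarrow> 'x::ab_group_add \<Rightarrow> 'x" +
  fixes R :: "'x set" and b :: "'x \<Rightarrow> 'x \<Rightarrow> 'k"
  assumes zero_root: "0 \<in> R"
    and form: "bilinear_form_on sc (span R) b"
    and form_sym: "symmetric_on (span R) b"
    and isotropic_radical: "\<alpha> \<in> R \<Longrightarrow> b \<alpha> \<alpha> = 0 \<Longrightarrow> \<beta> \<in> R \<Longrightarrow> b \<beta> \<alpha> = 0"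
    and string: "\<alpha> \<in> R \<Longrightarrow> b \<alpha> \<alpha> \<noteq> 0 \<Longrightarrow> \<beta> \<in> R \<Longrightarrow>
      \<exists>m n::nat. 2 * b \<beta> \<alpha> = (of_nat m - of_nat n) * b \<alpha> \<alpha> \<and>
        (\<forall>i::int. - int m \<le> i \<and> i \<le> int n \<longrightarrow> \<beta> + sc (of_int i) \<alpha> \<in> R)"
begin

definition refl :: "'x \<Rightarrow> 'x \<Rightarrow> 'x"
  where "refl \<alpha> x = (if \<alpha> \<in> R \<and> b \<alpha> \<alpha> \<noteq> 0 then x - sc (2 * b x \<alpha> / b \<alpha> \<alpha>) \<alpha> else x)"

lemma rootX: "\<alpha> \<in> R \<Longrightarrow> \<alpha> \<in> span R"
  by (rule span_base)

lemma form_add_left: "x \<in> span R \<Longrightarrow> y \<in> span R \<Longrightarrow> z \<in> span R \<Longrightarrow> b (x + y) z = b x z + b y z"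
  and form_add_right: "x \<in> span R \<Longrightarrow> y \<in> span R \<Longrightarrow> z \<in> span R \<Longrightarrow> b x (y + z) = b x y + b x z"
  and form_scale_left: "x \<in> span R \<Longrightarrow> z \<in> span R \<Longrightarrow> b (sc c x) z = c * b x z"
  and form_scale_right: "x \<in> span R \<Longrightarrow> z \<in> span R \<Longrightarrow> b x (sc c z) = c * b x z"
  using form by (auto simp: bilinear_form_on_def linear_on_def)

lemma form_commute: "x \<in> span R \<Longrightarrow> y \<in> span R \<Longrightarrow> b x y = b y x"
  using form_sym by (auto simp: symmetric_on_def)

lemma form_zero_left: "z \<in> span R \<Longrightarrow> b 0 z = 0"
  using form_scale_left[of 0 z 0] span_zero by simp

lemma form_diff_left: "x \<in> span R \<Longrightarrow> y \<in> span R \<Longrightarrow> z \<in> span R \<Longrightarrow> b (x - y) z = b x z - b y z"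
  using form_add_left[of "x - y" y z] span_diff[of x R y] by simp

lemma form_diff_right: "x \<in> span R \<Longrightarrow> y \<in> span R \<Longrightarrow> z \<in> span R \<Longrightarrow> b x (y - z) = b x y - b x z"
  using form_add_right[of x "y - z" z] span_diff[of y R z] by simp

lemmas form_simps = form_add_left form_add_right form_scale_left form_scale_right
  form_diff_left form_diff_right form_zero_left rootX span_add span_scale span_diff span_zero

lemma refl_span: "x \<in> span R \<Longrightarrow> refl \<alpha> x \<in> span R"
  by (simp add: refl_def form_simps)

lemma form_refl:
  assumes "x \<in> span R" "y \<in> span R"
  shows "b (refl \<alpha> x) (refl \<alpha> y) = b x y"
proof (cases "\<alpha> \<in> R \<and> b \<alpha> \<alpha> \<noteq> 0")
  case True
  define c d where "c = 2 * b x \<alpha> / b \<alpha> \<alpha>" and "d = 2 * b y \<alpha> / b \<alpha> \<alpha>"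
  have cd: "c * b \<alpha> \<alpha> = 2 * b x \<alpha>" "d * b \<alpha> \<alpha> = 2 * b y \<alpha>"
    using True by (simp_all add: c_def d_def)
  have comm: "b \<alpha> y = b y \<alpha>" using True assms form_commute rootX by blast
  have "b (x - sc c \<alpha>) (y - sc d \<alpha>) = b x y - d * b x \<alpha> - c * b y \<alpha> + d * (c * b \<alpha> \<alpha>)"
    using True assms by (simp add: form_simps comm algebra_simps)
  also have "\<dots> = b x y + d * b x \<alpha> - c * b y \<alpha>" unfolding cd by simp
  also have "d * b x \<alpha> = c * b y \<alpha>" by (simp add: c_def d_def)
  finally show ?thesis using True by (simp add: refl_def c_def d_def)
qed (simp add: refl_def)

lemma refl_involution: "x \<in> span R \<Longrightarrow> refl \<alpha> (refl \<alpha> x) = x"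
proof (cases "\<alpha> \<in> R \<and> b \<alpha> \<alpha> \<noteq> 0")
  case True
  assume x: "x \<in> span R"
  let ?c = "2 * b x \<alpha> / b \<alpha> \<alpha>"
  have "b (x - sc ?c \<alpha>) \<alpha> = - b x \<alpha>"
    using True x by (simp add: form_simps)
  then show ?thesis using True by (simp add: refl_def)
qed (simp add: refl_def)

text \<open>With \<open>\<langle>\<beta>, \<alpha>\<^sup>\<or>\<rangle> = m - n\<close> the reflection of \<open>\<beta>\<close> is \<open>\<beta> + (n - m) \<alpha>\<close>, and \<open>-m \<le> n - m \<le> n\<close>.\<close>
lemma refl_root: assumes "\<beta> \<in> R" shows "refl \<alpha> \<beta> \<in> R"
proof (cases "\<alpha> \<in> R \<and> b \<alpha> \<alpha> \<noteq> 0")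
  case True
  with string assms obtain m n :: nat
    where mn: "2 * b \<beta> \<alpha> = (of_nat m - of_nat n) * b \<alpha> \<alpha>"
      and str: "\<And>i::int. - int m \<le> i \<Longrightarrow> i \<le> int n \<Longrightarrow> \<beta> + sc (of_int i) \<alpha> \<in> R" by blast
  have "2 * b \<beta> \<alpha> / b \<alpha> \<alpha> = - of_int (int n - int m)"
    using True by (simp add: mn)
  then have "refl \<alpha> \<beta> = \<beta> - sc (- of_int (int n - int m)) \<alpha>"
    using True by (simp only: refl_def simp_thms if_True)
  then have "refl \<alpha> \<beta> = \<beta> + sc (of_int (int n - int m)) \<alpha>"
    by (simp only: scale_minus_left diff_minus_eq_add)
  then show ?thesis using str[of "int n - int m"] by simp
qed (simp add: refl_def assms)

lemma refl_self: "refl \<alpha> \<alpha> = - \<alpha>" if "\<alpha> \<in> R" "b \<alpha> \<alpha> \<noteq> 0"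
  using that scale_left_distrib[of 1 1 \<alpha>] by (simp add: refl_def)

lemma neg_neq_self: "- \<alpha> \<noteq> \<alpha>" if "\<alpha> \<noteq> 0" for \<alpha> :: 'x
proof
  assume "- \<alpha> = \<alpha>"
  then have "sc 2 \<alpha> = 0" using scale_left_distrib[of 1 1 \<alpha>] by (metis add.right_inverse one_add_one scale_one)
  with that show False by simp
qed

lemma anisotropic_nonzero: "b \<alpha> \<alpha> \<noteq> 0 \<Longrightarrow> \<alpha> \<noteq> 0"
  using form_zero_left[of 0] span_zero by auto

lemma real_roots_refl: "real_roots R (span R) refl = {\<alpha> \<in> R. b \<alpha> \<alpha> \<noteq> 0}"
  using refl_self neg_neq_self anisotropic_nonzero rootX
  by (fastforce simp: real_roots_def refl_def split: if_splits)

lemma imag_roots_refl: "imag_roots R (span R) refl = {\<alpha> \<in> R. b \<alpha> \<alpha> = 0}"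
  by (auto simp: imag_roots_def real_roots_refl)

lemma linear_on_refl: "linear_on sc sc (span R) (refl \<alpha>)"
proof -
  have "2 * b (x + y) \<alpha> / b \<alpha> \<alpha> = 2 * b x \<alpha> / b \<alpha> \<alpha> + 2 * b y \<alpha> / b \<alpha> \<alpha>"
    if "x \<in> span R" "y \<in> span R" "\<alpha> \<in> R" for x y
    using that by (simp add: form_simps field_simps add_divide_distrib)
  then show ?thesis
    by (auto simp: linear_on_def refl_def scale_left_distrib scale_right_diff_distrib form_simps mult.left_commute)
qed

lemma refl_image: 
  assumes "\<And>\<beta>. \<beta> \<in> A \<Longrightarrow> refl \<alpha> \<beta> \<in> A" "A \<subseteq> span R" shows "refl \<alpha> ` A = A"
proof
  show "A \<subseteq> refl \<alpha> ` A"
  proof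
    fix \<beta> assume "\<beta> \<in> A"
    then show "\<beta> \<in> refl \<alpha> ` A"
      using assms refl_involution[of \<beta> \<alpha>] by (intro image_eqI[of _ _ "refl \<alpha> \<beta>"]) auto
  qed
qed (use assms in auto)

lemma pre_reflection_system_refl: "pre_reflection_system sc R (span R) refl"
proof -
  have "bij_betw (refl \<alpha>) (span R) (span R)" for \<alpha>
    by (rule bij_betw_byWitness[of _ "refl \<alpha>"]) (auto simp: refl_involution refl_span)
  moreover have "\<exists>v\<in>span R. span R = span (insert v {x \<in> span R. refl \<alpha> x = x})" if \<alpha>: "\<alpha> \<in> R" for \<alpha>
  proof (cases "b \<alpha> \<alpha> = 0")
    case True
    then have "{x \<in> span R. refl \<alpha> x = x} = span R" by (auto simp: refl_def)
    then show ?thesis using span_zero by (intro bexI[of _ 0]) (auto simp: insert_absorb span_span)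
  next
    case False
    have "x \<in> span (insert \<alpha> {x \<in> span R. refl \<alpha> x = x})" if x: "x \<in> span R" for x
    proof -
      let ?y = "x - sc (b x \<alpha> / b \<alpha> \<alpha>) \<alpha>"
      have "b ?y \<alpha> = 0" using False x \<alpha> by (simp add: form_simps)
      then have "?y \<in> {x \<in> span R. refl \<alpha> x = x}"
        using x \<alpha> by (simp add: refl_def form_simps)
      then have "?y + sc (b x \<alpha> / b \<alpha> \<alpha>) \<alpha> \<in> span (insert \<alpha> {x \<in> span R. refl \<alpha> x = x})"
        by (intro span_add span_scale) (auto intro: span_base)
      then show ?thesis by simp
    qed
    moreover have "span (insert \<alpha> {x \<in> span R. refl \<alpha> x = x}) \<subseteq> span R"
      using \<alpha> by (intro span_minimal) (auto intro: rootX)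
    ultimately show ?thesis using \<alpha> rootX by (intro bexI[of _ \<alpha>]) auto
  qed
  moreover have "refl \<alpha> ` real_roots R (span R) refl = real_roots R (span R) refl"
     "refl \<alpha> ` imag_roots R (span R) refl = imag_roots R (span R) refl" for \<alpha>
    by (intro refl_image; auto simp: real_roots_refl imag_roots_refl refl_root form_refl rootX)+
  moreover have "vector_space sc" ..
  ultimately show ?thesis
    using zero_root linear_on_refl refl_involution refl_self
    unfolding pre_reflection_system_def
    by (simp add: real_roots_refl) (metis neg_neq_self anisotropic_nonzero)
qed

lemma coroot_pairing_refl:
  assumes "x \<in> span R" "\<alpha> \<in> R" "b \<alpha> \<alpha> \<noteq> 0"
  shows "coroot_pairing sc R (span R) refl x \<alpha> = 2 * b x \<alpha> / b \<alpha> \<alpha>"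
proof -
  have "(THE c. refl \<alpha> x = x - sc c \<alpha>) = 2 * b x \<alpha> / b \<alpha> \<alpha>"
    using assms anisotropic_nonzero by (intro the_equality) (auto simp: refl_def)
  then show ?thesis using assms by (simp add: coroot_pairing_def real_roots_refl)
qed

lemma cartan_integer:
  assumes "\<alpha> \<in> R" "b \<alpha> \<alpha> \<noteq> 0" "\<beta> \<in> R"
  obtains n :: int where "2 * b \<beta> \<alpha> = of_int n * b \<alpha> \<alpha>"
  using string[OF assms] by (metis of_int_diff of_int_of_nat_eq)

text \<open>Let \<open>\<langle>\<beta>, \<alpha>\<^sup>\<or>\<rangle> = -m\<close> and \<open>p = \<langle>\<alpha>, \<beta>\<^sup>\<or>\<rangle>\<close>. For \<open>0 \<le> i \<le> m\<close> the vector \<open>\<gamma> = \<beta> + i\<alpha>\<close> is a root, and integrality of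
  \<open>\<langle>\<alpha>, \<gamma>\<^sup>\<or>\<rangle>\<close> says that \<open>m + i(m - i)p\<close> divides \<open>p(m - 2i)\<close>. Near the middle of the string the dividend is
  \<open>p\<close> or \<open>2p\<close>, while the divisor grows quadratically in \<open>m\<close>; from \<open>m = 7\<close> on this is impossible.\<close>
lemma cartan_integer_lower_bound:
  assumes \<alpha>: "\<alpha> \<in> R" "b \<alpha> \<alpha> \<noteq> 0" and \<beta>: "\<beta> \<in> R"
    and N: "2 * b \<beta> \<alpha> = of_int N * b \<alpha> \<alpha>"
  shows "- 6 \<le> N"
proof (rule ccontr)
  assume less: "\<not> ?thesis"
  define m where "m = - N"
  have m: "m \<ge> 7" and ab: "2 * b \<beta> \<alpha> = - of_int m * b \<alpha> \<alpha>"
    using less N by (auto simp: m_def)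
  obtain k n :: nat where kn: "2 * b \<beta> \<alpha> = (of_nat k - of_nat n) * b \<alpha> \<alpha>"
      and str: "\<And>i::int. - int k \<le> i \<Longrightarrow> i \<le> int n \<Longrightarrow> \<beta> + sc (of_int i) \<alpha> \<in> R"
    using string[OF \<alpha> \<beta>] by blast
  have "of_int (int k - int n) = (of_int (- m) :: 'k)"
    using kn ab \<alpha> by (metis mult_right_cancel of_int_diff of_int_minus of_int_of_nat_eq)
  then have mn: "m \<le> int n" unfolding of_int_eq_iff by linarith
  \<comment> \<open>the index just below the middle of the string, so that \<open>m - 2i\<close> is small but not zero\<close>
  define i where "i = (m - 1) div 2"
  have i: "m - 2 * i = 1 \<or> m - 2 * i = 2" "0 \<le> i" "i \<le> m" using m by (auto simp: i_def)
  define \<gamma> where "\<gamma> = \<beta> + sc (of_int i) \<alpha>"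
  have \<gamma>: "\<gamma> \<in> R" using str[of i] i mn by (simp add: \<gamma>_def)
  have bab: "b \<alpha> \<beta> = b \<beta> \<alpha>" using form_commute rootX \<alpha> \<beta> by blast
  have \<beta>an: "b \<beta> \<beta> \<noteq> 0"
  proof
    assume "b \<beta> \<beta> = 0"
    then have "b \<beta> \<alpha> = 0" using isotropic_radical[OF \<beta> _ \<alpha>(1)] bab by simp
    then show False using ab \<alpha> m by simp
  qed
  obtain p :: int where p: "2 * b \<beta> \<alpha> = of_int p * b \<beta> \<beta>"
    using cartan_integer[OF \<beta> \<beta>an \<alpha>(1)] bab by metis
  have p0: "p \<noteq> 0" using p ab \<alpha> m by auto
  have \<alpha>\<gamma>: "2 * b \<alpha> \<gamma> = of_int (2 * i - m) * b \<alpha> \<alpha>"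
    using \<alpha> \<beta> ab bab by (simp add: \<gamma>_def form_simps algebra_simps)
  have \<gamma>an: "b \<gamma> \<gamma> \<noteq> 0"
  proof
    assume "b \<gamma> \<gamma> = 0"
    then have "b \<alpha> \<gamma> = 0" using isotropic_radical \<gamma> \<alpha> by blast
    then show False using \<alpha>\<gamma> \<alpha> i by (auto simp flip: of_int_diff of_int_mult)
  qed
  have "b \<gamma> \<gamma> = b \<beta> \<beta> + of_int i * (2 * b \<beta> \<alpha>) + of_int i * of_int i * b \<alpha> \<alpha>"
    using \<alpha> \<beta> bab by (simp add: \<gamma>_def form_simps algebra_simps)
  then have \<gamma>\<gamma>: "b \<gamma> \<gamma> = b \<beta> \<beta> - of_int (i * (m - i)) * b \<alpha> \<alpha>"
    using ab by (simp add: algebra_simps)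
  obtain q :: int where q: "2 * b \<alpha> \<gamma> = of_int q * b \<gamma> \<gamma>"
    using cartan_integer[OF \<gamma> \<gamma>an \<alpha>(1)] .
  have pb: "of_int p * b \<beta> \<beta> = - of_int m * b \<alpha> \<alpha>" using p ab by simp
  have "of_int p * (of_int (2 * i - m) * b \<alpha> \<alpha>) = of_int q * (of_int p * b \<beta> \<beta> - of_int p * of_int (i * (m - i)) * b \<alpha> \<alpha>)"
    unfolding \<alpha>\<gamma>[symmetric] q \<gamma>\<gamma> by (simp only: right_diff_distrib mult.assoc mult.left_commute)
  also have "\<dots> = - of_int (q * (m + i * (m - i) * p)) * b \<alpha> \<alpha>"
    unfolding pb by (simp add: algebra_simps)
  finally have "of_int (p * (2 * i - m)) * b \<alpha> \<alpha> = of_int (- (q * (m + i * (m - i) * p))) * b \<alpha> \<alpha>"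
    by (simp add: algebra_simps)
  then have "p * (2 * i - m) = - (q * (m + i * (m - i) * p))"
    using \<alpha> by (simp only: mult_right_cancel of_int_eq_iff simp_thms)
  then have "(m + i * (m - i) * p) dvd p * (m - 2 * i)"
    by (intro dvdI[of _ _ q]) (simp add: algebra_simps)
  moreover have "p * (m - 2 * i) \<noteq> 0" using p0 i by auto
  ultimately have le: "\<bar>m + i * (m - i) * p\<bar> \<le> \<bar>p * (m - 2 * i)\<bar>"
    using dvd_imp_le_int by blast
  have "\<bar>p * (m - 2 * i)\<bar> \<le> 2 * \<bar>p\<bar>" using i by (auto simp: abs_mult)
  moreover have "\<bar>i * (m - i) * p\<bar> = i * (m - i) * \<bar>p\<bar>" using i by (simp add: abs_mult)
  ultimately have "i * (m - i) * \<bar>p\<bar> - m \<le> 2 * \<bar>p\<bar>"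
    using le m by linarith
  then have small: "(i * (m - i) - 2) * \<bar>p\<bar> \<le> m" by (simp add: algebra_simps)
  have big: "i * (m - i) - 2 > m"
  proof -
    have "i \<ge> 3" using m by (simp add: i_def)
    then have sq: "3 * i \<le> i * i" by (intro mult_right_mono) auto
    show ?thesis using i(1)
    proof
      assume "m - 2 * i = 1"
      then have eq: "m = 2 * i + 1" by simp
      then have "i * (m - i) = i * i + 1 * i" by (simp add: algebra_simps)
      with eq sq \<open>i \<ge> 3\<close> show ?thesis by linarith
    next
      assume "m - 2 * i = 2"
      then have eq: "m = 2 * i + 2" by simp
      then have "i * (m - i) = i * i + 2 * i" by (simp add: algebra_simps)
      with eq sq \<open>i \<ge> 3\<close> show ?thesis by linarith
    qed
  qed
  have p1: "1 \<le> \<bar>p\<bar>" using p0 by simp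
  have "0 \<le> i * (m - i) - 2" using big m by linarith
  from mult_left_mono[OF p1 this] have "i * (m - i) - 2 \<le> (i * (m - i) - 2) * \<bar>p\<bar>"
    by simp
  with small big show False by linarith
qed

text \<open>The upper bound is the lower bound for the reflected root.\<close>
lemma cartan_integer_bound:
  assumes \<alpha>: "\<alpha> \<in> R" "b \<alpha> \<alpha> \<noteq> 0" and \<beta>: "\<beta> \<in> R"
    and N: "2 * b \<beta> \<alpha> = of_int N * b \<alpha> \<alpha>"
  shows "- 6 \<le> N" "N \<le> 6"
proof -
  show "- 6 \<le> N" by (rule cartan_integer_lower_bound[OF assms])
  have s: "refl \<alpha> \<beta> \<in> R" by (rule refl_root[OF \<beta>])
  have "refl \<alpha> \<beta> = \<beta> - sc (of_int N) \<alpha>" using \<alpha> N by (simp add: refl_def)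
  then have "2 * b (refl \<alpha> \<beta>) \<alpha> = 2 * b \<beta> \<alpha> - 2 * (of_int N * b \<alpha> \<alpha>)"
    using \<alpha> \<beta> by (simp add: form_simps right_diff_distrib)
  then have "2 * b (refl \<alpha> \<beta>) \<alpha> = of_int (- N) * b \<alpha> \<alpha>"
    unfolding N by simp
  from cartan_integer_lower_bound[OF \<alpha> s this] show "N \<le> 6" by simp
qed

text \<open>Adding one vector to a spanning set enlarges the space of vectors orthogonal to \<open>F\<close> by at most one
  dimension; one further root kills it.\<close>
lemma finite_separating_set_of_roots:
  assumes nd: "\<And>x. x \<in> span R \<Longrightarrow> (\<forall>\<alpha>\<in>R. b x \<alpha> = 0) \<Longrightarrow> x = 0"
    and "finite A" "A \<subseteq> span R"
  shows "\<exists>F. finite F \<and> F \<subseteq> R \<and> (\<forall>v\<in>span A. (\<forall>\<alpha>\<in>F. b v \<alpha> = 0) \<longrightarrow> v = 0)"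
  using assms(2,3)
proof (induction A rule: finite_induct)
  case empty
  then show ?case by (intro exI[of _ "{}"]) auto
next
  case (insert a A)
  then obtain F where F: "finite F" "F \<subseteq> R" "\<And>v. v \<in> span A \<Longrightarrow> \<forall>\<alpha>\<in>F. b v \<alpha> = 0 \<Longrightarrow> v = 0"
    by auto
  have sub: "span (insert a A) \<subseteq> span R" using insert by (intro span_minimal) auto
  show ?case
  proof (cases "\<forall>v\<in>span (insert a A). (\<forall>\<alpha>\<in>F. b v \<alpha> = 0) \<longrightarrow> v = 0")
    case True
    with F show ?thesis by blast
  next
    case False
    then obtain w where w: "w \<in> span (insert a A)" "\<forall>\<alpha>\<in>F. b w \<alpha> = 0" "w \<noteq> 0" by blast
    obtain c where c: "w - sc c a \<in> span A" using w(1) by (auto simp: span_insert)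
    have c0: "c \<noteq> 0" using F(3)[of w] c w by auto
    obtain \<alpha> where \<alpha>: "\<alpha> \<in> R" "b w \<alpha> \<noteq> 0" using nd[of w] w sub by blast
    have "v = 0" if v: "v \<in> span (insert a A)" "\<forall>\<beta>\<in>insert \<alpha> F. b v \<beta> = 0" for v
    proof -
      obtain d where d: "v - sc d a \<in> span A" using v(1) by (auto simp: span_insert)
      let ?u = "v - sc (d / c) w"
      have "?u = (v - sc d a) - sc (d / c) (w - sc c a)"
        using c0 by (simp add: scale_right_diff_distrib)
      then have "?u \<in> span A" using c d by (metis span_diff span_scale)
      moreover have "\<forall>\<beta>\<in>F. b ?u \<beta> = 0"
        using v w F(2) sub by (auto simp: form_simps subset_eq)
      ultimately have u: "?u = 0" by (rule F(3))
      then have "b v \<alpha> = d / c * b w \<alpha>"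
        using w \<alpha> sub by (metis eq_iff_diff_eq_0 form_scale_left rootX subsetD)
      then have "d / c = 0" using v \<alpha> by simp
      then show ?thesis using u by simp
    qed
    then show ?thesis using F \<alpha> by (intro exI[of _ "insert \<alpha> F"]) auto
  qed
qed

text \<open>A root in the span of a finite set is determined by its Cartan integers with the finitely many roots
  of \<open>finite_separating_set_of_roots\<close>, and there are only thirteen values for each.\<close>
lemma locally_finite_root_system_refl:
  assumes nd: "\<And>x. x \<in> span R \<Longrightarrow> (\<forall>\<alpha>\<in>R. b x \<alpha> = 0) \<Longrightarrow> x = 0"
  shows "locally_finite_root_system sc R (span R) refl"
proof -
  have "coroot_pairing sc R (span R) refl \<alpha> \<beta> \<in> \<int>" if \<alpha>: "\<alpha> \<in> R" and \<beta>: "\<beta> \<in> R" for \<alpha> \<beta>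
  proof (cases "b \<beta> \<beta> = 0")
    case True
    then show ?thesis by (simp add: coroot_pairing_def real_roots_refl)
  next
    case False
    obtain n :: int where "2 * b \<alpha> \<beta> = of_int n * b \<beta> \<beta>" using cartan_integer[OF \<beta> False \<alpha>] .
    then show ?thesis using False \<alpha> \<beta> by (simp add: coroot_pairing_refl rootX)
  qed
  moreover have "R = real_roots R (span R) refl \<union> {0}"
  proof -
    have "\<alpha> = 0" if "\<alpha> \<in> R" "b \<alpha> \<alpha> = 0" for \<alpha>
      using that nd[of \<alpha>] isotropic_radical form_commute rootX by metis
    then show ?thesis using zero_root by (auto simp: real_roots_refl)
  qed
  moreover have "finite (R \<inter> span A)" if A: "finite A" "A \<subseteq> span R" for A
  proof -
    obtain F where F: "finite F" "F \<subseteq> R" "\<And>v. v \<in> span A \<Longrightarrow> \<forall>\<alpha>\<in>F. b v \<alpha> = 0 \<Longrightarrow> v = 0"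
      using finite_separating_set_of_roots[OF nd A] by blast
    have sub: "span A \<subseteq> span R" using A by (intro span_minimal) auto
    let ?\<phi> = "\<lambda>\<beta>. restrict (\<lambda>\<alpha>. 2 * b \<beta> \<alpha> / b \<alpha> \<alpha>) F"
    have "?\<phi> ` (R \<inter> span A) \<subseteq> PiE F (\<lambda>_. of_int ` {-6..6})"
    proof (rule image_subsetI)
      fix \<beta> assume "\<beta> \<in> R \<inter> span A"
      then have \<beta>: "\<beta> \<in> R" by simp
      have "2 * b \<beta> \<alpha> / b \<alpha> \<alpha> \<in> of_int ` {-6..6}" if "\<alpha> \<in> F" for \<alpha>
      proof (cases "b \<alpha> \<alpha> = 0")
        case True
        then show ?thesis by (auto intro!: image_eqI[of _ _ 0])
      next
        case False
        have \<alpha>: "\<alpha> \<in> R" using that F by auto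
        obtain n :: int where n: "2 * b \<beta> \<alpha> = of_int n * b \<alpha> \<alpha>"
          using cartan_integer[OF \<alpha> False \<beta>] .
        then have "2 * b \<beta> \<alpha> / b \<alpha> \<alpha> = of_int n" using False by simp
        then show ?thesis using cartan_integer_bound[OF \<alpha> False \<beta> n] by auto
      qed
      then show "?\<phi> \<beta> \<in> PiE F (\<lambda>_. of_int ` {-6..6})" by (simp add: restrict_PiE_iff)
    qed
    then have "finite (?\<phi> ` (R \<inter> span A))"
      by (rule finite_subset) (use F in \<open>auto intro!: finite_PiE\<close>)
    moreover have "inj_on ?\<phi> (R \<inter> span A)"
    proof (rule inj_onI)
      fix x y assume x: "x \<in> R \<inter> span A" and y: "y \<in> R \<inter> span A" and eq: "?\<phi> x = ?\<phi> y"
      have "b (x - y) \<alpha> = 0" if "\<alpha> \<in> F" for \<alpha>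
      proof -
        have \<alpha>: "\<alpha> \<in> R" using that F by auto
        have "b x \<alpha> = b y \<alpha>"
        proof (cases "b \<alpha> \<alpha> = 0")
          case True
          then show ?thesis using isotropic_radical \<alpha> x y by auto
        next
          case False
          then show ?thesis using fun_cong[OF eq[unfolded restrict_def], of \<alpha>] that by simp
        qed
        then show ?thesis using x y \<alpha> by (simp add: form_simps)
      qed
      then have "x - y = 0" using x y by (intro F(3) span_diff) auto
      then show "x = y" by simp
    qed
    ultimately show ?thesis by (rule finite_imageD)
  qed
  ultimately show ?thesis
    using pre_reflection_system_refl by (auto simp: locally_finite_root_system_def)
qed

definition radical :: "'x set"
  where "radical = {x \<in> span R. \<forall>y\<in>span R. b x y = 0}"

lemma subspace_radical: "subspace radical"
  by (auto simp: subspace_def radical_def form_simps)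

lemma form_eq_zero_on_span:
  assumes x: "x \<in> span R" and "\<forall>\<alpha>\<in>R. b x \<alpha> = 0" and y: "y \<in> span R"
  shows "b x y = 0"
proof -
  have "subspace {y \<in> span R. b x y = 0}"
    using x form_zero_left[OF x] form_commute[OF x span_zero] by (auto simp: subspace_def form_simps)
  moreover have "R \<subseteq> {y \<in> span R. b x y = 0}" using assms rootX by auto
  ultimately show ?thesis using span_minimal y by blast
qed

lemma isotropic_in_radical: "\<alpha> \<in> R \<Longrightarrow> b \<alpha> \<alpha> = 0 \<Longrightarrow> \<alpha> \<in> radical"
proof -
  assume \<alpha>: "\<alpha> \<in> R" "b \<alpha> \<alpha> = 0"
  then have "\<forall>\<beta>\<in>R. b \<alpha> \<beta> = 0" using isotropic_radical form_commute rootX by metis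
  then have "b \<alpha> y = 0" if "y \<in> span R" for y
    using form_eq_zero_on_span \<alpha> rootX that by blast
  then show ?thesis using \<alpha> rootX by (simp add: radical_def)
qed

text \<open>The projection \<open>f\<close> along the radical preserves the form, so \<open>f ` R\<close> again satisfies the axioms of the
  locale, now with a nondegenerate form; its reflections are the images of those of \<open>R\<close>.\<close>
theorem affine_reflection_system_refl: "affine_reflection_system sc R (span R) refl"
proof -
  obtain f where hom: "module_hom sc sc f" and fN: "\<And>x. x \<in> span R \<Longrightarrow> f x - x \<in> radical"
    and f0: "\<And>x. x \<in> radical \<Longrightarrow> f x = 0"
    using linear_projection_along[OF subspace_radical] by (auto simp: radical_def)
  interpret f: module_hom sc sc f by (rule hom)
  have fX: "f x \<in> span R" if "x \<in> span R" for x
    using span_add[OF fN[OF that, THEN subsetD[of radical "span R", rotated]] that] by (auto simp: radical_def)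
  have rad: "b x y = 0" "b y x = 0" if "x \<in> radical" "y \<in> span R" for x y
    using that form_commute by (auto simp: radical_def)
  have bf1: "b (f x) y = b x y" if "x \<in> span R" "y \<in> span R" for x y
    using rad(1)[OF fN[OF that(1)] that(2)] that by (simp add: form_simps fX)
  have bf: "b (f x) (f y) = b x y" if "x \<in> span R" "y \<in> span R" for x y
    using bf1 that form_commute fX by metis
  have ff: "f (f x) = f x" if "x \<in> span R" for x
    using f0[OF fN[OF that]] by (simp add: f.diff)
  have spanS: "span (f ` R) = f ` span R" by (rule f.span_image)
  have S_sub: "span (f ` R) \<subseteq> span R" using fX spanS by auto
  interpret S: root_string_form sc "f ` R" b
  proof
    show "0 \<in> f ` R" using zero_root by (auto intro: image_eqI[of _ _ 0])
    show "bilinear_form_on sc (span (f ` R)) b"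
      using form S_sub by (auto simp: bilinear_form_on_def linear_on_def subset_eq)
    show "symmetric_on (span (f ` R)) b"
      using form_sym S_sub by (auto simp: symmetric_on_def subset_eq)
  next
    fix \<alpha> \<beta> assume "\<alpha> \<in> f ` R" "b \<alpha> \<alpha> = 0" "\<beta> \<in> f ` R"
    then show "b \<beta> \<alpha> = 0" using isotropic_radical by (auto simp: bf rootX)
  next
    fix \<alpha> \<beta> assume "\<alpha> \<in> f ` R" "b \<alpha> \<alpha> \<noteq> 0" "\<beta> \<in> f ` R"
    then obtain \<alpha>' \<beta>' where ab: "\<alpha>' \<in> R" "\<beta>' \<in> R" "\<alpha> = f \<alpha>'" "\<beta> = f \<beta>'" by blast
    then have "b \<alpha>' \<alpha>' \<noteq> 0" using \<open>b \<alpha> \<alpha> \<noteq> 0\<close> by (simp add: bf rootX)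
    from string[OF ab(1) this ab(2)] obtain m n :: nat
      where mn: "2 * b \<beta>' \<alpha>' = (of_nat m - of_nat n) * b \<alpha>' \<alpha>'"
        and str: "\<And>i::int. - int m \<le> i \<Longrightarrow> i \<le> int n \<Longrightarrow> \<beta>' + sc (of_int i) \<alpha>' \<in> R" by blast
    have "\<beta> + sc (of_int i) \<alpha> = f (\<beta>' + sc (of_int i) \<alpha>')" for i
      using ab by (simp add: f.add f.scale)
    then show "\<exists>m n::nat. 2 * b \<beta> \<alpha> = (of_nat m - of_nat n) * b \<alpha> \<alpha> \<and>
        (\<forall>i::int. - int m \<le> i \<and> i \<le> int n \<longrightarrow> \<beta> + sc (of_int i) \<alpha> \<in> f ` R)"
      using mn str ab by (intro exI[of _ m] exI[of _ n]) (auto simp: bf rootX)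
  qed
  have nd: "x = 0" if x: "x \<in> span (f ` R)" and orth: "\<forall>\<alpha>\<in>f ` R. b x \<alpha> = 0" for x
  proof -
    obtain y where y: "y \<in> span R" "x = f y" using x spanS by auto
    have xR: "x \<in> span R" using x S_sub by auto
    have "b x \<beta> = 0" if "\<beta> \<in> R" for \<beta>
    proof -
      have "b x \<beta> = b x (f \<beta>)" using bf1 form_commute xR that fX rootX by metis
      then show ?thesis using orth that by simp
    qed
    then have "b x z = 0" if "z \<in> span R" for z
      using form_eq_zero_on_span xR that by blast
    then have "x \<in> radical" using xR by (simp add: radical_def)
    then show "x = 0" using f0 ff y by metis
  qed
  have "locally_finite_root_system sc (f ` R) (span (f ` R)) S.refl"
    by (rule S.locally_finite_root_system_refl[OF nd])
  moreover have "reflection_extension sc R (span R) refl sc (f ` R) (span (f ` R)) S.refl f"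
  proof -
    have "linear_on sc sc (span R) f" by (auto simp: linear_on_def f.add f.scale)
    moreover have "f (refl \<alpha> \<beta>) = S.refl (f \<alpha>) (f \<beta>)" if "\<alpha> \<in> R" "\<beta> \<in> R" for \<alpha> \<beta>
      using that by (simp add: refl_def S.refl_def bf rootX f.diff f.scale)
    moreover have "f ` imag_roots R (span R) refl = imag_roots (f ` R) (span (f ` R)) S.refl"
      "f ` real_roots R (span R) refl = real_roots (f ` R) (span (f ` R)) S.refl"
      unfolding imag_roots_refl S.imag_roots_refl real_roots_refl S.real_roots_refl
      by (auto simp: bf rootX)
    ultimately show ?thesis
      using spanS by (auto simp: reflection_extension_def reflection_morphism_def)
  qed
  ultimately show ?thesis
    unfolding affine_reflection_system_def using pre_reflection_system_refl by blast
qed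

end

section \<open>Weights of the toral subalgebra\<close>

lemma vector_space_fun_sc: "vector_space (fun_sc :: 'k::field \<Rightarrow> ('e \<Rightarrow> 'k) \<Rightarrow> 'e \<Rightarrow> 'k)"
  by unfold_locales (auto simp: fun_sc_def fun_eq_iff algebra_simps)

lemma fun_sc_apply [simp]: "fun_sc c \<alpha> t = c * \<alpha> t"
  by (simp add: fun_sc_def)

lemma locally_nilpotent_last:
  assumes "locally_nilpotent u" "x \<noteq> 0"
  shows "\<exists>k. (\<forall>j\<le>k. (u ^^ j) x \<noteq> 0) \<and> (u ^^ Suc k) x = 0"
proof -
  have "\<exists>n. (u ^^ n) x = 0" using assms by (simp add: locally_nilpotent_def)
  then obtain n where n: "(u ^^ n) x = 0" "\<forall>j<n. (u ^^ j) x \<noteq> 0"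
    using exists_least_iff[of "\<lambda>n. (u ^^ n) x = 0"] by auto
  then obtain k where "n = Suc k" using assms by (cases n) auto
  then show ?thesis using n by (intro exI[of _ k]) auto
qed

locale iara =
  fixes sc :: "'k::field_char_0 \<Rightarrow> 'e::ab_group_add \<Rightarrow> 'e"
    and br :: "'e \<Rightarrow> 'e \<Rightarrow> 'e" and T :: "'e set" and B :: "'e \<Rightarrow> 'e \<Rightarrow> 'k"
  assumes iara: "invariant_affine_reflection_algebra sc br T B"

sublocale iara \<subseteq> vector_space sc
  using iara by (simp add: invariant_affine_reflection_algebra_def toral_pair_def lie_algebra_def)

sublocale iara \<subseteq> F: vector_space "fun_sc :: 'k \<Rightarrow> ('e \<Rightarrow> 'k) \<Rightarrow> ('e \<Rightarrow> 'k)"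
  by (rule vector_space_fun_sc)

context iara
begin

abbreviation "E \<equiv> weight_space sc br T"
abbreviation "R \<equiv> roots sc br T"
abbreviation "X \<equiv> F.span R"
abbreviation "R_an \<equiv> anisotropic_roots sc br T B"
abbreviation "R_null \<equiv> null_roots sc br T B"
abbreviation "t \<equiv> repr_elt T B"

lemma br_add_left: "br (x + y) z = br x z + br y z"
  and br_add_right: "br x (y + z) = br x y + br x z"
  and br_scale_left: "br (sc c x) y = sc c (br x y)"
  and br_scale_right: "br x (sc c y) = sc c (br x y)"
  and br_self: "br x x = 0"
  and jacobi_cyclic: "br x (br y z) + br y (br z x) + br z (br x y) = 0"
  and subspace_T: "subspace T"
  using iara by (auto simp: invariant_affine_reflection_algebra_def toral_pair_def lie_algebra_def linear_on_def)

lemma br_zero: "br 0 x = 0" "br x 0 = 0"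
  using br_scale_left[of 0 0 x] br_scale_right[of x 0 0] by simp_all

lemma br_commute: "br x y = - br y x"
proof -
  have "br (x + y) (x + y) = 0" by (rule br_self)
  then have "br x y + br y x = 0" using br_self[of x] br_self[of y] by (simp add: br_add_left br_add_right add.commute)
  then show ?thesis by (simp add: eq_neg_iff_add_eq_0)
qed

lemma br_minus: "br (- x) y = - br x y" "br x (- y) = - br x y"
  using br_scale_left[of "-1" x y] br_scale_right[of x "-1" y] by simp_all

lemma br_jacobi: "br x (br y z) = br (br x y) z + br y (br x z)"
proof -
  have "br x (br y z) = - br y (br z x) - br z (br x y)"
    using jacobi_cyclic[of x y z] by (simp add: eq_neg_iff_add_eq_0 algebra_simps)
  also have "\<dots> = br y (br x z) + br (br x y) z"
    by (simp add: br_commute[of z x] br_commute[of z "br x y"] br_minus)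
  finally show ?thesis by (simp add: add.commute)
qed

lemma br_sum: "br (sum f I) x = (\<Sum>i\<in>I. br (f i) x)" "br x (sum f I) = (\<Sum>i\<in>I. br x (f i))"
  by (induction I rule: infinite_finite_induct; simp add: br_zero br_add_left br_add_right)+

lemma B_add_left: "B (x + y) z = B x z + B y z"
  and B_add_right: "B x (y + z) = B x y + B x z"
  and B_scale_left: "B (sc c x) y = c * B x y"
  and B_scale_right: "B x (sc c y) = c * B x y"
  and B_commute: "B x y = B y x"
  and B_invariant: "B (br x y) z = B x (br y z)"
  using iara
  by (auto simp: invariant_affine_reflection_algebra_def bilinear_form_on_def linear_on_def
      symmetric_on_def invariant_on_def)

lemma B_zero: "B 0 x = 0" "B x 0 = 0"
  using B_scale_left[of 0 0 x] B_scale_right[of x 0 0] by simp_all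

lemma B_minus: "B (- x) y = - B x y" "B x (- y) = - B x y"
  using B_scale_left[of "-1" x y] B_scale_right[of x "-1" y] by simp_all

lemma B_diff: "B (x - y) z = B x z - B y z" "B x (y - z) = B x y - B x z"
  using B_add_left[of x "- y" z] B_add_right[of x y "- z"] by (simp_all add: B_minus)

lemma B_nondegenerate: "(\<And>y. B x y = 0) \<Longrightarrow> x = 0"
  and B_nondegenerate_T: "x \<in> T \<Longrightarrow> (\<And>y. y \<in> T \<Longrightarrow> B x y = 0) \<Longrightarrow> x = 0"
  using iara by (auto simp: invariant_affine_reflection_algebra_def nondegenerate_on_def)

lemma weight: "x \<in> E \<alpha> \<Longrightarrow> s \<in> T \<Longrightarrow> br s x = sc (\<alpha> s) x"
  by (simp add: weight_space_def)

lemma weightI: "(\<And>s. s \<in> T \<Longrightarrow> br s x = sc (\<alpha> s) x) \<Longrightarrow> x \<in> E \<alpha>"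
  by (simp add: weight_space_def)

lemma subspace_E: "subspace (E \<alpha>)"
  by (auto simp: subspace_def weight_space_def br_zero br_add_right br_scale_right
      scale_right_distrib scale_left_commute)

lemmas E_zero = subspace_0[OF subspace_E] and E_add = subspace_add[OF subspace_E]
  and E_scale = subspace_scale[OF subspace_E]

lemma weight_br: "x \<in> E \<alpha> \<Longrightarrow> y \<in> E \<beta> \<Longrightarrow> br x y \<in> E (\<alpha> + \<beta>)"
  by (intro weightI, subst br_jacobi)
    (simp add: weight br_scale_left br_scale_right scale_left_distrib)

lemma subspace_dual: "F.subspace (dual sc T)"
  by (auto simp: F.subspace_def dual_def linear_on_def algebra_simps)

lemma root_dual: "\<alpha> \<in> R \<Longrightarrow> \<alpha> \<in> dual sc T"
  by (simp add: roots_def)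

lemma X_dual: "\<alpha> \<in> X \<Longrightarrow> \<alpha> \<in> dual sc T"
  using F.span_minimal[OF _ subspace_dual] root_dual by blast

lemma rootI: "\<alpha> \<in> dual sc T \<Longrightarrow> x \<in> E \<alpha> \<Longrightarrow> x \<noteq> 0 \<Longrightarrow> \<alpha> \<in> R"
  by (auto simp: roots_def)

lemma root_vector: "\<alpha> \<in> R \<Longrightarrow> \<exists>x\<in>E \<alpha>. x \<noteq> 0"
  using E_zero[of \<alpha>] by (auto simp: roots_def)

lemma dual_add: "\<alpha> \<in> dual sc T \<Longrightarrow> \<beta> \<in> dual sc T \<Longrightarrow> \<alpha> + \<beta> \<in> dual sc T"
  and dual_scale: "\<alpha> \<in> dual sc T \<Longrightarrow> fun_sc c \<alpha> \<in> dual sc T"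
  and dual_neg: "\<alpha> \<in> dual sc T \<Longrightarrow> - \<alpha> \<in> dual sc T"
  and dual_zero: "0 \<in> dual sc T"
  using subspace_dual by (auto intro: F.subspace_add F.subspace_scale F.subspace_neg F.subspace_0)

lemma weight_independent:
  assumes "finite J" "J \<subseteq> dual sc T" "\<And>\<alpha>. \<alpha> \<in> J \<Longrightarrow> x \<alpha> \<in> E \<alpha>" "(\<Sum>\<alpha>\<in>J. x \<alpha>) = 0" "\<alpha> \<in> J"
  shows "x \<alpha> = 0"
proof -
  have "\<forall>J x. finite J \<and> J \<subseteq> dual sc T \<and> (\<forall>i\<in>J. x i \<in> E i) \<and> (\<Sum>i\<in>J. x i) = 0 \<longrightarrow> (\<forall>i\<in>J. x i = 0)"
    using iara by (simp add: invariant_affine_reflection_algebra_def toral_pair_def direct_sum_def)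
  with assms show ?thesis by blast
qed

lemma weight_span: "span (\<Union>\<alpha>\<in>R. E \<alpha>) = UNIV"
proof -
  have "span (\<Union>\<alpha>\<in>dual sc T. E \<alpha>) = UNIV"
    using iara by (simp add: invariant_affine_reflection_algebra_def toral_pair_def direct_sum_def)
  moreover have "(\<Union>\<alpha>\<in>dual sc T. E \<alpha>) \<subseteq> span (\<Union>\<alpha>\<in>R. E \<alpha>)"
  proof
    fix x assume "x \<in> (\<Union>\<alpha>\<in>dual sc T. E \<alpha>)"
    then show "x \<in> span (\<Union>\<alpha>\<in>R. E \<alpha>)"
      using rootI by (cases "x = 0") (auto simp: span_zero intro: span_base)
  qed
  ultimately show ?thesis using span_minimal[OF _ subspace_span] by (metis top.extremum_unique)
qed

lemma weight_decomposition:
  obtains J y where "finite J" "J \<subseteq> R" "\<And>\<alpha>. y \<alpha> \<in> E \<alpha>" "x = (\<Sum>\<alpha>\<in>J. y \<alpha>)"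
proof -
  have "x \<in> span (\<Union>\<alpha>\<in>R. E \<alpha>)" using weight_span by simp
  then have "\<exists>J y. finite J \<and> J \<subseteq> R \<and> (\<forall>\<alpha>. y \<alpha> \<in> E \<alpha>) \<and> x = (\<Sum>\<alpha>\<in>J. y \<alpha>)"
  proof (induction rule: span_induct_alt)
    case base
    show ?case by (intro exI[of _ "{}"] exI[of _ "\<lambda>_. 0"]) (simp add: E_zero)
  next
    case (step c u z)
    then obtain J y \<beta> where J: "finite J" "J \<subseteq> R" "\<forall>\<alpha>. y \<alpha> \<in> E \<alpha>" "z = (\<Sum>\<alpha>\<in>J. y \<alpha>)"
      and \<beta>: "\<beta> \<in> R" "u \<in> E \<beta>" by blast
    define y' where "y' = (\<lambda>\<alpha>. (if \<alpha> \<in> J then y \<alpha> else 0) + (if \<alpha> = \<beta> then sc c u else 0))"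
    have "(\<Sum>\<alpha>\<in>insert \<beta> J. y' \<alpha>) = (\<Sum>\<alpha>\<in>insert \<beta> J. if \<alpha> \<in> J then y \<alpha> else 0) + sc c u"
      using J(1) by (simp add: y'_def sum.distrib)
    also have "(\<Sum>\<alpha>\<in>insert \<beta> J. if \<alpha> \<in> J then y \<alpha> else 0) = (\<Sum>\<alpha>\<in>J. y \<alpha>)"
      using J(1) by (intro sum.mono_neutral_cong_right) auto
    finally have "sc c u + z = (\<Sum>\<alpha>\<in>insert \<beta> J. y' \<alpha>)" using J(4) by simp
    moreover have "y' \<alpha> \<in> E \<alpha>" for \<alpha>
      using J(3) \<beta> by (auto simp: y'_def E_zero E_scale E_add)
    ultimately show ?case using J \<beta> by (intro exI[of _ "insert \<beta> J"] exI[of _ y']) auto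
  qed
  with that show thesis by blast
qed

lemma toral_action_on_weight_sums:
  assumes s: "s \<in> T" and J: "finite J" "J \<subseteq> R" "\<And>\<alpha>. y \<alpha> \<in> E \<alpha>"
  shows "br s (\<Sum>\<alpha>\<in>J. sc (c \<alpha>) (y \<alpha>)) = (\<Sum>\<alpha>\<in>J. sc (\<alpha> s * c \<alpha>) (y \<alpha>))"
    and "(\<Sum>\<alpha>\<in>J. sc (c \<alpha>) (y \<alpha>)) = 0 \<Longrightarrow> \<alpha> \<in> J \<Longrightarrow> sc (c \<alpha>) (y \<alpha>) = 0"
proof -
  show "br s (\<Sum>\<alpha>\<in>J. sc (c \<alpha>) (y \<alpha>)) = (\<Sum>\<alpha>\<in>J. sc (\<alpha> s * c \<alpha>) (y \<alpha>))"
    by (simp add: br_sum br_scale_right weight[OF J(3) s] mult.commute)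
  show "(\<Sum>\<alpha>\<in>J. sc (c \<alpha>) (y \<alpha>)) = 0 \<Longrightarrow> \<alpha> \<in> J \<Longrightarrow> sc (c \<alpha>) (y \<alpha>) = 0"
    using weight_independent[of J "\<lambda>\<alpha>. sc (c \<alpha>) (y \<alpha>)" \<alpha>] J root_dual by (auto simp: E_scale)
qed

text \<open>If \<open>u = \<Sum> y\<^sub>\<alpha>\<close> with \<open>y\<^sub>\<alpha> \<in> E\<^sub>\<alpha>\<close>, then \<open>[u, u] = 0\<close> forces \<open>\<alpha>(u) y\<^sub>\<alpha> = 0\<close>, whence \<open>[u, [s, u]] = 0\<close> for every
  \<open>s \<in> T\<close>. Since \<open>ad u\<close> is diagonalizable, \<open>(ad u)\<^sup>2 s = 0\<close> implies \<open>[u, s] = 0\<close>.\<close>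
lemma T_abelian:
  assumes "s \<in> T" "u \<in> T" shows "br s u = 0"
proof -
  have step: "br u (br s u) = 0"
  proof -
    obtain J y where J: "finite J" "J \<subseteq> R" "\<And>\<alpha>. y \<alpha> \<in> E \<alpha>" "u = (\<Sum>\<alpha>\<in>J. y \<alpha>)"
      using weight_decomposition[of u] by metis
    note eig = toral_action_on_weight_sums[OF _ J(1-3)]
    have "(\<Sum>\<alpha>\<in>J. sc (\<alpha> u) (y \<alpha>)) = br u u"
      using eig(1)[OF assms(2), of "\<lambda>_. 1"] J(4) by simp
    then have z: "sc (\<alpha> u) (y \<alpha>) = 0" if "\<alpha> \<in> J" for \<alpha>
      using eig(2)[OF assms(2), of "\<lambda>\<alpha>. \<alpha> u"] that br_self by simp
    have "br s u = (\<Sum>\<alpha>\<in>J. sc (\<alpha> s) (y \<alpha>))" using eig(1)[OF assms(1), of "\<lambda>_. 1"] J(4) by simp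
    then have "br u (br s u) = (\<Sum>\<alpha>\<in>J. sc (\<alpha> u * \<alpha> s) (y \<alpha>))" using eig(1)[OF assms(2)] by simp
    also have "\<dots> = (\<Sum>\<alpha>\<in>J. sc (\<alpha> s) (sc (\<alpha> u) (y \<alpha>)))" by (simp add: mult.commute)
    also have "\<dots> = 0" using z by (intro sum.neutral) (simp del: scale_scale)
    finally show ?thesis .
  qed
  obtain J y where J: "finite J" "J \<subseteq> R" "\<And>\<alpha>. y \<alpha> \<in> E \<alpha>" "s = (\<Sum>\<alpha>\<in>J. y \<alpha>)"
    using weight_decomposition[of s] by metis
  note eig = toral_action_on_weight_sums[OF _ J(1-3)]
  have us: "br u s = (\<Sum>\<alpha>\<in>J. sc (\<alpha> u) (y \<alpha>))" using eig(1)[OF assms(2), of "\<lambda>_. 1"] J(4) by simp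
  then have "br u (br u s) = (\<Sum>\<alpha>\<in>J. sc (\<alpha> u * \<alpha> u) (y \<alpha>))" using eig(1)[OF assms(2)] by simp
  moreover have "br u (br u s) = 0" using step br_commute[of u s] by (simp add: br_minus)
  ultimately have "sc (\<alpha> u * \<alpha> u) (y \<alpha>) = 0" if "\<alpha> \<in> J" for \<alpha>
    using eig(2)[OF assms(2), of "\<lambda>\<alpha>. \<alpha> u * \<alpha> u"] that by simp
  then have "sc (\<alpha> u) (y \<alpha>) = 0" if "\<alpha> \<in> J" for \<alpha> using that by fastforce
  then have "br u s = 0" unfolding us by (intro sum.neutral) auto
  then show ?thesis using br_commute[of s u] by simp
qed

lemma T_weight_zero: "s \<in> T \<Longrightarrow> s \<in> E 0"
  by (rule weightI) (simp add: T_abelian)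

text \<open>Elements of \<open>T\<close> have weight \<open>0\<close>; if \<open>T = 0\<close>, then \<open>E\<^sub>0\<close> is the whole nonzero algebra.\<close>
lemma zero_in_R: "0 \<in> R"
proof (cases "T = {0}")
  case True
  have "\<alpha> = 0" if "\<alpha> \<in> dual sc T" for \<alpha>
  proof
    fix x
    have "\<alpha> (sc 0 0) = 0 * \<alpha> 0" using that True by (simp only: dual_def linear_on_def) auto
    then show "\<alpha> x = 0 x" using that True by (cases "x = 0") (auto simp: dual_def)
  qed
  then have "R \<subseteq> {0}" using root_dual by blast
  moreover have "R \<noteq> {}"
  proof
    assume "R = {}"
    then have "(UNIV :: 'e set) = {0}" using weight_span by simp
    moreover have "\<exists>x::'e. x \<noteq> 0"
      using iara by (simp add: invariant_affine_reflection_algebra_def toral_pair_def)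
    ultimately show False by blast
  qed
  ultimately show ?thesis by blast
next
  case False
  then obtain s where "s \<in> T" "s \<noteq> 0" using subspace_0[OF subspace_T] by blast
  then show ?thesis using rootI[OF dual_zero] T_weight_zero by blast
qed

lemma B_weight_orthogonal:
  assumes "x \<in> E \<alpha>" "y \<in> E \<beta>" "\<alpha> \<in> dual sc T" "\<beta> \<in> dual sc T" "\<alpha> + \<beta> \<noteq> 0"
  shows "B x y = 0"
proof -
  obtain s where s: "\<alpha> s + \<beta> s \<noteq> 0" using assms(5) by (auto simp: fun_eq_iff)
  have "s \<in> T" using s assms(3,4) unfolding dual_def by force
  have "\<alpha> s * B x y = - B (br x s) y"
    using weight[OF assms(1) \<open>s \<in> T\<close>] br_commute[of x s] by (simp add: B_minus B_scale_left)
  also have "\<dots> = - \<beta> s * B x y"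
    using weight[OF assms(2) \<open>s \<in> T\<close>] by (simp add: B_invariant B_scale_right)
  finally have "(\<alpha> s + \<beta> s) * B x y = 0" by (simp add: algebra_simps)
  then show ?thesis using s by simp
qed

lemma t_unique: "s \<in> T \<Longrightarrow> (\<And>u. u \<in> T \<Longrightarrow> B s u = \<alpha> u) \<Longrightarrow> t \<alpha> = s"
  unfolding repr_elt_def
proof (rule the_equality)
  fix s' assume s: "s \<in> T" "\<And>u. u \<in> T \<Longrightarrow> B s u = \<alpha> u" and s': "s' \<in> T \<and> (\<forall>u\<in>T. B s' u = \<alpha> u)"
  have "s' - s = 0"
    using s s' by (intro B_nondegenerate_T) (auto simp: B_diff subspace_diff[OF subspace_T])
  then show "s' = s" by simp
qed auto

lemma t_exists:
  assumes "\<alpha> \<in> X" shows "t \<alpha> \<in> T \<and> (\<forall>u\<in>T. B (t \<alpha>) u = \<alpha> u)"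
proof -
  have "\<exists>s\<in>T. \<forall>u\<in>T. B s u = \<alpha> u"
    using assms
  proof (induction rule: F.span_induct_alt)
    case base
    show ?case using subspace_0[OF subspace_T] by (intro bexI[of _ 0]) (auto simp: B_zero)
  next
    case (step c \<beta> \<gamma>)
    then obtain s s' where "s \<in> T" "\<forall>u\<in>T. B s u = \<beta> u" "s' \<in> T" "\<forall>u\<in>T. B s' u = \<gamma> u"
      using iara unfolding invariant_affine_reflection_algebra_def by blast
    then show ?case
      by (intro bexI[of _ "sc c s + s'"])
        (auto simp: B_add_left B_scale_left subspace_add[OF subspace_T] subspace_scale[OF subspace_T])
  qed
  then obtain s where "s \<in> T" "\<And>u. u \<in> T \<Longrightarrow> B s u = \<alpha> u" by blast
  then show ?thesis using t_unique[of s \<alpha>] by simp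
qed

lemma t_T: "\<alpha> \<in> X \<Longrightarrow> t \<alpha> \<in> T" and B_t: "\<alpha> \<in> X \<Longrightarrow> u \<in> T \<Longrightarrow> B (t \<alpha>) u = \<alpha> u"
  using t_exists by blast+

lemma rootX: "\<alpha> \<in> R \<Longrightarrow> \<alpha> \<in> X" by (rule F.span_base)

text \<open>The calculations below use the right-hand side, which is linear in \<open>\<alpha>\<close> by definition.\<close>
lemma form_X_eval: "\<alpha> \<in> X \<Longrightarrow> \<beta> \<in> X \<Longrightarrow> form_X T B \<alpha> \<beta> = \<alpha> (t \<beta>)"
  by (simp add: form_X_def B_t t_T)

lemma eval_commute: "\<alpha> \<in> X \<Longrightarrow> \<beta> \<in> X \<Longrightarrow> \<alpha> (t \<beta>) = \<beta> (t \<alpha>)"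
  using form_X_eval form_X_def B_commute by metis

lemma R_an_iff: "\<alpha> \<in> R_an \<longleftrightarrow> \<alpha> \<in> R \<and> \<alpha> (t \<alpha>) \<noteq> 0"
  and R_null_iff: "\<alpha> \<in> R_null \<longleftrightarrow> \<alpha> \<in> R \<and> \<alpha> (t \<alpha>) = 0"
  by (auto simp: anisotropic_roots_def null_roots_def form_X_eval rootX)

lemma t_add: "\<alpha> \<in> X \<Longrightarrow> \<beta> \<in> X \<Longrightarrow> t (\<alpha> + \<beta>) = t \<alpha> + t \<beta>"
  by (rule t_unique) (auto simp: t_T B_t B_add_left subspace_add[OF subspace_T])

lemma t_scale: "\<alpha> \<in> X \<Longrightarrow> t (fun_sc c \<alpha>) = sc c (t \<alpha>)"
  by (rule t_unique) (auto simp: t_T B_t B_scale_left subspace_scale[OF subspace_T])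

lemma t_zero: "t 0 = 0"
  by (rule t_unique) (auto simp: B_zero subspace_0[OF subspace_T])

lemma t_neg: "\<alpha> \<in> X \<Longrightarrow> t (- \<alpha>) = - t \<alpha>"
  by (rule t_unique) (auto simp: t_T B_t B_minus subspace_neg[OF subspace_T])

lemma dual_add_arg: "\<alpha> \<in> dual sc T \<Longrightarrow> s \<in> T \<Longrightarrow> u \<in> T \<Longrightarrow> \<alpha> (s + u) = \<alpha> s + \<alpha> u"
  and dual_scale_arg: "\<alpha> \<in> dual sc T \<Longrightarrow> s \<in> T \<Longrightarrow> \<alpha> (sc c s) = c * \<alpha> s"
  by (auto simp: dual_def linear_on_def)

lemma dual_neg_arg: "\<alpha> \<in> dual sc T \<Longrightarrow> s \<in> T \<Longrightarrow> \<alpha> (- s) = - \<alpha> s"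
  using dual_scale_arg[of \<alpha> s "-1"] by simp

lemmas dual_linear = dual_add_arg dual_scale_arg dual_neg_arg

section \<open>Integrable triples and root strings\<close>

text \<open>Both sides lie in \<open>T\<close> and have the same products with \<open>T\<close>, by invariance.\<close>
lemma br_opposite_weights:
  assumes "\<alpha> \<in> X" "e \<in> E \<alpha>" "f \<in> E (- \<alpha>)" "br e f \<in> T"
  shows "br e f = sc (B e f) (t \<alpha>)"
proof -
  have "B (br e f) u = B e f * \<alpha> u" if "u \<in> T" for u
    using weight[OF assms(3) that] br_commute[of f u]
    by (simp add: B_invariant B_minus B_scale_right)
  then have "br e f - sc (B e f) (t \<alpha>) = 0"
    using assms
    by (intro B_nondegenerate_T) (auto simp: B_diff B_scale_left B_t t_T subspace_diff[OF subspace_T]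
        subspace_scale[OF subspace_T])
  then show ?thesis by simp
qed

text \<open>The pair common to both kinds of roots. For \<open>\<alpha> = 0\<close> it is the zero pair, as \<open>t\<^sub>0 = 0\<close>.\<close>
lemma root_pair:
  assumes "\<alpha> \<in> R"
  obtains e f where "e \<in> E \<alpha>" "f \<in> E (- \<alpha>)" "br e f = - t \<alpha>" "\<alpha> \<noteq> 0 \<Longrightarrow> br e f \<noteq> 0"
proof (cases "\<alpha> = 0")
  case True
  then show thesis using that[of 0 0] by (simp add: br_zero t_zero E_zero)
next
  case False
  then obtain e f where ef: "e \<in> E \<alpha>" "f \<in> E (- \<alpha>)" "br e f \<noteq> 0" "br e f \<in> T"
    using iara assms unfolding invariant_affine_reflection_algebra_def by blast
  have eq: "br e f = sc (B e f) (t \<alpha>)" using br_opposite_weights ef rootX assms by blast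
  then have c: "B e f \<noteq> 0" "t \<alpha> \<noteq> 0" using ef by auto
  define e' where "e' = sc (- 1 / B e f) e"
  have "br e' f = - t \<alpha>" unfolding e'_def br_scale_left eq using c by simp
  moreover have "e' \<in> E \<alpha>" unfolding e'_def using ef by (intro E_scale)
  ultimately show thesis using that[of e' f] ef c by simp
qed

lemma neg_root: "- \<alpha> \<in> R" if \<alpha>: "\<alpha> \<in> R"
proof -
  obtain e f where f: "f \<in> E (- \<alpha>)" "\<alpha> \<noteq> 0 \<Longrightarrow> br e f \<noteq> 0"
    using root_pair[OF \<alpha>] by blast
  show ?thesis
  proof (cases "\<alpha> = 0")
    case False
    then have "f \<noteq> 0" using f(2) by (auto simp: br_zero)
    then show ?thesis using rootI[OF dual_neg[OF root_dual[OF \<alpha>]] f(1)] by simp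
  qed (use \<alpha> in simp)
qed

lemma neg_R_an: "- \<alpha> \<in> R_an" if "\<alpha> \<in> R_an"
proof -
  have "\<alpha> \<in> X" using that rootX by (simp add: R_an_iff)
  then show ?thesis
    using that neg_root by (simp add: R_an_iff t_neg dual_linear X_dual t_T)
qed

definition coroot :: "('e \<Rightarrow> 'k) \<Rightarrow> 'e"
  where "coroot \<alpha> = sc (2 / \<alpha> (t \<alpha>)) (t \<alpha>)"

lemma coroot_T: "\<alpha> \<in> R_an \<Longrightarrow> coroot \<alpha> \<in> T"
  by (simp add: coroot_def t_T rootX R_an_iff subspace_scale[OF subspace_T])

lemma eval_coroot: "\<alpha> \<in> R_an \<Longrightarrow> \<beta> \<in> dual sc T \<Longrightarrow> \<beta> (coroot \<alpha>) = 2 * \<beta> (t \<alpha>) / \<alpha> (t \<alpha>)"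
  by (simp add: coroot_def t_T rootX R_an_iff dual_linear)

lemma eval_coroot_self: "\<alpha> \<in> R_an \<Longrightarrow> \<alpha> (coroot \<alpha>) = 2"
  by (simp add: eval_coroot root_dual R_an_iff)

lemma coroot_neg: "\<alpha> \<in> R_an \<Longrightarrow> coroot (- \<alpha>) = - coroot \<alpha>"
  by (simp add: coroot_def R_an_iff t_neg rootX dual_linear root_dual t_T)

lemma ad_nilpotent: "\<alpha> \<in> R_an \<Longrightarrow> x \<in> E \<alpha> \<Longrightarrow> locally_nilpotent (br x)"
  using iara by (simp add: invariant_affine_reflection_algebra_def)

lemma integrable_triple:
  assumes "\<alpha> \<in> R_an"
  obtains e f where "integrable_sl2_triple sc br T \<alpha> e (coroot \<alpha>) f" "e \<noteq> 0"
proof -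
  have \<alpha>: "\<alpha> \<in> R" "\<alpha> \<in> X" "\<alpha> (t \<alpha>) \<noteq> 0" using assms rootX by (auto simp: R_an_iff)
  then have "\<alpha> \<noteq> 0" by auto
  with \<alpha> obtain e f where ef: "e \<in> E \<alpha>" "f \<in> E (- \<alpha>)" "br e f = - t \<alpha>" "br e f \<noteq> 0"
    using root_pair by metis
  let ?e = "sc (2 / \<alpha> (t \<alpha>)) e"
  have e: "?e \<in> E \<alpha>" "?e \<noteq> 0" using ef \<alpha> by (auto simp: E_scale br_zero)
  have "br ?e f = - coroot \<alpha>" using ef by (simp add: br_scale_left coroot_def)
  moreover have "br (coroot \<alpha>) ?e = sc 2 ?e"
    using weight[OF e(1) coroot_T[OF assms]] eval_coroot_self[OF assms] by simp
  moreover have "br (coroot \<alpha>) f = sc (- 2) f"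
    using weight[OF ef(2) coroot_T[OF assms]] eval_coroot_self[OF assms] by simp
  ultimately have "integrable_sl2_triple sc br T \<alpha> ?e (coroot \<alpha>) f"
    using e ef coroot_T[OF assms] ad_nilpotent[OF assms e(1)] ad_nilpotent[OF neg_R_an[OF assms] ef(2)]
    by (simp add: integrable_sl2_triple_def sl2_triple_def)
  with e that show thesis by blast
qed

text \<open>If \<open>\<alpha>\<close> carries a triple with \<open>h \<in> T\<close>, then \<open>h\<close> is a multiple of \<open>t\<^sub>\<alpha>\<close> while \<open>\<alpha>(h) = 2\<close>, so \<open>\<alpha>(t\<^sub>\<alpha>) \<noteq> 0\<close>.\<close>
lemma int_roots_eq: "int_roots sc br T = R_an"
proof
  show "R_an \<subseteq> int_roots sc br T"
  proof
    fix \<alpha> assume \<alpha>: "\<alpha> \<in> R_an"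
    obtain e f where "integrable_sl2_triple sc br T \<alpha> e (coroot \<alpha>) f"
      by (rule integrable_triple[OF \<alpha>])
    then show "\<alpha> \<in> int_roots sc br T"
      using \<alpha> R_an_iff by (auto simp: int_roots_def)
  qed
  show "int_roots sc br T \<subseteq> R_an"
  proof
    fix \<alpha> assume "\<alpha> \<in> int_roots sc br T"
    then obtain e h f where \<alpha>: "\<alpha> \<in> R" and tr: "e \<in> E \<alpha>" "h \<in> T" "f \<in> E (- \<alpha>)"
      "(e, h, f) \<noteq> (0, 0, 0)" "br e f = - h" "br h e = sc 2 e" "br h f = sc (- 2) f"
      by (auto simp: int_roots_def integrable_sl2_triple_def sl2_triple_def)
    have e: "e \<noteq> 0"
    proof
      assume "e = 0"
      then have "h = 0" using tr by (simp add: br_zero)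
      then have "f = 0" using tr by (simp add: br_zero)
      with \<open>e = 0\<close> \<open>h = 0\<close> tr show False by simp
    qed
    have "sc (\<alpha> h - 2) e = 0" using tr weight[OF tr(1,2)] by (simp add: scale_left_diff_distrib)
    then have "\<alpha> h = 2" using e by simp
    moreover have "br e f = sc (B e f) (t \<alpha>)"
      using br_opposite_weights[OF rootX[OF \<alpha>] tr(1,3)] tr subspace_neg[OF subspace_T] by simp
    then have "\<alpha> (br e f) = B e f * \<alpha> (t \<alpha>)" using \<alpha> rootX by (simp add: dual_linear root_dual t_T)
    then have "- \<alpha> h = B e f * \<alpha> (t \<alpha>)" using tr dual_neg_arg[OF root_dual[OF \<alpha>]] by simp
    ultimately have "\<alpha> (t \<alpha>) \<noteq> 0" by auto
    then show "\<alpha> \<in> R_an" using \<alpha> by (simp add: R_an_iff)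
  qed
qed

text \<open>On a vector \<open>v\<close> killed by \<open>f\<close> one has \<open>f e\<^sup>j\<^sup>+\<^sup>1 v = (j + 1)(j - n) e\<^sup>j v\<close>. For the last nonzero power \<open>e\<^sup>m v\<close>
  the left-hand side vanishes, so \<open>n = m\<close> in characteristic zero.\<close>
lemma sl2_lowest_weight:
  assumes ef: "br e f = - h" and he: "br h e = sc 2 e"
    and v: "br f v = 0" "br h v = sc (- n) v" "v \<noteq> 0" and nil: "locally_nilpotent (br e)"
  obtains m :: nat where "n = of_nat m" "\<And>j. j \<le> m \<Longrightarrow> (br e ^^ j) v \<noteq> 0"
proof -
  have fe: "br f e = h" using ef br_commute[of f e] by simp
  have h: "br h ((br e ^^ j) v) = sc (2 * of_nat j - n) ((br e ^^ j) v)" for j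
  proof (induction j)
    case (Suc j)
    have "br h (br e ((br e ^^ j) v)) = sc 2 (br e ((br e ^^ j) v)) + sc (2 * of_nat j - n) (br e ((br e ^^ j) v))"
      by (subst br_jacobi) (simp add: he Suc br_scale_left br_scale_right)
    then show ?case by (simp add: algebra_simps flip: scale_left_distrib)
  qed (simp add: v)
  have f: "br f ((br e ^^ Suc j) v) = sc (of_nat (Suc j) * (of_nat j - n)) ((br e ^^ j) v)" for j
  proof (induction j)
    case 0
    show ?case using br_jacobi[of f e v] by (simp add: fe v br_zero)
  next
    case (Suc j)
    have "br f (br e ((br e ^^ Suc j) v)) = br h ((br e ^^ Suc j) v) + br e (br f ((br e ^^ Suc j) v))"
      by (subst br_jacobi) (simp only: fe)
    also have "\<dots> = sc (2 * of_nat (Suc j) - n) ((br e ^^ Suc j) v)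
        + sc (of_nat (Suc j) * (of_nat j - n)) ((br e ^^ Suc j) v)"
      by (simp only: h Suc br_scale_right) simp
    also have "\<dots> = sc (of_nat (Suc (Suc j)) * (of_nat (Suc j) - n)) ((br e ^^ Suc j) v)"
      by (simp add: algebra_simps flip: scale_left_distrib)
    finally show ?case by simp
  qed
  obtain m where low: "\<And>j. j \<le> m \<Longrightarrow> (br e ^^ j) v \<noteq> 0" and last: "(br e ^^ Suc m) v = 0"
    using locally_nilpotent_last[OF nil v(3)] by blast
  have "sc (of_nat (Suc m) * (of_nat m - n)) ((br e ^^ m) v) = 0"
    using f[of m] last by (simp add: br_zero)
  moreover have "(br e ^^ m) v \<noteq> 0" using low by simp
  ultimately have "of_nat m = n" using of_nat_neq_0[where 'a='k] by (auto simp del: of_nat_Suc)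
  then show thesis using that[of m] low by simp
qed

lemma weight_funpow: "x \<in> E \<beta> \<Longrightarrow> y \<in> E \<alpha> \<Longrightarrow> (br y ^^ n) x \<in> E (\<beta> + fun_sc (of_nat n) \<alpha>)"
proof (induction n)
  case (Suc n)
  have "\<alpha> + (\<beta> + fun_sc (of_nat n) \<alpha>) = \<beta> + fun_sc (of_nat (Suc n)) \<alpha>"
    by (auto simp: fun_eq_iff algebra_simps)
  then show ?case using weight_br[OF Suc.prems(2) Suc.IH[OF Suc.prems]]
    by (simp only: funpow.simps o_apply)
qed simp

text \<open>Apply the lowest weight argument to the last nonzero vector \<open>f\<^sup>k x\<close> of a root vector \<open>x\<close> of \<open>\<beta>\<close>. The
  resulting string \<open>\<beta> - k\<alpha>, \<dots>, \<beta> + (m - k)\<alpha>\<close> contains \<open>\<beta>\<close> and its reflection only if \<open>k \<le> m\<close>, which holds when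
  \<open>\<beta>(h\<^sub>\<alpha>) = 2k - m\<close> is not positive.\<close>
lemma half_root_string:
  assumes \<alpha>: "\<alpha> \<in> R_an" and \<beta>: "\<beta> \<in> R"
  shows "\<exists>k m::nat. \<beta> (coroot \<alpha>) = 2 * of_nat k - of_nat m \<and>
    (\<forall>i::int. - int k \<le> i \<and> i \<le> int m - int k \<longrightarrow> \<beta> + fun_sc (of_int i) \<alpha> \<in> R)"
proof -
  obtain e f where tr: "integrable_sl2_triple sc br T \<alpha> e (coroot \<alpha>) f"
    using integrable_triple[OF \<alpha>] by metis
  then have e: "e \<in> E \<alpha>" and f: "f \<in> E (- \<alpha>)" and ef: "br e f = - coroot \<alpha>" "br (coroot \<alpha>) e = sc 2 e"
    and nil: "locally_nilpotent (br e)" "locally_nilpotent (br f)"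
    by (auto simp: integrable_sl2_triple_def sl2_triple_def)
  obtain x where x: "x \<in> E \<beta>" "x \<noteq> 0" using root_vector[OF \<beta>] by blast
  obtain k where k: "(br f ^^ k) x \<noteq> 0" "(br f ^^ Suc k) x = 0"
    using locally_nilpotent_last[OF nil(2) x(2)] by blast
  define v where "v = (br f ^^ k) x"
  have v: "v \<noteq> 0" "br f v = 0" using k by (auto simp: v_def)
  have vw: "v \<in> E (\<beta> + fun_sc (of_nat k) (- \<alpha>))" unfolding v_def by (rule weight_funpow[OF x(1) f])
  have "br (coroot \<alpha>) v = sc (- (2 * of_nat k - \<beta> (coroot \<alpha>))) v"
    using weight[OF vw coroot_T[OF \<alpha>]] eval_coroot_self[OF \<alpha>] by (simp add: algebra_simps)
  from sl2_lowest_weight[OF ef v(2) this v(1) nil(1)]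
  obtain m :: nat where m: "2 * of_nat k - \<beta> (coroot \<alpha>) = of_nat m"
    and nz: "\<And>j. j \<le> m \<Longrightarrow> (br e ^^ j) v \<noteq> 0" by metis
  have "\<beta> + fun_sc (of_int i) \<alpha> \<in> R" if i: "- int k \<le> i" "i \<le> int m - int k" for i
  proof -
    define j where "j = nat (i + int k)"
    have "i = int j - int k" using i by (simp add: j_def)
    then have "of_int i = (of_nat j - of_nat k :: 'k)" by simp
    then have "\<beta> + fun_sc (of_nat k) (- \<alpha>) + fun_sc (of_nat j) \<alpha> = \<beta> + fun_sc (of_int i) \<alpha>"
      by (simp add: fun_eq_iff left_diff_distrib)
    then have "(br e ^^ j) v \<in> E (\<beta> + fun_sc (of_int i) \<alpha>)"
      using weight_funpow[OF vw e, of j] by (simp only:)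
    moreover have "\<beta> + fun_sc (of_int i) \<alpha> \<in> dual sc T"
      using \<alpha> \<beta> by (intro dual_add dual_scale) (auto simp: root_dual R_an_iff)
    moreover have "(br e ^^ j) v \<noteq> 0" using nz i by (simp add: j_def)
    ultimately show ?thesis using rootI by blast
  qed
  then show ?thesis using m by (intro exI[of _ k] exI[of _ m]) (auto simp: algebra_simps)
qed

text \<open>If \<open>\<beta>(h\<^sub>\<alpha>)\<close> is positive, the string is taken in direction \<open>- \<alpha>\<close>.\<close>
lemma root_string:
  assumes \<alpha>: "\<alpha> \<in> R_an" and \<beta>: "\<beta> \<in> R"
  shows "\<exists>m n::nat. \<beta> (coroot \<alpha>) = of_nat m - of_nat n \<and>
    (\<forall>i::int. - int m \<le> i \<and> i \<le> int n \<longrightarrow> \<beta> + fun_sc (of_int i) \<alpha> \<in> R)"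
proof -
  obtain k m where km: "\<beta> (coroot \<alpha>) = 2 * of_nat k - of_nat m"
    "\<And>i. - int k \<le> i \<Longrightarrow> i \<le> int m - int k \<Longrightarrow> \<beta> + fun_sc (of_int i) \<alpha> \<in> R"
    using half_root_string[OF \<alpha> \<beta>] by blast
  show ?thesis
  proof (cases "2 * k \<le> m")
    case True
    then show ?thesis using km
      by (intro exI[of _ k] exI[of _ "m - k"]) (auto simp: of_nat_diff)
  next
    case False
    obtain k' m' where km': "\<beta> (coroot (- \<alpha>)) = 2 * of_nat k' - of_nat m'"
      "\<And>i. - int k' \<le> i \<Longrightarrow> i \<le> int m' - int k' \<Longrightarrow> \<beta> + fun_sc (of_int i) (- \<alpha>) \<in> R"
      using half_root_string[OF neg_R_an[OF \<alpha>] \<beta>] by blast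
    have "\<beta> (coroot (- \<alpha>)) = - \<beta> (coroot \<alpha>)"
      using coroot_neg[OF \<alpha>] coroot_T[OF \<alpha>] dual_linear[OF root_dual[OF \<beta>]] by simp
    then have "of_int (2 * int k' - int m') = (of_int (int m - 2 * int k) :: 'k)"
      using km(1) km'(1) by simp
    then have "2 * int k' - int m' = int m - 2 * int k" unfolding of_int_eq_iff .
    then have le: "2 * k' \<le> m'" using False by linarith
    have "\<beta> + fun_sc (of_int i) \<alpha> \<in> R" if "- int (m' - k') \<le> i" "i \<le> int k'" for i
    proof -
      have "\<beta> + fun_sc (of_int i) \<alpha> = \<beta> + fun_sc (of_int (- i)) (- \<alpha>)" by (auto simp: fun_eq_iff)
      then show ?thesis using km'(2)[of "- i"] that le by simp
    qed
    moreover have "\<beta> (coroot \<alpha>) = of_nat (m' - k') - of_nat k'"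
      using km'(1) \<open>\<beta> (coroot (- \<alpha>)) = - \<beta> (coroot \<alpha>)\<close> le by (simp add: of_nat_diff algebra_simps)
    ultimately show ?thesis by (intro exI[of _ "m' - k'"] exI[of _ k']) auto
  qed
qed

section \<open>Isotropic roots\<close>

text \<open>The central element \<open>t\<^sub>\<alpha>\<close> acts on all \<open>E\<^sub>\<gamma>\<^sub>-\<^sub>n\<^sub>\<alpha>\<close> by the same scalar \<open>c = \<gamma>(t\<^sub>\<alpha>)\<close>, because \<open>\<alpha>(t\<^sub>\<alpha>) = 0\<close>. Hence
  \<open>e f\<^sup>n\<^sup>+\<^sup>1 x = - (n + 1) c f\<^sup>n x\<close> and no power of \<open>f\<close> kills \<open>x\<close>.\<close>
lemma heisenberg_string:
  assumes \<alpha>: "\<alpha> \<in> R_null" and ef: "e \<in> E \<alpha>" "f \<in> E (- \<alpha>)" "br e f = - t \<alpha>"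
    and x: "x \<in> E \<gamma>" "x \<noteq> 0" "br e x = 0" and c: "\<gamma> (t \<alpha>) \<noteq> 0"
  shows "(br f ^^ n) x \<noteq> 0"
proof -
  have \<alpha>X: "\<alpha> \<in> X" "\<alpha> (t \<alpha>) = 0" using \<alpha> rootX by (auto simp: R_null_iff)
  have tw: "br (t \<alpha>) ((br f ^^ n) x) = sc (\<gamma> (t \<alpha>)) ((br f ^^ n) x)" for n
    using weight[OF weight_funpow[OF x(1) ef(2), of n] t_T[OF \<alpha>X(1)]] \<alpha>X(2) by simp
  have e: "br e ((br f ^^ Suc n) x) = sc (- (of_nat (Suc n) * \<gamma> (t \<alpha>))) ((br f ^^ n) x)" for n
  proof (induction n)
    case 0
    show ?case using br_jacobi[of e f x] tw[of 0] by (simp add: ef x br_zero br_minus)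
  next
    case (Suc n)
    have "br e (br f ((br f ^^ Suc n) x)) = br (- t \<alpha>) ((br f ^^ Suc n) x) + br f (br e ((br f ^^ Suc n) x))"
      by (subst br_jacobi) (simp only: ef)
    also have "\<dots> = sc (- \<gamma> (t \<alpha>)) ((br f ^^ Suc n) x)
        + sc (- (of_nat (Suc n) * \<gamma> (t \<alpha>))) ((br f ^^ Suc n) x)"
      by (simp only: br_minus tw Suc br_scale_right scale_minus_left) simp
    also have "\<dots> = sc (- (of_nat (Suc (Suc n)) * \<gamma> (t \<alpha>))) ((br f ^^ Suc n) x)"
      by (simp add: algebra_simps flip: scale_left_distrib)
    finally show ?case by simp
  qed
  show ?thesis
  proof (induction n)
    case (Suc n)
    show ?case
    proof
      assume "(br f ^^ Suc n) x = 0"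
      then have "sc (- (of_nat (Suc n) * \<gamma> (t \<alpha>))) ((br f ^^ n) x) = 0" using e[of n] by (simp only: br_zero)
      then show False using Suc c of_nat_neq_0[where 'a='k, of n] by (simp del: of_nat_Suc)
    qed
  qed (simp add: x)
qed

text \<open>Either the powers of \<open>e\<close> never kill a root vector of \<open>\<beta>\<close>, or the last nonzero one is killed by \<open>e\<close> and
  the powers of \<open>f\<close> never kill it.\<close>
lemma isotropic_ray:
  assumes \<alpha>: "\<alpha> \<in> R_null" and \<beta>: "\<beta> \<in> R" and c: "\<beta> (t \<alpha>) \<noteq> 0"
  obtains \<gamma> and \<epsilon> :: int where "\<gamma> \<in> R" "\<gamma> (t \<alpha>) = \<beta> (t \<alpha>)" "\<epsilon> = 1 \<or> \<epsilon> = - 1"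
    "\<And>n::nat. \<gamma> + fun_sc (of_int (\<epsilon> * int n)) \<alpha> \<in> R"
proof -
  have \<alpha>R: "\<alpha> \<in> R" "\<alpha> (t \<alpha>) = 0" using \<alpha> by (auto simp: R_null_iff)
  obtain e f where ef: "e \<in> E \<alpha>" "f \<in> E (- \<alpha>)" "br e f = - t \<alpha>"
    using root_pair[OF \<alpha>R(1)] by blast
  obtain x where x: "x \<in> E \<beta>" "x \<noteq> 0" using root_vector[OF \<beta>] by blast
  have dual: "\<beta> + fun_sc c \<alpha> \<in> dual sc T" for c
    using \<alpha>R \<beta> by (intro dual_add dual_scale root_dual)
  show thesis
  proof (cases "\<forall>n. (br e ^^ n) x \<noteq> 0")
    case True
    then have "\<beta> + fun_sc (of_int (1 * int n)) \<alpha> \<in> R" for n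
      using rootI[OF dual[of "of_nat n"] weight_funpow[OF x(1) ef(1), of n]] by simp
    then show thesis using that[of \<beta> 1] \<beta> by simp
  next
    case False
    then obtain n where n: "(br e ^^ n) x = 0" "\<forall>j<n. (br e ^^ j) x \<noteq> 0"
      using exists_least_iff[of "\<lambda>n. (br e ^^ n) x = 0"] by auto
    then obtain k where k: "n = Suc k" using x by (cases n) auto
    define v where "v = (br e ^^ k) x"
    define \<gamma> where "\<gamma> = \<beta> + fun_sc (of_nat k) \<alpha>"
    have v: "v \<in> E \<gamma>" "v \<noteq> 0" "br e v = 0"
      using n k weight_funpow[OF x(1) ef(1), of k] by (auto simp: v_def \<gamma>_def)
    have \<gamma>: "\<gamma> (t \<alpha>) = \<beta> (t \<alpha>)" using \<alpha>R by (simp add: \<gamma>_def)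
    have \<gamma>R: "\<gamma> \<in> R" using rootI[OF dual v(1)[unfolded \<gamma>_def] v(2)] by (simp add: \<gamma>_def)
    have "\<gamma> + fun_sc (of_int (- 1 * int n)) \<alpha> \<in> R" for n
    proof (rule rootI)
      show "(br f ^^ n) v \<noteq> 0" using heisenberg_string[OF \<alpha> ef v] c \<gamma> by simp
      have "\<gamma> + fun_sc (of_nat n) (- \<alpha>) = \<gamma> + fun_sc (of_int (- 1 * int n)) \<alpha>"
        by (auto simp: fun_eq_iff)
      then show "(br f ^^ n) v \<in> E (\<gamma> + fun_sc (of_int (- 1 * int n)) \<alpha>)"
        using weight_funpow[OF v(1) ef(2), of n] by (simp only:)
      show "\<gamma> + fun_sc (of_int (- 1 * int n)) \<alpha> \<in> dual sc T"
        using \<gamma>R \<alpha>R by (intro dual_add dual_scale root_dual)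
    qed
    then show thesis using that[of \<gamma> "- 1"] \<gamma> \<gamma>R by simp
  qed
qed

text \<open>Along a ray \<open>\<gamma> + \<epsilon>n\<alpha>\<close> the square length is \<open>N n = (\<gamma>|\<gamma>) + 2\<epsilon>nc\<close> with \<open>c = (\<gamma>|\<alpha>) \<noteq> 0\<close>, and the Cartan number
  of \<open>\<alpha>\<close> with respect to the \<open>n\<close>-th root is \<open>2c / N n\<close>. If it is the integer \<open>k\<close> for \<open>n\<close> and \<open>k'\<close> for \<open>n + 3\<close>,
  then \<open>k'(1 + 3\<epsilon>k) = k\<close>, which no nonzero integers satisfy since \<open>\<bar>1 + 3\<epsilon>k\<bar> > \<bar>k\<bar>\<close>.\<close>
lemma isotropic_orthogonal:
  assumes \<alpha>: "\<alpha> \<in> R_null" and \<beta>: "\<beta> \<in> R"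
  shows "\<beta> (t \<alpha>) = 0"
proof (rule ccontr)
  assume nz: "\<beta> (t \<alpha>) \<noteq> 0"
  obtain \<gamma> and \<epsilon> :: int where \<gamma>: "\<gamma> \<in> R" "\<gamma> (t \<alpha>) = \<beta> (t \<alpha>)" and \<epsilon>: "\<epsilon> = 1 \<or> \<epsilon> = - 1"
    and ray: "\<And>n::nat. \<gamma> + fun_sc (of_int (\<epsilon> * int n)) \<alpha> \<in> R"
    using isotropic_ray[OF \<alpha> \<beta> nz] by blast
  define c where "c = \<gamma> (t \<alpha>)"
  have c: "c \<noteq> 0" using nz \<gamma> by (simp add: c_def)
  have \<alpha>R: "\<alpha> \<in> R" "\<alpha> (t \<alpha>) = 0" using \<alpha> by (auto simp: R_null_iff)
  note X = rootX[OF \<alpha>R(1)] rootX[OF \<gamma>(1)]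
  define A where "A = \<gamma> (t \<gamma>)"
  define N where "N n = A + 2 * of_int (\<epsilon> * int n) * c" for n
  have comm: "\<alpha> (t \<gamma>) = c" using eval_commute X by (simp add: c_def)
  have norm: "\<delta> (t \<delta>) = N n" "\<alpha> (t \<delta>) = c" if "\<delta> = \<gamma> + fun_sc (of_int (\<epsilon> * int n)) \<alpha>" for \<delta> n
    using X \<alpha>R comm
    by (simp_all add: that t_add t_scale F.span_scale dual_linear X_dual t_T subspace_scale[OF subspace_T]
        N_def A_def c_def algebra_simps)
  have int: "\<exists>k::int. of_int k * N n = 2 * c" if "N n \<noteq> 0" for n
  proof -
    let ?\<delta> = "\<gamma> + fun_sc (of_int (\<epsilon> * int n)) \<alpha>"
    have \<delta>: "?\<delta> \<in> R_an" using ray norm(1)[OF refl] that by (simp add: R_an_iff)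
    obtain a b :: nat where "\<alpha> (coroot ?\<delta>) = of_nat a - of_nat b"
      using root_string[OF \<delta> \<alpha>R(1)] by blast
    then have "of_int (int a - int b) * N n = 2 * c"
      using that eval_coroot[OF \<delta> root_dual[OF \<alpha>R(1)]] norm[OF refl] by simp
    then show ?thesis by blast
  qed
  have step: "N (n + d) = N n + 2 * of_int (\<epsilon> * int d) * c" for n d by (simp add: N_def algebra_simps)
  \<comment> \<open>\<open>N\<close> is affine and not constant, so it vanishes at most once\<close>
  obtain n where n: "N n \<noteq> 0" "N (n + 3) \<noteq> 0"
  proof -
    have nz: "N (i + d) \<noteq> 0" if "N i = 0" "d > 0" for i d
      using step[of i d] that c \<epsilon> by auto
    show thesis
    proof (cases "\<exists>i. N i = 0")
      case True
      then obtain i where "N i = 0" ..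
      then show thesis using that[of "i + 1"] nz[of i 1] nz[of i 4] by (simp add: add.commute add.left_commute)
    qed (use that[of 0] in auto)
  qed
  obtain k k' :: int where k: "of_int k * N n = 2 * c" and k': "of_int k' * N (n + 3) = 2 * c"
    using int n by blast
  have "of_int k * (of_int k' * (N n + 2 * of_int (\<epsilon> * 3) * c)) = of_int k * (2 * c)"
    using k' step[of n 3] by simp
  then have "of_int k' * (of_int k * N n) + 2 * of_int (3 * \<epsilon> * k * k') * c = of_int k * (2 * c)"
    by (simp add: algebra_simps)
  then have "(of_int (k' * (1 + 3 * \<epsilon> * k)) :: 'k) * (2 * c) = of_int k * (2 * c)"
    unfolding k by (simp add: algebra_simps)
  then have "k' * (1 + 3 * \<epsilon> * k) = k" using c by (metis mult_right_cancel mult_eq_0_iff of_int_eq_iff zero_neq_numeral)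
  then have "(1 + 3 * \<epsilon> * k) dvd k" by (metis dvd_triv_right)
  moreover have "k \<noteq> 0" using k c by auto
  ultimately have "\<bar>1 + 3 * \<epsilon> * k\<bar> \<le> \<bar>k\<bar>" using dvd_imp_le_int by blast
  then show False using \<epsilon> \<open>k \<noteq> 0\<close> by auto
qed

lemma bilinear_form_X: "bilinear_form_on fun_sc X (form_X T B)"
  by (auto simp: bilinear_form_on_def linear_on_def form_X_def t_add t_scale B_add_left B_add_right
      B_scale_left B_scale_right)

end

section \<open>The reflection system of the roots\<close>

sublocale iara \<subseteq> Q: root_string_form fun_sc "roots sc br T" "form_X T B"
proof
  show "0 \<in> R" by (rule zero_in_R)
  show "bilinear_form_on fun_sc X (form_X T B)" by (rule bilinear_form_X)
  show "symmetric_on X (form_X T B)" by (simp add: symmetric_on_def form_X_def B_commute)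
next
  fix \<alpha> \<beta> assume "\<alpha> \<in> R" "form_X T B \<alpha> \<alpha> = 0" "\<beta> \<in> R"
  then show "form_X T B \<beta> \<alpha> = 0"
    using isotropic_orthogonal[of \<alpha> \<beta>] by (simp add: form_X_eval rootX R_null_iff)
next
  fix \<alpha> \<beta> assume "\<alpha> \<in> R" "form_X T B \<alpha> \<alpha> \<noteq> 0" "\<beta> \<in> R"
  then have \<alpha>: "\<alpha> \<in> R_an" and \<beta>: "\<beta> \<in> R" by (auto simp: R_an_iff form_X_eval rootX)
  obtain m n :: nat where mn: "\<beta> (coroot \<alpha>) = of_nat m - of_nat n"
    "\<forall>i::int. - int m \<le> i \<and> i \<le> int n \<longrightarrow> \<beta> + fun_sc (of_int i) \<alpha> \<in> R"
    using root_string[OF \<alpha> \<beta>] by blast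
  have "2 * form_X T B \<beta> \<alpha> = \<beta> (coroot \<alpha>) * form_X T B \<alpha> \<alpha>"
    using \<alpha> \<beta> by (simp add: eval_coroot root_dual form_X_eval rootX R_an_iff)
  then show "\<exists>m n::nat. 2 * form_X T B \<beta> \<alpha> = (of_nat m - of_nat n) * form_X T B \<alpha> \<alpha> \<and>
        (\<forall>i::int. - int m \<le> i \<and> i \<le> int n \<longrightarrow> \<beta> + fun_sc (of_int i) \<alpha> \<in> R)"
    using mn by metis
qed

context iara
begin

abbreviation "s \<equiv> root_reflection sc br T B"

lemma s_eq_refl: "s = Q.refl"
  by (intro ext) (auto simp: root_reflection_def Q.refl_def R_an_iff form_X_eval rootX)

lemma real_roots_eq: "real_roots R X s = R_an"
  unfolding s_eq_refl Q.real_roots_refl by (auto simp: R_an_iff form_X_eval rootX)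

lemma imag_roots_eq: "imag_roots R X s = R_null"
  unfolding s_eq_refl Q.imag_roots_refl by (auto simp: R_null_iff form_X_eval rootX)

lemma affine_reflection_system_roots: "affine_reflection_system fun_sc R X s"
  unfolding s_eq_refl by (rule Q.affine_reflection_system_refl)

lemma symmetric_roots_R: "symmetric_roots R"
proof -
  have "R \<subseteq> uminus ` R" using neg_root by (intro subsetI image_eqI[of _ uminus "- _"]) auto
  then show ?thesis using neg_root by (auto simp: symmetric_roots_def)
qed

lemma integrable_triple_form_X:
  assumes "\<alpha> \<in> R_an"
  shows "\<exists>e h f. integrable_sl2_triple sc br T \<alpha> e h f \<and>
    (\<forall>\<beta>\<in>R. form_X T B \<beta> \<alpha> = form_X T B \<alpha> \<alpha> / 2 * \<beta> h)"
proof -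
  obtain e f where "integrable_sl2_triple sc br T \<alpha> e (coroot \<alpha>) f"
    by (rule integrable_triple[OF assms])
  moreover have "form_X T B \<beta> \<alpha> = form_X T B \<alpha> \<alpha> / 2 * \<beta> (coroot \<alpha>)" if "\<beta> \<in> R" for \<beta>
    using assms that by (simp add: eval_coroot root_dual form_X_eval rootX R_an_iff)
  ultimately show ?thesis by blast
qed

lemma isotropic_triple_form_X:
  assumes "\<alpha> \<in> R_null"
  shows "\<exists>e\<in>E \<alpha>. \<exists>u\<in>T. \<exists>f\<in>E (- \<alpha>). br e f = - u \<and> (\<forall>\<beta>\<in>R. form_X T B \<beta> \<alpha> = \<beta> u)"
proof -
  have \<alpha>: "\<alpha> \<in> R" using assms by (simp add: R_null_iff)
  obtain e f where "e \<in> E \<alpha>" "f \<in> E (- \<alpha>)" "br e f = - t \<alpha>" using root_pair[OF \<alpha>] by blast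
  then show ?thesis using \<alpha> by (intro bexI[of _ e] bexI[of _ "t \<alpha>"] bexI[of _ f])
      (auto simp: form_X_eval rootX t_T)
qed

lemma null_root_eval_zero: "\<nu> \<in> R_null \<Longrightarrow> \<alpha> \<in> X \<Longrightarrow> \<nu> (t \<alpha>) = 0"
  using Q.isotropic_in_radical[of \<nu>]
  by (simp add: Q.radical_def R_null_iff form_X_eval rootX)

text \<open>Adding an element of the radical does not change the square length.\<close>
lemma R_an_add_null: "\<alpha> + \<nu> \<in> R_an" if "\<alpha> \<in> R_an" "\<nu> \<in> R_null" "\<alpha> + \<nu> \<in> R"
proof -
  have X: "\<alpha> \<in> X" "\<nu> \<in> X" using that rootX by (auto simp: R_an_iff R_null_iff)
  have "\<nu> (t \<alpha>) = 0" "\<nu> (t \<nu>) = 0" "\<alpha> (t \<nu>) = 0"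
    using null_root_eval_zero[OF that(2)] X eval_commute by auto
  then show ?thesis using that X by (simp add: R_an_iff t_add dual_linear X_dual t_T)
qed

section \<open>The core and tameness\<close>

abbreviation "K \<equiv> core sc br T B"

lemma K_subspace: "subspace K"
  and K_br: "x \<in> K \<Longrightarrow> y \<in> K \<Longrightarrow> br x y \<in> K"
  and E_sub_K: "\<alpha> \<in> R_an \<Longrightarrow> x \<in> E \<alpha> \<Longrightarrow> x \<in> K"
  and K_minimal: "subspace M \<Longrightarrow> (\<And>x y. x \<in> M \<Longrightarrow> y \<in> M \<Longrightarrow> br x y \<in> M) \<Longrightarrow>
    (\<And>\<alpha> x. \<alpha> \<in> R_an \<Longrightarrow> x \<in> E \<alpha> \<Longrightarrow> x \<in> M) \<Longrightarrow> K \<subseteq> M"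
  unfolding core_def subalgebra_generated_def
  by (auto simp: subspace_def)

text \<open>By the Jacobi identity the centralizer of an element is a subalgebra, so generators suffice.\<close>
lemma core_centralized:
  assumes x: "\<And>\<alpha> y. \<alpha> \<in> R_an \<Longrightarrow> y \<in> E \<alpha> \<Longrightarrow> br x y = 0" and y: "y \<in> K"
  shows "br x y = 0"
proof -
  have "K \<subseteq> {y. br x y = 0}"
  proof (rule K_minimal)
    show "subspace {y. br x y = 0}"
      by (auto simp: subspace_def br_zero br_add_right br_scale_right)
    fix y z assume "y \<in> {y. br x y = 0}" "z \<in> {y. br x y = 0}"
    then show "br y z \<in> {y. br x y = 0}" by (simp add: br_jacobi[of x y z] br_zero)
  qed (use x in auto)
  then show ?thesis using y by blast
qed

text \<open>If \<open>\<alpha>\<close> is isotropic and \<open>\<beta>\<close> anisotropic, then \<open>\<beta> \<plusminus> \<alpha>\<close> is anisotropic as soon as it is a root, and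
  \<open>\<alpha>\<close> is a difference of the two. So if \<open>\<alpha>\<close> is not a sum of anisotropic roots, \<open>E\<^sub>\<plusminus>\<^sub>\<alpha>\<close> centralizes the core.
  For \<open>\<alpha> = 0\<close> the same assumption means that there is no anisotropic root at all; then the core is zero
  and its centralizer is everything.\<close>
lemma tame_algebra_imp_tame_roots:
  assumes tame: "tame_algebra sc br T B"
  shows "tame_roots R X s"
proof -
  have "\<exists>\<beta>\<in>R_an. \<exists>\<gamma>\<in>R_an. \<alpha> = \<beta> + \<gamma>" if \<alpha>: "\<alpha> \<in> R_null" for \<alpha>
  proof (rule ccontr)
    assume not: "\<not> ?thesis"
    have \<alpha>R: "\<alpha> \<in> R" using \<alpha> by (simp add: R_null_iff)
    have cent: "br x y = 0" if x: "x \<in> E \<delta>" "\<delta> = \<alpha> \<or> \<delta> = - \<alpha>" and y: "y \<in> K" for x y \<delta>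
    proof (rule core_centralized[OF _ y])
      fix \<beta> z assume \<beta>: "\<beta> \<in> R_an" and z: "z \<in> E \<beta>"
      have \<delta>: "\<delta> \<in> R_null"
        using x(2) \<alpha> \<alpha>R neg_root[OF \<alpha>R] by (auto simp: R_null_iff t_neg rootX dual_linear root_dual t_T)
      have bz: "br x z \<in> E (\<beta> + \<delta>)" using weight_br[OF x(1) z] by (simp add: add.commute)
      show "br x z = 0"
      proof (rule ccontr)
        assume "br x z \<noteq> 0"
        moreover have "\<beta> + \<delta> \<in> dual sc T"
          using \<beta> \<delta> by (intro dual_add root_dual) (auto simp: R_an_iff R_null_iff)
        ultimately have "\<beta> + \<delta> \<in> R" using rootI bz by blast
        then have an: "\<beta> + \<delta> \<in> R_an" using R_an_add_null[OF \<beta> \<delta>] by simp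
        have "\<exists>\<beta>\<in>R_an. \<exists>\<gamma>\<in>R_an. \<alpha> = \<beta> + \<gamma>"
          using x(2)
        proof
          assume "\<delta> = \<alpha>"
          then show ?thesis using an neg_R_an[OF \<beta>] by (intro bexI[of _ "\<beta> + \<delta>"] bexI[of _ "- \<beta>"]) auto
        next
          assume "\<delta> = - \<alpha>"
          then show ?thesis using \<beta> neg_R_an[OF an] by (intro bexI[of _ "\<beta>"] bexI[of _ "- (\<beta> + \<delta>)"]) auto
        qed
        with not show False by blast
      qed
    qed
    have sub: "centralizer br K \<subseteq> K" using tame by (simp add: tame_algebra_def)
    show False
    proof (cases "\<alpha> = 0")
      case True
      have "R_an = {}"
      proof (rule ccontr)
        assume "R_an \<noteq> {}"
        then obtain \<beta> where "\<beta> \<in> R_an" by blast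
        then show False using not True neg_R_an by force
      qed
      then have "K \<subseteq> {0}" by (intro K_minimal) (auto simp: br_zero)
      then have "x \<in> centralizer br K" for x by (auto simp: centralizer_def br_zero)
      then have "(UNIV :: 'e set) \<subseteq> {0}" using sub \<open>K \<subseteq> {0}\<close> by blast
      moreover have "\<exists>x::'e. x \<noteq> 0"
        using iara by (simp add: invariant_affine_reflection_algebra_def toral_pair_def)
      ultimately show False by blast
    next
      case False
      obtain e f where ef: "e \<in> E \<alpha>" "f \<in> E (- \<alpha>)" "\<alpha> \<noteq> 0 \<Longrightarrow> br e f \<noteq> 0"
        using root_pair[OF \<alpha>R] by blast
      have "f \<in> centralizer br K" using cent[OF ef(2)] by (auto simp: centralizer_def)
      then have "br e f = 0" using cent[OF ef(1)] sub by blast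
      then show False using ef False by simp
    qed
  qed
  then show ?thesis unfolding tame_roots_def real_roots_eq imag_roots_eq by blast
qed

lemma coroot_K: assumes "\<alpha> \<in> R_an" shows "coroot \<alpha> \<in> K"
proof -
  obtain e f where tr: "integrable_sl2_triple sc br T \<alpha> e (coroot \<alpha>) f"
    by (rule integrable_triple[OF assms])
  then have "e \<in> K" "f \<in> K" "coroot \<alpha> = br f e"
    using assms neg_R_an E_sub_K br_commute[of f e] by (auto simp: integrable_sl2_triple_def sl2_triple_def)
  then show ?thesis using K_br by simp
qed

lemma coroot_br: "\<alpha> \<in> R_an \<Longrightarrow> x \<in> E \<alpha> \<Longrightarrow> br (coroot \<alpha>) x = sc 2 x"
  using weight[of x \<alpha> "coroot \<alpha>"] coroot_T eval_coroot_self by simp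

text \<open>A root space of an isotropic root \<open>\<gamma>\<close> maps \<open>E\<^sub>\<alpha>\<close> with \<open>\<alpha>\<close> anisotropic into \<open>E\<^sub>\<alpha>\<^sub>+\<^sub>\<gamma>\<close>, which is zero or again
  one of the generating spaces; derivations that map generators into the core preserve it.\<close>
lemma core_ideal:
  assumes y: "y \<in> K" shows "br z y \<in> K"
proof -
  have root: "K \<subseteq> {y \<in> K. br z y \<in> K}" if \<gamma>: "\<gamma> \<in> R" and z: "z \<in> E \<gamma>" for \<gamma> z
  proof (rule K_minimal)
    show "subspace {y \<in> K. br z y \<in> K}"
      using K_subspace by (auto simp: subspace_def br_zero br_add_right br_scale_right)
    fix x y assume "x \<in> {y \<in> K. br z y \<in> K}" "y \<in> {y \<in> K. br z y \<in> K}"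
    then show "br x y \<in> {y \<in> K. br z y \<in> K}"
      by (auto simp: br_jacobi[of z x y] intro!: K_br subspace_add[OF K_subspace])
  next
    fix \<alpha> y assume \<alpha>: "\<alpha> \<in> R_an" and y: "y \<in> E \<alpha>"
    show "y \<in> {y \<in> K. br z y \<in> K}"
    proof (cases "\<gamma> \<in> R_an")
      case True
      then show ?thesis using E_sub_K[OF \<alpha> y] E_sub_K[OF _ z] K_br by simp
    next
      case False
      then have \<gamma>0: "\<gamma> \<in> R_null" using \<gamma> by (simp add: R_an_iff R_null_iff)
      have w: "br z y \<in> E (\<alpha> + \<gamma>)" using weight_br[OF z y] by (simp add: add.commute)
      have "br z y \<in> K"
      proof (cases "br z y = 0")
        case True
        then show ?thesis using K_subspace by (simp add: subspace_0)
      next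
        case False
        then have "\<alpha> + \<gamma> \<in> R"
          using rootI[OF _ w] \<alpha> \<gamma> by (simp add: dual_add root_dual R_an_iff)
        then show ?thesis using R_an_add_null[OF \<alpha> \<gamma>0] E_sub_K w by blast
      qed
      then show ?thesis using E_sub_K[OF \<alpha> y] by simp
    qed
  qed
  have "subspace {z. br z y \<in> K}"
    using K_subspace by (auto simp: subspace_def br_zero br_add_left br_scale_left)
  then have "span (\<Union>\<alpha>\<in>R. E \<alpha>) \<subseteq> {z. br z y \<in> K}"
    by (rule span_minimal[rotated]) (use root y in blast)
  then show ?thesis using weight_span by blast
qed

text \<open>Each generator is a bracket in the core, \<open>x = [h\<^sub>\<alpha>, x] / 2\<close>, so the core is perfect, and
  \<open>(z|[x, y]) = ([z, x]|y) = 0\<close>.\<close>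
lemma central_orthogonal_to_core:
  assumes z: "z \<in> centre br K" and y: "y \<in> K"
  shows "B z y = 0"
proof -
  have zK: "br z x = 0" if "x \<in> K" for x using z that by (simp add: centre_def)
  have "K \<subseteq> {y \<in> K. B z y = 0}"
  proof (rule K_minimal)
    show "subspace {y \<in> K. B z y = 0}"
      using K_subspace by (auto simp: subspace_def B_zero B_add_right B_scale_right)
    fix x y assume "x \<in> {y \<in> K. B z y = 0}" "y \<in> {y \<in> K. B z y = 0}"
    then show "br x y \<in> {y \<in> K. B z y = 0}"
      using zK[of x] by (simp add: K_br B_zero flip: B_invariant)
  next
    fix \<alpha> x assume \<alpha>: "\<alpha> \<in> R_an" and x: "x \<in> E \<alpha>"
    have "2 * B z x = B z (br (coroot \<alpha>) x)" by (simp add: coroot_br[OF \<alpha> x] B_scale_right)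
    also have "\<dots> = 0" using zK[OF coroot_K[OF \<alpha>]] by (simp add: B_zero flip: B_invariant)
    finally show "x \<in> {y \<in> K. B z y = 0}" using E_sub_K[OF \<alpha> x] by simp
  qed
  then show ?thesis using y by blast
qed

text \<open>For \<open>y\<close> in the core and any \<open>z\<close>, \<open>([x, y]|z) = (x|[y, z]) = 0\<close> because the core is an ideal; the form on
  the whole algebra is nondegenerate.\<close>
lemma orthogonal_to_core_central:
  assumes x: "x \<in> K" and orth: "\<And>y. y \<in> K \<Longrightarrow> B x y = 0"
  shows "x \<in> centre br K"
proof -
  have "br x y = 0" if y: "y \<in> K" for y
  proof (rule B_nondegenerate)
    fix z
    have "br y z \<in> K" using core_ideal[OF y, of z] br_commute[of y z] K_subspace by (simp add: subspace_neg)
    then show "B (br x y) z = 0" using orth by (simp add: B_invariant)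
  qed
  then show ?thesis using x by (simp add: centre_def)
qed

lemma weight_independent_inj:
  assumes "finite J" "inj_on w J" "\<And>i. i \<in> J \<Longrightarrow> w i \<in> dual sc T" "\<And>i. i \<in> J \<Longrightarrow> x i \<in> E (w i)"
    "(\<Sum>i\<in>J. x i) = 0" "i \<in> J"
  shows "x i = 0"
proof -
  let ?y = "\<lambda>\<alpha>. x (the_inv_into J w \<alpha>)"
  have inv: "?y (w i) = x i" if "i \<in> J" for i using that by (simp add: the_inv_into_f_f[OF assms(2)])
  have "?y (w i) = 0"
  proof (rule weight_independent[of "w ` J" ?y])
    have "(\<Sum>\<alpha>\<in>w ` J. ?y \<alpha>) = (\<Sum>i\<in>J. x i)"
      by (subst sum.reindex[OF assms(2)]) (simp add: inv)
    then show "(\<Sum>\<alpha>\<in>w ` J. ?y \<alpha>) = 0" using assms(5) by simp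
    show "?y \<alpha> \<in> E \<alpha>" if "\<alpha> \<in> w ` J" for \<alpha> using that assms(4) inv by auto
  qed (use assms in auto)
  then show ?thesis using inv assms(6) by simp
qed

lemma span_br_closed:
  assumes "subspace M" "\<And>a c. a \<in> A \<Longrightarrow> c \<in> C \<Longrightarrow> br a c \<in> M" "x \<in> span A" "y \<in> span C"
  shows "br x y \<in> M"
proof -
  have sub: "subspace {x. br x c \<in> M}" "subspace {y. br x y \<in> M}" for x c
    using assms(1) by (auto simp: subspace_def br_zero br_add_left br_scale_left br_add_right br_scale_right)
  have "span A \<subseteq> {x. br x c \<in> M}" if "c \<in> C" for c
    by (rule span_minimal[OF _ sub(1)]) (use assms(2) that in auto)
  then have "span C \<subseteq> {y. br x y \<in> M}"
    by (intro span_minimal[OF _ sub(2)]) (use assms(3) in auto)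
  then show ?thesis using assms(4) by blast
qed

lemma span_B_orthogonal:
  assumes "\<And>a c. a \<in> A \<Longrightarrow> c \<in> C \<Longrightarrow> B a c = 0" "x \<in> span A" "y \<in> span C"
  shows "B x y = 0"
proof -
  have sub: "subspace {x. B x c = 0}" "subspace {y. B x y = 0}" for x c
    by (auto simp: subspace_def B_zero B_add_left B_scale_left B_add_right B_scale_right)
  have "span A \<subseteq> {x. B x c = 0}" if "c \<in> C" for c
    by (rule span_minimal[OF _ sub(1)]) (use assms(1) that in auto)
  then have "span C \<subseteq> {y. B x y = 0}"
    by (intro span_minimal[OF _ sub(2)]) (use assms(2) in auto)
  then show ?thesis using assms(3) by blast
qed

end

section \<open>The grading of the core\<close>

lemma group_closure_subset:
  assumes "A \<subseteq> M" "0 \<in> M" "\<And>x y. x \<in> M \<Longrightarrow> y \<in> M \<Longrightarrow> x - y \<in> M"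
  shows "group_closure A \<subseteq> M"
proof
  fix x assume "x \<in> group_closure A"
  then show "x \<in> M" by induction (use assms in auto)
qed

lemma group_closure_idem: "group_closure (group_closure A) = group_closure A"
  by (intro antisym group_closure_subset) (auto intro: group_closure.intros)
text \<open>The quotient root system and the section are parameters because the structure of the core is claimed
  for every choice of them.\<close>
locale core_grading = iara sc br T B
  for sc :: "'k::field_char_0 \<Rightarrow> 'e::ab_group_add \<Rightarrow> 'e" and br T B +
  fixes scY :: "'k \<Rightarrow> 'y::ab_group_add \<Rightarrow> 'y" and S Y :: "'y set" and sS :: "'y \<Rightarrow> 'y \<Rightarrow> 'y"
    and f :: "('e \<Rightarrow> 'k) \<Rightarrow> 'y" and g :: "'y \<Rightarrow> ('e \<Rightarrow> 'k)"
  assumes lfrs: "locally_finite_root_system scY S Y sS"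
    and extension: "reflection_extension fun_sc R X s scY S Y sS f"
    and section_g: "partial_section fun_sc R X s scY S Y sS f g"

sublocale core_grading \<subseteq> V: vector_space scY
  using lfrs by (simp add: locally_finite_root_system_def pre_reflection_system_def)

context core_grading
begin

lemma pre_S: "pre_reflection_system scY S Y sS"
  using lfrs by (simp add: locally_finite_root_system_def)

lemma zero_S: "0 \<in> S" and Y_span: "Y = V.span S"
  using pre_S by (auto simp: pre_reflection_system_def)

lemma S_Y: "\<xi> \<in> S \<Longrightarrow> \<xi> \<in> Y"
  by (simp add: Y_span V.span_base)

lemmas Y_closed = V.span_add[of _ S, folded Y_span] V.span_diff[of _ S, folded Y_span]
  V.span_neg[of _ S, folded Y_span] V.span_scale[of _ S, folded Y_span] V.span_zero[of S, folded Y_span]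

lemma real_S: "real_roots S Y sS = S - {0}"
proof -
  have "S = real_roots S Y sS \<union> {0}" using lfrs unfolding locally_finite_root_system_def by blast
  moreover have "0 \<notin> real_roots S Y sS" using pre_S by (auto simp: pre_reflection_system_def)
  ultimately show ?thesis by blast
qed

lemma imag_S: "imag_roots S Y sS = {0}"
  using zero_S by (auto simp: imag_roots_def real_S)

lemma f_an: "f ` R_an = S - {0}" and f_null: "f ` R_null = {0}"
  using extension by (simp_all add: reflection_extension_def real_roots_eq imag_roots_eq real_S imag_S)

lemma R_cases: "\<alpha> \<in> R \<Longrightarrow> \<alpha> \<in> R_an \<or> \<alpha> \<in> R_null"
  by (auto simp: R_an_iff R_null_iff)

lemma f_S: "\<alpha> \<in> R \<Longrightarrow> f \<alpha> \<in> S"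
  using R_cases[of \<alpha>] f_an f_null zero_S by (metis DiffD1 imageI singletonD)

lemma f_add: "x \<in> X \<Longrightarrow> y \<in> X \<Longrightarrow> f (x + y) = f x + f y"
  and f_scale: "x \<in> X \<Longrightarrow> f (fun_sc c x) = scY c (f x)"
  and f_Y: "x \<in> X \<Longrightarrow> f x \<in> Y"
  using extension by (auto simp: reflection_extension_def reflection_morphism_def linear_on_def)

lemma fun_sc_minus_one: "fun_sc (-1) x = - x" for x :: "'e \<Rightarrow> 'k"
  by (rule ext) simp

lemma f_neg: "x \<in> X \<Longrightarrow> f (- x) = - f x"
  using f_scale[of x "-1"] by (simp add: fun_sc_minus_one)

lemma f_diff: "x \<in> X \<Longrightarrow> y \<in> X \<Longrightarrow> f (x - y) = f x - f y"
  using f_add[of x "- y"] f_neg[of y] F.span_neg[of y R] by simp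

lemma g_add: "x \<in> Y \<Longrightarrow> y \<in> Y \<Longrightarrow> g (x + y) = g x + g y"
  and g_scale: "x \<in> Y \<Longrightarrow> g (scY c x) = fun_sc c (g x)"
  and g_X: "x \<in> Y \<Longrightarrow> g x \<in> X"
  and g_ind: "\<xi> \<in> indivisible_part scY S \<Longrightarrow> g \<xi> \<in> R"
  and f_g: "x \<in> Y \<Longrightarrow> f (g x) = x"
  using section_g by (auto simp: partial_section_def reflection_morphism_def linear_on_def)

lemma g_zero: "g 0 = 0"
  using g_scale[of 0 0] Y_closed(5) by (simp add: fun_eq_iff)

lemma g_neg: "x \<in> Y \<Longrightarrow> g (- x) = - g x"
  using g_scale[of x "-1"] by (simp add: fun_sc_minus_one)

lemma R_an_of_image: "\<alpha> \<in> R \<Longrightarrow> f \<alpha> \<noteq> 0 \<Longrightarrow> \<alpha> \<in> R_an"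
  using f_null R_cases by blast

lemma S_neg: "\<xi> \<in> S \<Longrightarrow> - \<xi> \<in> S"
proof -
  assume \<xi>: "\<xi> \<in> S"
  show ?thesis
  proof (cases "\<xi> = 0")
    case False
    then have "\<xi> \<in> f ` R_an" using f_an \<xi> by simp
    then obtain \<alpha> where "\<alpha> \<in> R" "\<xi> = f \<alpha>" using R_an_iff by blast
    then show ?thesis using f_S[OF neg_root] f_neg[OF rootX] by metis
  qed (use \<xi> in simp)
qed

text \<open>Both sides are linear in \<open>x\<close> and agree on the spanning set of roots.\<close>
lemma f_reflection:
  assumes \<beta>: "\<beta> \<in> R" and x: "x \<in> X"
  shows "f (s \<beta> x) = sS (f \<beta>) (f x)"
proof -
  have "\<forall>\<alpha>\<in>S. linear_on scY scY Y (sS \<alpha>) \<and> bij_betw (sS \<alpha>) Y Y"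
    using pre_S unfolding pre_reflection_system_def by (elim conjE)
  then have lin: "linear_on scY scY Y (sS (f \<beta>))"
    using f_S[OF \<beta>] by simp
  have slin: "linear_on fun_sc fun_sc X (s \<beta>)" and sX: "\<And>x. x \<in> X \<Longrightarrow> s \<beta> x \<in> X"
    unfolding s_eq_refl by (rule Q.linear_on_refl) (rule Q.refl_span)
  have "F.subspace {x \<in> X. f (s \<beta> x) = sS (f \<beta>) (f x)}"
    unfolding F.subspace_def
  proof (intro conjI ballI allI)
    have f0: "f 0 = 0" using f_scale[OF F.span_zero, of 0] by simp
    have "s \<beta> (fun_sc 0 0) = fun_sc 0 (s \<beta> 0)" using slin F.span_zero unfolding linear_on_def by blast
    moreover have "sS (f \<beta>) (scY 0 0) = scY 0 (sS (f \<beta>) 0)" using lin Y_closed(5) unfolding linear_on_def by blast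
    ultimately show "0 \<in> {x \<in> X. f (s \<beta> x) = sS (f \<beta>) (f x)}"
      using F.span_zero f0 by simp
  qed (use slin lin sX f_add f_scale f_Y in \<open>auto simp: linear_on_def F.span_add F.span_scale\<close>)
  moreover have "R \<subseteq> {x \<in> X. f (s \<beta> x) = sS (f \<beta>) (f x)}"
    using extension \<beta> rootX by (auto simp: reflection_extension_def reflection_morphism_def)
  ultimately show ?thesis using F.span_minimal x by blast
qed

lemma coroot_pairing_f:
  assumes \<beta>: "\<beta> \<in> R_an" and x: "x \<in> X"
  shows "coroot_pairing scY S Y sS (f x) (f \<beta>) = x (coroot \<beta>)"
proof -
  have \<beta>R: "\<beta> \<in> R" "\<beta> \<in> X" "f \<beta> \<in> S - {0}" using \<beta> R_an_iff rootX f_an by blast+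
  have "s \<beta> x = x - fun_sc (x (coroot \<beta>)) \<beta>"
    using \<beta> x \<beta>R by (simp add: root_reflection_def form_X_eval eval_coroot X_dual)
  then have eq: "sS (f \<beta>) (f x) = f x - scY (x (coroot \<beta>)) (f \<beta>)"
    using f_reflection[OF \<beta>R(1) x] x \<beta>R by (simp add: f_diff F.span_scale f_scale)
  have "(THE c. sS (f \<beta>) (f x) = f x - scY c (f \<beta>)) = x (coroot \<beta>)"
    using eq \<beta>R(3) by (intro the_equality) auto
  then show ?thesis using \<beta>R(3) by (simp add: coroot_pairing_def real_S)
qed

text \<open>The reflection in \<open>\<beta>\<close> moves \<open>\<nu>\<close> by \<open>\<nu>(h\<^sub>\<beta>) \<beta>\<close>, while the reflection in \<open>f \<beta>\<close> fixes \<open>f \<nu> = 0\<close>; and \<open>f \<beta> \<noteq> 0\<close>.\<close>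
lemma kernel_coroot_zero:
  assumes \<beta>: "\<beta> \<in> R_an" and \<nu>: "\<nu> \<in> X" "f \<nu> = 0"
  shows "\<nu> (coroot \<beta>) = 0"
proof -
  have "f 0 = 0" using f_scale[OF F.span_zero, of 0] by simp
  then have "\<nu> (coroot \<beta>) = (0 :: 'e \<Rightarrow> 'k) (coroot \<beta>)"
    using coroot_pairing_f[OF \<beta>] \<nu> F.span_zero by metis
  then show ?thesis by simp
qed

definition \<Lambda> where "\<Lambda> = Lambda R X S f g"

abbreviation comp where "comp \<equiv> core_component sc br T S g \<Lambda>"
abbreviation Lat where "Lat \<equiv> root_lattice S"
abbreviation S_ind where "S_ind \<equiv> indivisible_part scY S"

lemma \<Lambda>_ker: assumes "\<nu> \<in> \<Lambda>" shows "\<nu> \<in> X" "f \<nu> = 0"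
proof -
  have "f 0 = 0" using f_scale[OF F.span_zero, of 0] by simp
  then have "\<Lambda> \<subseteq> {\<nu> \<in> X. f \<nu> = 0}" unfolding \<Lambda>_def Lambda_def
    by (intro group_closure_subset) (auto simp: Lambda_at_def F.span_zero F.span_diff f_diff)
  then show "\<nu> \<in> X" "f \<nu> = 0" using assms by auto
qed

lemma \<Lambda>_add: "\<nu> \<in> \<Lambda> \<Longrightarrow> \<mu> \<in> \<Lambda> \<Longrightarrow> \<nu> + \<mu> \<in> \<Lambda>"
  and \<Lambda>_diff: "\<nu> \<in> \<Lambda> \<Longrightarrow> \<mu> \<in> \<Lambda> \<Longrightarrow> \<nu> - \<mu> \<in> \<Lambda>"
  and \<Lambda>_zero: "0 \<in> \<Lambda>"
  and \<Lambda>_closure: "group_closure \<Lambda> = \<Lambda>"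
  by (auto simp: \<Lambda>_def Lambda_def group_closure_add group_closure_idem intro: group_closure.diff)

lemma Lat_Y: "q \<in> Lat \<Longrightarrow> q \<in> Y"
  using group_closure_subset[of S Y] S_Y Y_closed by blast

lemma S_Lat: "q \<in> S \<Longrightarrow> q \<in> Lat"
  by (simp add: group_closure.base)

lemma root_decomposition: "\<alpha> \<in> R \<Longrightarrow> f \<alpha> \<in> S \<and> \<alpha> - g (f \<alpha>) \<in> \<Lambda>"
proof -
  assume \<alpha>: "\<alpha> \<in> R"
  then have "\<alpha> - g (f \<alpha>) \<in> Lambda_at R X f g (f \<alpha>)"
    by (simp add: Lambda_at_def rootX g_X f_Y F.span_diff f_diff f_g)
  then show ?thesis using f_S[OF \<alpha>] by (auto simp: \<Lambda>_def Lambda_def intro!: group_closure.base)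
qed

lemma wt_X: "q \<in> Y \<Longrightarrow> \<nu> \<in> \<Lambda> \<Longrightarrow> g q + \<nu> \<in> X"
  and f_wt: "q \<in> Y \<Longrightarrow> \<nu> \<in> \<Lambda> \<Longrightarrow> f (g q + \<nu>) = q"
  by (simp_all add: g_X \<Lambda>_ker F.span_add f_add f_g)

lemma comp_root: "q \<in> S \<Longrightarrow> q \<noteq> 0 \<Longrightarrow> comp q \<nu> = E (g q + \<nu>)"
  by (simp add: core_component_def)

lemma comp_outside: "q \<notin> S \<Longrightarrow> comp q \<nu> = {0}"
  using zero_S by (auto simp: core_component_def)

text \<open>As \<open>S = - S\<close>, the second weight space in the definition is itself the component of degree \<open>- \<tau>\<close>.\<close>
lemma comp_zero: "comp 0 \<nu> = span {br x y | x y \<tau> \<mu>. \<tau> \<in> S - {0} \<and> \<mu> \<in> \<Lambda> \<and>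
        x \<in> comp \<tau> \<mu> \<and> y \<in> comp (- \<tau>) (\<nu> - \<mu>)}"
proof -
  have "comp \<tau> \<mu> = E (g \<tau> + \<mu>) \<and> comp (- \<tau>) (\<nu> - \<mu>) = E (- g \<tau> + (\<nu> - \<mu>))"
    if "\<tau> \<in> S - {0}" for \<tau> \<mu>
    using that S_neg by (simp add: comp_root g_neg S_Y)
  then have "{br x y | x y \<tau> \<mu>. \<tau> \<in> S - {0} \<and> \<mu> \<in> \<Lambda> \<and>
        x \<in> E (g \<tau> + \<mu>) \<and> y \<in> E (- g \<tau> + (\<nu> - \<mu>))} = {br x y | x y \<tau> \<mu>. \<tau> \<in> S - {0} \<and> \<mu> \<in> \<Lambda> \<and>
        x \<in> comp \<tau> \<mu> \<and> y \<in> comp (- \<tau>) (\<nu> - \<mu>)}"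
    by (intro Collect_cong) metis
  then show ?thesis by (simp add: core_component_def)
qed

lemma subspace_comp: "subspace (comp q \<nu>)"
  using subspace_E by (auto simp: core_component_def subspace_single_0)

lemma comp_weight: "comp q \<nu> \<subseteq> E (g q + \<nu>)"
proof (cases "q \<in> S")
  case False
  then show ?thesis by (simp add: comp_outside E_zero)
next
  case True
  show ?thesis
  proof (cases "q = 0")
    case True
    have "br x y \<in> E \<nu>" if "\<tau> \<in> S - {0}" "x \<in> comp \<tau> \<mu>" "y \<in> comp (- \<tau>) (\<nu> - \<mu>)" for x y \<tau> \<mu>
    proof -
      have "x \<in> E (g \<tau> + \<mu>)" "y \<in> E (- g \<tau> + (\<nu> - \<mu>))"
        using that S_neg by (simp_all add: comp_root g_neg S_Y)
      from weight_br[OF this] show ?thesis by (simp add: algebra_simps)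
    qed
    then have "comp 0 \<nu> \<subseteq> E \<nu>"
      unfolding comp_zero by (intro span_minimal subspace_E) blast
    then show ?thesis using True by (simp add: g_zero)
  qed (use True in \<open>simp add: comp_root\<close>)
qed

lemma comp_K:
  assumes "q \<in> Lat" "\<nu> \<in> \<Lambda>" shows "comp q \<nu> \<subseteq> K"
proof -
  have root: "comp \<tau> \<mu> \<subseteq> K" if "\<tau> \<in> S - {0}" "\<mu> \<in> \<Lambda>" for \<tau> \<mu>
  proof
    fix x assume x: "x \<in> comp \<tau> \<mu>"
    show "x \<in> K"
    proof (cases "x = 0")
      case True
      then show ?thesis using K_subspace by (simp add: subspace_0)
    next
      case False
      have xE: "x \<in> E (g \<tau> + \<mu>)" using x comp_weight by blast
      have \<tau>: "\<tau> \<in> Y" using that S_Y by blast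
      have "g \<tau> + \<mu> \<in> R" using rootI[OF X_dual[OF wt_X[OF \<tau> that(2)]] xE False] .
      then have "g \<tau> + \<mu> \<in> R_an" using R_an_of_image f_wt[OF \<tau> that(2)] that(1) by auto
      then show ?thesis using E_sub_K xE by blast
    qed
  qed
  consider "q \<notin> S" | "q \<in> S - {0}" | "q = 0" by blast
  then show ?thesis
  proof cases
    case 3
    have "{br x y | x y \<tau> \<mu>. \<tau> \<in> S - {0} \<and> \<mu> \<in> \<Lambda> \<and>
        x \<in> comp \<tau> \<mu> \<and> y \<in> comp (- \<tau>) (\<nu> - \<mu>)} \<subseteq> K"
    proof -
      have "br x y \<in> K" if \<tau>: "\<tau> \<in> S - {0}" "\<mu> \<in> \<Lambda>" and xy: "x \<in> comp \<tau> \<mu>" "y \<in> comp (- \<tau>) (\<nu> - \<mu>)" for x y \<tau> \<mu>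
        using \<tau> xy S_neg[of \<tau>] root[of \<tau> \<mu>] root[of "- \<tau>" "\<nu> - \<mu>"] \<Lambda>_diff[OF assms(2) \<tau>(2)]
        by (intro K_br) (auto simp: subset_eq)
      then show ?thesis by blast
    qed
    then show ?thesis unfolding 3 comp_zero by (rule span_minimal[OF _ K_subspace])
  qed (use root assms K_subspace in \<open>auto simp: comp_outside subspace_0\<close>)
qed

text \<open>If \<open>p + q\<close> is not a root of the quotient, then no root of \<open>E\<close> lies above it and the bracket vanishes.\<close>
lemma comp_br_roots:
  assumes p: "p \<in> S - {0}" and q: "q \<in> S - {0}" and \<Lambda>: "\<nu> \<in> \<Lambda>" "\<mu> \<in> \<Lambda>"
    and x: "x \<in> comp p \<nu>" and y: "y \<in> comp q \<mu>"
  shows "br x y \<in> comp (p + q) (\<nu> + \<mu>)"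
proof -
  have Y: "p \<in> Y" "q \<in> Y" "p + q \<in> Y" using p q S_Y Y_closed by auto
  have eq: "g (p + q) + (\<nu> + \<mu>) = g p + \<nu> + (g q + \<mu>)" using Y by (simp add: g_add algebra_simps)
  have w: "br x y \<in> E (g (p + q) + (\<nu> + \<mu>))"
    unfolding eq by (intro weight_br subsetD[OF comp_weight] x y)
  consider "p + q \<in> S - {0}" | "p + q \<notin> S" | "p + q = 0" by blast
  then show ?thesis
  proof cases
    case 1
    then show ?thesis using w by (simp add: comp_root)
  next
    case 2
    have "br x y = 0"
    proof (rule ccontr)
      assume "br x y \<noteq> 0"
      then have "g (p + q) + (\<nu> + \<mu>) \<in> R"
        using rootI[OF X_dual[OF wt_X[OF Y(3) \<Lambda>_add[OF \<Lambda>]]] w] by simp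
      then show False using f_S f_wt[OF Y(3) \<Lambda>_add[OF \<Lambda>]] 2 by metis
    qed
    then show ?thesis using subspace_comp by (simp add: subspace_0)
  next
    case 3
    then have "q = - p" by (simp add: eq_neg_iff_add_eq_0 add.commute)
    then have "br x y \<in> {br x y | x y \<tau> \<kappa>. \<tau> \<in> S - {0} \<and> \<kappa> \<in> \<Lambda> \<and>
        x \<in> comp \<tau> \<kappa> \<and> y \<in> comp (- \<tau>) (\<nu> + \<mu> - \<kappa>)}"
      using p x y \<Lambda> by (intro CollectI exI[of _ x] exI[of _ y] exI[of _ p] exI[of _ \<nu>]) simp
    then show ?thesis unfolding 3 comp_zero by (rule span_base)
  qed
qed

lemma comp_br_degree_zero:
  assumes q: "q \<in> S - {0}" and x: "x \<in> comp 0 \<nu>" and y: "y \<in> comp q \<mu>"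
  shows "br x y \<in> comp q (\<nu> + \<mu>)" "br y x \<in> comp q (\<mu> + \<nu>)"
proof -
  have "x \<in> E \<nu>" "y \<in> E (g q + \<mu>)" using x y comp_weight[of 0 \<nu>] comp_weight by (auto simp: g_zero)
  from weight_br[OF this] show "br x y \<in> comp q (\<nu> + \<mu>)"
    using q by (simp add: comp_root algebra_simps)
  then show "br y x \<in> comp q (\<mu> + \<nu>)"
    using br_commute[of y x] subspace_neg[OF subspace_comp] by (simp add: add.commute)
qed

text \<open>Only degree \<open>0\<close> with itself is left: for \<open>x = [a, c]\<close> with \<open>a\<close>, \<open>c\<close> of opposite nonzero degrees,
  \<open>[[a, c], y] = [a, [c, y]] - [c, [a, y]]\<close> reduces it to the other cases.\<close>
lemma comp_br:
  assumes p: "p \<in> Lat" and q: "q \<in> Lat" and \<Lambda>: "\<nu> \<in> \<Lambda>" "\<mu> \<in> \<Lambda>"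
    and x: "x \<in> comp p \<nu>" and y: "y \<in> comp q \<mu>"
  shows "br x y \<in> comp (p + q) (\<nu> + \<mu>)"
proof -
  have zero: "0 \<in> comp (p + q) (\<nu> + \<mu>)" using subspace_comp by (simp add: subspace_0)
  consider "p \<notin> S \<or> q \<notin> S" | "p \<in> S - {0}" "q \<in> S - {0}" | "p = 0" "q \<in> S - {0}"
    | "p \<in> S - {0}" "q = 0" | "p = 0" "q = 0" by blast
  then show ?thesis
  proof cases
    case 1
    then have "br x y = 0" using x y comp_outside by (auto simp: br_zero)
    then show ?thesis using zero by simp
  next
    case 2
    then show ?thesis using comp_br_roots \<Lambda> x y by blast
  next
    case 3
    then show ?thesis using comp_br_degree_zero(1) x y by simp
  next
    case 4
    then show ?thesis using comp_br_degree_zero(2) x y by simp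
  next
    case 5
    have sub: "subspace {x. br x y \<in> comp 0 (\<nu> + \<mu>)}"
      using subspace_comp[of 0 "\<nu> + \<mu>"]
      by (auto simp: subspace_def br_zero br_add_left br_scale_left)
    have "br (br a c) y \<in> comp 0 (\<nu> + \<mu>)"
      if \<tau>: "\<tau> \<in> S - {0}" "\<kappa> \<in> \<Lambda>" and a: "a \<in> comp \<tau> \<kappa>" and c: "c \<in> comp (- \<tau>) (\<nu> - \<kappa>)" for a c \<tau> \<kappa>
    proof -
      have \<tau>': "- \<tau> \<in> S - {0}" using \<tau> S_neg by auto
      have y0: "y \<in> comp 0 \<mu>" using y 5 by simp
      have "br c y \<in> comp (- \<tau>) (\<nu> - \<kappa> + \<mu>)" by (rule comp_br_degree_zero(2)[OF \<tau>' y0 c])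
      from comp_br_roots[OF \<tau>(1) \<tau>' \<tau>(2) _ a this]
      have 1: "br a (br c y) \<in> comp 0 (\<nu> + \<mu>)"
        using \<Lambda> \<tau> \<Lambda>_add \<Lambda>_diff by (simp add: algebra_simps)
      have "br a y \<in> comp \<tau> (\<kappa> + \<mu>)" by (rule comp_br_degree_zero(2)[OF \<tau>(1) y0 a])
      from comp_br_roots[OF \<tau>' \<tau>(1) _ _ c this]
      have 2: "br c (br a y) \<in> comp 0 (\<nu> + \<mu>)"
        using \<Lambda> \<tau> \<Lambda>_add \<Lambda>_diff by (simp add: algebra_simps)
      have "br (br a c) y = br a (br c y) - br c (br a y)" by (simp add: br_jacobi[of a c y])
      then show ?thesis using 1 2 subspace_comp by (simp add: subspace_diff)
    qed
    then have "comp 0 \<nu> \<subseteq> {x. br x y \<in> comp 0 (\<nu> + \<mu>)}"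
      unfolding comp_zero[of \<nu>] by (intro span_minimal sub) blast
    then show ?thesis using 5 x by auto
  qed
qed

lemma Lat_add: "p \<in> Lat \<Longrightarrow> q \<in> Lat \<Longrightarrow> p + q \<in> Lat"
  by (rule group_closure_add)

text \<open>The span is closed under brackets by \<open>comp_br\<close> and contains the generators, because a root \<open>\<alpha>\<close> splits as
  \<open>g (f \<alpha>)\<close> plus an element of \<open>\<Lambda>\<close>.\<close>
lemma core_eq_span_comp: "K = span (\<Union>q\<in>Lat. \<Union>\<nu>\<in>\<Lambda>. comp q \<nu>)" (is "K = span ?U")
proof
  show "span ?U \<subseteq> K" using comp_K by (intro span_minimal K_subspace) blast
  show "K \<subseteq> span ?U"
  proof (rule K_minimal)
    fix x y assume "x \<in> span ?U" "y \<in> span ?U"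
    then show "br x y \<in> span ?U"
    proof (rule span_br_closed[OF subspace_span, rotated])
      fix a c assume "a \<in> ?U" "c \<in> ?U"
      then obtain p \<nu> q \<mu> where "p \<in> Lat" "q \<in> Lat" "\<nu> \<in> \<Lambda>" "\<mu> \<in> \<Lambda>" "a \<in> comp p \<nu>" "c \<in> comp q \<mu>"
        by blast
      then have "br a c \<in> comp (p + q) (\<nu> + \<mu>)" "p + q \<in> Lat" "\<nu> + \<mu> \<in> \<Lambda>"
        by (auto intro: comp_br Lat_add \<Lambda>_add)
      then have "br a c \<in> ?U" by blast
      then show "br a c \<in> span ?U" by (rule span_base)
    qed
  next
    fix \<alpha> x assume \<alpha>: "\<alpha> \<in> R_an" and x: "x \<in> E \<alpha>"
    then have "f \<alpha> \<in> S - {0}" "\<alpha> - g (f \<alpha>) \<in> \<Lambda>"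
      using f_an root_decomposition R_an_iff by blast+
    moreover from this have "x \<in> comp (f \<alpha>) (\<alpha> - g (f \<alpha>))" using x by (simp add: comp_root)
    ultimately have "x \<in> ?U" using S_Lat by blast
    then show "x \<in> span ?U" by (rule span_base)
  qed (rule subspace_span)
qed

lemma wt_inj:
  assumes "p \<in> Lat" "q \<in> Lat" "\<nu> \<in> \<Lambda>" "\<mu> \<in> \<Lambda>" "g p + \<nu> = g q + \<mu>"
  shows "p = q \<and> \<nu> = \<mu>"
  using assms f_wt[OF Lat_Y] by (metis add_left_cancel)

lemma section_anisotropic:
  assumes "\<alpha> \<in> S_ind - {0}" shows "g \<alpha> \<in> R_an"
proof -
  have "\<alpha> \<in> S" using assms zero_S by (auto simp: indivisible_part_def)
  then show ?thesis using assms g_ind R_an_of_image[of "g \<alpha>"] f_g[OF S_Y] by auto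
qed
text \<open>Otherwise \<open>\<xi>/4\<close> would be a root, and its Cartan number with \<open>\<xi>\<close> is \<open>1/2\<close>.\<close>
lemma root_or_half_indivisible:
  assumes "\<xi> \<in> S"
  shows "\<xi> \<in> S_ind \<or> scY (1/2) \<xi> \<in> S_ind"
proof (rule ccontr)
  assume not: "\<not> ?thesis"
  then have "\<xi> \<noteq> 0" "scY (1/2) \<xi> \<in> S" "scY (1/2) (scY (1/2) \<xi>) \<in> S"
    using assms by (auto simp: indivisible_part_def)
  then have q: "scY (1/4) \<xi> \<in> S" by simp
  obtain \<alpha> where \<alpha>: "\<alpha> \<in> R_an" "\<xi> = f \<alpha>" using f_an assms \<open>\<xi> \<noteq> 0\<close> by blast
  then have \<alpha>X: "\<alpha> \<in> X" using R_an_iff rootX by blast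
  have "coroot_pairing scY S Y sS (scY (1/4) \<xi>) \<xi> \<in> \<int>"
    using lfrs q assms unfolding locally_finite_root_system_def by blast
  moreover have "coroot_pairing scY S Y sS (scY (1/4) \<xi>) \<xi> = 1/2"
    using coroot_pairing_f[OF \<alpha>(1) F.span_scale[OF \<alpha>X, of "1/4"]] \<alpha> \<alpha>X
    by (simp add: f_scale eval_coroot_self)
  ultimately obtain n :: int where "(1/2 :: 'k) = of_int n" by (auto elim: Ints_cases)
  then have "(1 :: 'k) = 2 * of_int n" by (simp add: field_simps)
  then have "of_int (2 * n) = (of_int 1 :: 'k)" by simp
  then have "2 * n = 1" unfolding of_int_eq_iff .
  then show False by presburger
qed

end

section \<open>The centreless core\<close>

locale centreless_core = core_grading sc br T B scY S Y sS f g
  for sc :: "'k::field_char_0 \<Rightarrow> 'e::ab_group_add \<Rightarrow> 'e" and br T B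
    and scY :: "'k \<Rightarrow> 'y::ab_group_add \<Rightarrow> 'y" and S Y sS f g +
  fixes scL :: "'k \<Rightarrow> 'l::ab_group_add \<Rightarrow> 'l" and L :: "'l set" and brL :: "'l \<Rightarrow> 'l \<Rightarrow> 'l"
    and \<pi> :: "'e \<Rightarrow> 'l"
  assumes quotient: "lie_quotient sc K br (centre br K) scL L brL \<pi>"

sublocale centreless_core \<subseteq> W: vector_space scL
  using quotient by (simp add: lie_quotient_def lie_algebra_def)

context centreless_core
begin

lemma lie_L: "lie_algebra scL L brL"
  and \<pi>_add: "x \<in> K \<Longrightarrow> y \<in> K \<Longrightarrow> \<pi> (x + y) = \<pi> x + \<pi> y"
  and \<pi>_scale: "x \<in> K \<Longrightarrow> \<pi> (sc c x) = scL c (\<pi> x)"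
  and \<pi>_image: "\<pi> ` K = L"
  and \<pi>_br: "x \<in> K \<Longrightarrow> y \<in> K \<Longrightarrow> brL (\<pi> x) (\<pi> y) = \<pi> (br x y)"
  and \<pi>_kernel: "{x \<in> K. \<pi> x = 0} = centre br K"
  using quotient by (auto simp: lie_quotient_def linear_on_def)

lemma \<pi>_zero_iff: "x \<in> K \<Longrightarrow> \<pi> x = 0 \<longleftrightarrow> x \<in> centre br K"
  using \<pi>_kernel by blast

lemmas K_zero = subspace_0[OF K_subspace] and K_add = subspace_add[OF K_subspace]
  and K_scale = subspace_scale[OF K_subspace] and K_neg = subspace_neg[OF K_subspace]
  and K_diff = subspace_diff[OF K_subspace]

lemma \<pi>_zero: "\<pi> 0 = 0"
  using \<pi>_scale[OF K_zero, of 0] by simp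

lemma \<pi>_neg: "x \<in> K \<Longrightarrow> \<pi> (- x) = - \<pi> x"
  using \<pi>_scale[of x "-1"] by simp

lemma \<pi>_diff: "x \<in> K \<Longrightarrow> y \<in> K \<Longrightarrow> \<pi> (x - y) = \<pi> x - \<pi> y"
  using \<pi>_add[of x "- y"] \<pi>_neg[of y] K_neg by simp

lemma \<pi>_sum: "(\<And>i. i \<in> J \<Longrightarrow> x i \<in> K) \<Longrightarrow> \<pi> (sum x J) = (\<Sum>i\<in>J. \<pi> (x i)) \<and> sum x J \<in> K"
  by (induction J rule: infinite_finite_induct) (auto simp: \<pi>_zero K_zero \<pi>_add K_add)

lemma \<pi>_subspace:
  assumes "subspace M" "M \<subseteq> K" shows "W.subspace (\<pi> ` M)"
  unfolding W.subspace_def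
proof (intro conjI ballI allI)
  show "0 \<in> \<pi> ` M" using \<pi>_zero subspace_0[OF assms(1)] by (metis image_eqI)
next
  fix u v assume "u \<in> \<pi> ` M" "v \<in> \<pi> ` M"
  then obtain x y where "x \<in> M" "y \<in> M" "u = \<pi> x" "v = \<pi> y" by blast
  then show "u + v \<in> \<pi> ` M" using assms by (intro image_eqI[of _ _ "x + y"]) (auto simp: \<pi>_add subspace_add subset_eq)
next
  fix c u assume "u \<in> \<pi> ` M"
  then obtain x where "x \<in> M" "u = \<pi> x" by blast
  then show "scL c u \<in> \<pi> ` M" using assms by (intro image_eqI[of _ _ "sc c x"]) (auto simp: \<pi>_scale subspace_scale subset_eq)
qed

lemma \<pi>_span:
  assumes "A \<subseteq> K" shows "W.span (\<pi> ` A) = \<pi> ` span A"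
proof
  have sub: "span A \<subseteq> K" by (rule span_minimal[OF assms K_subspace])
  show "W.span (\<pi> ` A) \<subseteq> \<pi> ` span A"
    by (intro W.span_minimal \<pi>_subspace subspace_span sub) (auto intro: span_base)
  have "subspace {x \<in> K. \<pi> x \<in> W.span (\<pi> ` A)}"
    by (auto simp: subspace_def \<pi>_zero K_zero K_add K_scale \<pi>_add \<pi>_scale
        W.span_zero W.span_add W.span_scale)
  then have "span A \<subseteq> {x \<in> K. \<pi> x \<in> W.span (\<pi> ` A)}"
    by (rule span_minimal[rotated]) (use assms in \<open>auto intro: W.span_base\<close>)
  then show "\<pi> ` span A \<subseteq> W.span (\<pi> ` A)" by blast
qed

abbreviation G where "G q \<nu> \<equiv> \<pi> ` comp q \<nu>"

lemma root_component_G: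
  assumes "q \<in> Lat" shows "root_component scL \<Lambda> G q = \<pi> ` span (\<Union>\<nu>\<in>\<Lambda>. comp q \<nu>)"
proof -
  have "(\<Union>\<nu>\<in>\<Lambda>. comp q \<nu>) \<subseteq> K" using comp_K assms by blast
  from \<pi>_span[OF this] show ?thesis by (simp add: root_component_def image_UN)
qed

text \<open>The brackets of the homogeneous terms with a root vector have distinct weights, so they vanish one by
  one; in this sense the centre is a graded ideal.\<close>
lemma homogeneous_sum_central:
  assumes J: "finite J" "J \<subseteq> Lat \<times> \<Lambda>" and z: "\<And>q \<nu>. (q, \<nu>) \<in> J \<Longrightarrow> z (q, \<nu>) \<in> comp q \<nu>"
    and cen: "(\<Sum>i\<in>J. z i) \<in> centre br K" and i: "i \<in> J"
  shows "z i \<in> centre br K"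
proof -
  have zK: "z i \<in> K" if "i \<in> J" for i
    using z[of "fst i" "snd i"] comp_K[of "fst i" "snd i"] J that by (auto simp: subset_eq mem_Times_iff)
  have "br (z i) y = 0" if \<beta>: "\<beta> \<in> R_an" and y: "y \<in> E \<beta>" for \<beta> y
  proof (rule weight_independent_inj[of J "\<lambda>(q, \<nu>). g q + \<nu> + \<beta>" "\<lambda>i. br (z i) y" i])
    show "inj_on (\<lambda>(q, \<nu>). g q + \<nu> + \<beta>) J"
    proof (rule inj_onI, clarsimp)
      fix p \<nu> q \<mu> assume "(p, \<nu>) \<in> J" "(q, \<mu>) \<in> J" "g p + \<nu> = g q + \<mu>"
      then show "p = q \<and> \<nu> = \<mu>" using J(2) wt_inj[of p q \<nu> \<mu>] by auto
    qed
    have \<beta>': "\<beta> \<in> dual sc T" using \<beta> R_an_iff root_dual by blast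
    show "(case i of (q, \<nu>) \<Rightarrow> g q + \<nu> + \<beta>) \<in> dual sc T" if iJ: "i \<in> J" for i
    proof -
      obtain q \<nu> where i: "i = (q, \<nu>)" "q \<in> Lat" "\<nu> \<in> \<Lambda>" using J(2) iJ by blast
      show ?thesis using dual_add[OF X_dual[OF wt_X[OF Lat_Y[OF i(2)] i(3)]] \<beta>'] i(1) by simp
    qed
    show "br (z i) y \<in> E (case i of (q, \<nu>) \<Rightarrow> g q + \<nu> + \<beta>)" if "i \<in> J" for i
      using z[of "fst i" "snd i"] that comp_weight[of "fst i" "snd i"]
      by (auto simp: split_beta intro!: weight_br y)
    show "(\<Sum>i\<in>J. br (z i) y) = 0"
      using cen E_sub_K[OF \<beta> y] by (simp add: centre_def flip: br_sum)
  qed (use J i in auto)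
  then show ?thesis using core_centralized zK[OF i] by (auto simp: centre_def)
qed

lemma graded_L: "graded_lie_algebra scL L brL Lat \<Lambda> G"
proof -
  have "direct_sum scL L (Lat \<times> \<Lambda>) (\<lambda>(q, \<nu>). G q \<nu>)"
    unfolding direct_sum_def
  proof (intro conjI ballI allI impI)
    show "W.subspace (case i of (q, \<nu>) \<Rightarrow> G q \<nu>)" if "i \<in> Lat \<times> \<Lambda>" for i
      using that comp_K by (auto intro!: \<pi>_subspace subspace_comp)
    have "W.span (\<pi> ` (\<Union>q\<in>Lat. \<Union>\<nu>\<in>\<Lambda>. comp q \<nu>)) = L"
      using \<pi>_span[of "\<Union>q\<in>Lat. \<Union>\<nu>\<in>\<Lambda>. comp q \<nu>"] comp_K core_eq_span_comp \<pi>_image by (simp add: UN_subset_iff)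
    moreover have "\<pi> ` (\<Union>q\<in>Lat. \<Union>\<nu>\<in>\<Lambda>. comp q \<nu>) = (\<Union>i\<in>Lat \<times> \<Lambda>. case i of (q, \<nu>) \<Rightarrow> G q \<nu>)"
      by auto
    ultimately show "L = W.span (\<Union>i\<in>Lat \<times> \<Lambda>. case i of (q, \<nu>) \<Rightarrow> G q \<nu>)" by simp
  next
    fix J x i
    assume J: "finite J \<and> J \<subseteq> Lat \<times> \<Lambda> \<and> (\<forall>i\<in>J. x i \<in> (case i of (q, \<nu>) \<Rightarrow> G q \<nu>)) \<and> (\<Sum>i\<in>J. x i) = 0"
      and i: "i \<in> J"
    have "\<forall>i\<in>J. \<exists>w. w \<in> comp (fst i) (snd i) \<and> \<pi> w = x i"
      using J by (auto simp: split_beta image_iff) (metis fst_conv snd_conv)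
    then obtain z where z: "\<And>i. i \<in> J \<Longrightarrow> z i \<in> comp (fst i) (snd i) \<and> \<pi> (z i) = x i" by metis
    have zK: "z i \<in> K" if "i \<in> J" for i
      using z[OF that] comp_K[of "fst i" "snd i"] J that by (auto simp: subset_eq mem_Times_iff)
    have "\<pi> (sum z J) = 0" "sum z J \<in> K" using \<pi>_sum[of J z] zK z J by simp_all
    then have "(\<Sum>i\<in>J. z i) \<in> centre br K" using \<pi>_zero_iff by blast
    then have "z i \<in> centre br K"
      by (rule homogeneous_sum_central[rotated 3]) (use J i z in force)+
    then show "x i = 0" using z i zK \<pi>_zero_iff by metis
  qed
  moreover have "brL x y \<in> G (p + q) (\<nu> + \<mu>)"
    if pq: "p \<in> Lat" "q \<in> Lat" "\<nu> \<in> \<Lambda>" "\<mu> \<in> \<Lambda>" and x: "x \<in> G p \<nu>" and y: "y \<in> G q \<mu>" for p q \<nu> \<mu> x y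
  proof -
    obtain x' y' where xy: "x' \<in> comp p \<nu>" "y' \<in> comp q \<mu>" "x = \<pi> x'" "y = \<pi> y'" using x y by blast
    then have "x' \<in> K" "y' \<in> K" using comp_K pq by blast+
    then show ?thesis using xy comp_br[OF pq xy(1,2)] by (simp add: \<pi>_br)
  qed
  ultimately show ?thesis using lie_L by (simp add: graded_lie_algebra_def)
qed

text \<open>In the triple of the root \<open>\<beta> = g \<alpha> + \<nu>\<close> the vector \<open>e\<close> is not central, as \<open>[h\<^sub>\<beta>, e] = 2e\<close>, and \<open>h\<^sub>\<beta>\<close> acts on the weight \<open>g q + \<mu>\<close> by the
  Cartan number of \<open>f (g q + \<mu>) = q\<close> with respect to \<open>f \<beta> = \<alpha>\<close>.\<close>
lemma invertible_root_vector:
  assumes \<alpha>: "\<alpha> \<in> S - {0}" and \<nu>: "\<nu> \<in> \<Lambda>" and root: "g \<alpha> + \<nu> \<in> R"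
  obtains e f' where "invertible_pair scL brL scY S Y sS \<Lambda> G \<alpha> \<nu> e f'"
    "brL e f' = \<pi> (- coroot (g \<alpha> + \<nu>))"
proof -
  let ?\<beta> = "g \<alpha> + \<nu>"
  have \<alpha>Y: "\<alpha> \<in> Y" using \<alpha> S_Y by blast
  have \<beta>: "?\<beta> \<in> R_an" "f ?\<beta> = \<alpha>" using R_an_of_image[OF root] f_wt[OF \<alpha>Y \<nu>] \<alpha> by auto
  obtain e f' where tr: "integrable_sl2_triple sc br T ?\<beta> e (coroot ?\<beta>) f'" and "e \<noteq> 0"
    by (rule integrable_triple[OF \<beta>(1)])
  then have e: "e \<in> E ?\<beta>" and f': "f' \<in> E (- ?\<beta>)" and ef: "br e f' = - coroot ?\<beta>"
    by (auto simp: integrable_sl2_triple_def sl2_triple_def)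
  have K: "e \<in> K" "f' \<in> K" using E_sub_K \<beta>(1) neg_R_an e f' by blast+
  have fe: "br f' e = coroot ?\<beta>" using br_commute[of f' e] ef by simp
  have "e \<notin> centre br K"
  proof
    assume "e \<in> centre br K"
    then have "br (coroot ?\<beta>) e = 0"
      using coroot_K[OF \<beta>(1)] br_commute[of "coroot ?\<beta>" e] by (simp add: centre_def)
    then show False using coroot_br[OF \<beta>(1) e] \<open>e \<noteq> 0\<close> by simp
  qed
  then have "\<pi> e \<noteq> 0" using \<pi>_zero_iff K by blast
  moreover have "\<pi> e \<in> G \<alpha> \<nu>" using e \<alpha> by (simp add: comp_root)
  moreover have "\<pi> f' \<in> G (- \<alpha>) (- \<nu>)"
  proof -
    have "- ?\<beta> = g (- \<alpha>) + (- \<nu>)" using \<alpha>Y by (simp add: g_neg)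
    then show ?thesis using f' \<alpha> S_neg by (simp add: comp_root)
  qed
  moreover have "brL (brL (\<pi> f') (\<pi> e)) x = scL (coroot_pairing scY S Y sS q \<alpha>) x"
    if q: "q \<in> Lat" and x: "x \<in> root_component scL \<Lambda> G q" for q x
  proof -
    let ?c = "coroot_pairing scY S Y sS q \<alpha>"
    obtain z where z: "z \<in> span (\<Union>\<nu>\<in>\<Lambda>. comp q \<nu>)" "x = \<pi> z" using x root_component_G[OF q] by auto
    have sub: "subspace {z \<in> K. br (coroot ?\<beta>) z = sc ?c z}"
      using K_subspace by (auto simp: subspace_def br_zero br_add_right br_scale_right
          scale_right_distrib scale_left_commute)
    have "comp q \<mu> \<subseteq> {z \<in> K. br (coroot ?\<beta>) z = sc ?c z}" if \<mu>: "\<mu> \<in> \<Lambda>" for \<mu>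
    proof
      fix w assume w: "w \<in> comp q \<mu>"
      have "w \<in> E (g q + \<mu>)" using w comp_weight by blast
      then have "br (coroot ?\<beta>) w = sc ((g q + \<mu>) (coroot ?\<beta>)) w"
        by (rule weight[OF _ coroot_T[OF \<beta>(1)]])
      also have "(g q + \<mu>) (coroot ?\<beta>) = ?c"
        using coroot_pairing_f[OF \<beta>(1) wt_X[OF Lat_Y[OF q] \<mu>]] f_wt[OF Lat_Y[OF q] \<mu>] \<beta>(2) by simp
      finally show "w \<in> {z \<in> K. br (coroot ?\<beta>) z = sc ?c z}" using w comp_K[OF q \<mu>] by blast
    qed
    then have "span (\<Union>\<nu>\<in>\<Lambda>. comp q \<nu>) \<subseteq> {z \<in> K. br (coroot ?\<beta>) z = sc ?c z}"
      by (intro span_minimal[OF _ sub]) blast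
    then have "z \<in> K" "br (coroot ?\<beta>) z = sc ?c z" using z by auto
    then show ?thesis using z K coroot_K[OF \<beta>(1)] by (simp add: \<pi>_br fe \<pi>_scale)
  qed
  ultimately have "invertible_pair scL brL scY S Y sS \<Lambda> G \<alpha> \<nu> (\<pi> e) (\<pi> f')"
    by (auto simp: invertible_pair_def)
  then show thesis using that K ef by (metis \<pi>_br)
qed

lemma invertible_indivisible:
  assumes "\<alpha> \<in> S_ind - {0}"
  obtains e f' where "invertible_pair scL brL scY S Y sS \<Lambda> G \<alpha> 0 e f'"
    "brL e f' = \<pi> (- coroot (g \<alpha>))"
proof -
  have "\<alpha> \<in> S - {0}" using assms zero_S by (auto simp: indivisible_part_def)
  moreover have "g \<alpha> + 0 \<in> R" using g_ind assms by simp
  ultimately show thesis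
    using invertible_root_vector[OF _ \<Lambda>_zero, of \<alpha>] that by (metis add_0_right)
qed

text \<open>Degree zero of the core is spanned by brackets of components of opposite nonzero degree, and the
  projection carries these to the brackets on the right. Conversely such brackets have degree zero.\<close>
lemma root_component_zero:
  "root_component scL \<Lambda> G 0 = W.span {brL x y | x y \<alpha>. \<alpha> \<in> S - {0} \<and>
      x \<in> root_component scL \<Lambda> G \<alpha> \<and> y \<in> root_component scL \<Lambda> G (- \<alpha>)}" (is "_ = W.span ?C")
proof
  have S: "\<alpha> \<in> Lat" "- \<alpha> \<in> Lat" if "\<alpha> \<in> S - {0}" for \<alpha> using that S_Lat S_neg by auto
  have "G 0 \<nu> \<subseteq> W.span ?C" if \<nu>: "\<nu> \<in> \<Lambda>" for \<nu>
  proof -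
    let ?D = "{br x y | x y \<tau> \<mu>. \<tau> \<in> S - {0} \<and> \<mu> \<in> \<Lambda> \<and> x \<in> comp \<tau> \<mu> \<and> y \<in> comp (- \<tau>) (\<nu> - \<mu>)}"
    have D: "br x y \<in> K \<and> \<pi> (br x y) \<in> ?C"
      if \<tau>: "\<tau> \<in> S - {0}" "\<mu> \<in> \<Lambda>" and xy: "x \<in> comp \<tau> \<mu>" "y \<in> comp (- \<tau>) (\<nu> - \<mu>)" for x y \<tau> \<mu>
    proof -
      have \<mu>': "\<nu> - \<mu> \<in> \<Lambda>" using \<Lambda>_diff \<nu> \<tau> by blast
      have K: "x \<in> K" "y \<in> K" using comp_K[OF S(1)] comp_K[OF S(2)] \<tau> \<mu>' xy by blast+
      have "\<pi> x \<in> root_component scL \<Lambda> G \<tau>" "\<pi> y \<in> root_component scL \<Lambda> G (- \<tau>)"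
        unfolding root_component_def using \<tau> \<mu>' xy by (auto intro!: W.span_base)
      then have "\<pi> (br x y) \<in> ?C"
        using \<tau>(1) \<pi>_br[OF K] by (intro CollectI exI[of _ "\<pi> x"] exI[of _ "\<pi> y"] exI[of _ \<tau>]) simp
      then show ?thesis using K_br[OF K] by blast
    qed
    have "?D \<subseteq> K" "\<pi> ` ?D \<subseteq> ?C" using D by blast+
    then show ?thesis unfolding comp_zero using \<pi>_span[of ?D] W.span_mono by (metis (no_types, lifting))
  qed
  then show "root_component scL \<Lambda> G 0 \<subseteq> W.span ?C"
    unfolding root_component_def by (intro W.span_minimal W.subspace_span) blast
next
  let ?M = "span (\<Union>\<nu>\<in>\<Lambda>. comp 0 \<nu>)"
  have "brL x y \<in> \<pi> ` ?M" if \<alpha>: "\<alpha> \<in> S - {0}"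
    and xy: "x \<in> root_component scL \<Lambda> G \<alpha>" "y \<in> root_component scL \<Lambda> G (- \<alpha>)" for x y \<alpha>
  proof -
    have Lat: "\<alpha> \<in> Lat" "- \<alpha> \<in> Lat" using \<alpha> S_Lat S_neg by auto
    obtain x' y' where x'y': "x' \<in> span (\<Union>\<nu>\<in>\<Lambda>. comp \<alpha> \<nu>)" "y' \<in> span (\<Union>\<nu>\<in>\<Lambda>. comp (- \<alpha>) \<nu>)"
      "x = \<pi> x'" "y = \<pi> y'" using xy root_component_G Lat by auto
    have "br x' y' \<in> ?M"
    proof (rule span_br_closed[OF subspace_span _ x'y'(1,2)])
      fix a c assume "a \<in> (\<Union>\<nu>\<in>\<Lambda>. comp \<alpha> \<nu>)" "c \<in> (\<Union>\<nu>\<in>\<Lambda>. comp (- \<alpha>) \<nu>)"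
      then obtain \<nu> \<mu> where "\<nu> \<in> \<Lambda>" "\<mu> \<in> \<Lambda>" "a \<in> comp \<alpha> \<nu>" "c \<in> comp (- \<alpha>) \<mu>" by blast
      then have "br a c \<in> comp 0 (\<nu> + \<mu>)" "\<nu> + \<mu> \<in> \<Lambda>" using comp_br[OF Lat] \<Lambda>_add by auto
      then show "br a c \<in> ?M" by (auto intro: span_base)
    qed
    moreover have "x' \<in> K" "y' \<in> K"
    proof -
      have "span (\<Union>\<nu>\<in>\<Lambda>. comp \<alpha> \<nu>) \<subseteq> K" "span (\<Union>\<nu>\<in>\<Lambda>. comp (- \<alpha>) \<nu>) \<subseteq> K"
        using comp_K[OF Lat(1)] comp_K[OF Lat(2)] by (intro span_minimal K_subspace; blast)+
      then show "x' \<in> K" "y' \<in> K" using x'y' by auto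
    qed
    ultimately show ?thesis using x'y' by (simp add: \<pi>_br)
  qed
  then have "?C \<subseteq> \<pi> ` ?M" by blast
  moreover have "W.subspace (\<pi> ` ?M)"
    using comp_K S_Lat zero_S by (intro \<pi>_subspace subspace_span span_minimal K_subspace) blast
  ultimately show "W.span ?C \<subseteq> root_component scL \<Lambda> G 0"
    unfolding root_component_G[OF S_Lat[OF zero_S]] by (rule W.span_minimal)
qed

theorem predivision_graded_L: "predivision_graded scL L brL scY S Y sS \<Lambda> G"
proof -
  have "root_component scL \<Lambda> G q = {0}" if "q \<in> Lat - S" for q
    using that \<Lambda>_zero by (simp add: root_component_def comp_outside \<pi>_zero)
  moreover have "\<exists>e f'. invertible_pair scL brL scY S Y sS \<Lambda> G \<alpha> 0 e f'" if "\<alpha> \<in> S_ind - {0}" for \<alpha>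
    using invertible_indivisible[OF that] by blast
  moreover have "\<exists>e f'. invertible_pair scL brL scY S Y sS \<Lambda> G \<alpha> \<nu> e f'"
    if \<alpha>: "\<alpha> \<in> S - {0}" and \<nu>: "\<nu> \<in> \<Lambda>" and nz: "G \<alpha> \<nu> \<noteq> {0}" for \<alpha> \<nu>
  proof -
    have "comp \<alpha> \<nu> \<noteq> {0}" using nz \<pi>_zero by auto
    then obtain x where "x \<in> E (g \<alpha> + \<nu>)" "x \<noteq> 0"
      using \<alpha> E_zero[of "g \<alpha> + \<nu>"] by (auto simp: comp_root)
    then have "g \<alpha> + \<nu> \<in> R" using rootI[OF X_dual[OF wt_X]] S_Y \<alpha> \<nu> by blast
    then show ?thesis using invertible_root_vector[OF \<alpha> \<nu>] by blast
  qed
  ultimately show ?thesis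
    using lfrs \<Lambda>_closure graded_L root_component_zero by (simp add: predivision_graded_def)
qed

text \<open>The form on the quotient is computed on chosen representatives; it does not depend on them because
  the centre is orthogonal to the core.\<close>
definition BL where "BL u v = B (SOME x. x \<in> K \<and> \<pi> x = u) (SOME x. x \<in> K \<and> \<pi> x = v)"

lemma BL_\<pi>: assumes "x \<in> K" "y \<in> K" shows "BL (\<pi> x) (\<pi> y) = B x y"
proof -
  define x' y' where "x' = (SOME z. z \<in> K \<and> \<pi> z = \<pi> x)" and "y' = (SOME z. z \<in> K \<and> \<pi> z = \<pi> y)"
  have x': "x' \<in> K" "\<pi> x' = \<pi> x" and y': "y' \<in> K" "\<pi> y' = \<pi> y"
    using someI[of "\<lambda>z. z \<in> K \<and> \<pi> z = \<pi> x" x] someI[of "\<lambda>z. z \<in> K \<and> \<pi> z = \<pi> y" y] assms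
    by (auto simp: x'_def y'_def)
  have "x' - x \<in> centre br K" "y' - y \<in> centre br K"
    using x' y' assms \<pi>_zero_iff[of "x' - x"] \<pi>_zero_iff[of "y' - y"] by (simp_all add: \<pi>_diff K_diff)
  then have "B (x' - x) y' = 0" "B (y' - y) x = 0"
    using central_orthogonal_to_core y' assms by blast+
  then have "B x' y' = B x y" using B_commute[of x] by (simp add: B_diff)
  then show ?thesis by (simp add: BL_def x'_def y'_def)
qed

text \<open>An element \<open>u\<close> of the span of the coroots lies in \<open>T\<close>, is annihilated by \<open>\<Lambda>\<close>, and orthogonality says that
  it is annihilated by \<open>g \<xi>\<close> for indivisible \<open>\<xi>\<close>, hence for all \<open>\<xi>\<close>. So every anisotropic root vanishes
  at \<open>u\<close>, and \<open>u\<close> commutes with the generators of the core.\<close>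
lemma coroot_span_orthogonal_central:
  assumes u: "u \<in> span {- coroot (g \<alpha>) | \<alpha>. \<alpha> \<in> S_ind - {0}}"
    and orth: "\<And>\<alpha>. \<alpha> \<in> S_ind - {0} \<Longrightarrow> B u (coroot (g \<alpha>)) = 0"
  shows "u \<in> K \<and> u \<in> centre br K"
proof -
  have sub: "subspace {u \<in> K. u \<in> T \<and> (\<forall>\<nu>\<in>\<Lambda>. \<nu> u = 0)}"
    using K_subspace subspace_T \<Lambda>_ker(1)[THEN X_dual]
    by (auto simp: subspace_def dual_linear) (metis dual_scale_arg mult_zero_left scale_zero_left subspace_0 subspace_T)
  have "- coroot (g \<alpha>) \<in> {u \<in> K. u \<in> T \<and> (\<forall>\<nu>\<in>\<Lambda>. \<nu> u = 0)}" if "\<alpha> \<in> S_ind - {0}" for \<alpha>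
    using coroot_K[OF section_anisotropic[OF that]] coroot_T[OF section_anisotropic[OF that]] kernel_coroot_zero[OF section_anisotropic[OF that]] \<Lambda>_ker
      subspace_T
    by (auto simp: K_neg subspace_neg dual_neg_arg X_dual)
  then have "span {- coroot (g \<alpha>) | \<alpha>. \<alpha> \<in> S_ind - {0}} \<subseteq> {u \<in> K. u \<in> T \<and> (\<forall>\<nu>\<in>\<Lambda>. \<nu> u = 0)}"
    by (intro span_minimal[OF _ sub]) blast
  with u have uK: "u \<in> K" "u \<in> T" "\<And>\<nu>. \<nu> \<in> \<Lambda> \<Longrightarrow> \<nu> u = 0" by auto
  have ind: "g \<alpha> u = 0" if "\<alpha> \<in> S_ind" for \<alpha>
  proof (cases "\<alpha> = 0")
    case True
    then show ?thesis by (simp add: g_zero)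
  next
    case False
    then have \<alpha>: "\<alpha> \<in> S_ind - {0}" using that by simp
    have "g \<alpha> \<in> X" "g \<alpha> (t (g \<alpha>)) \<noteq> 0" using section_anisotropic[OF \<alpha>] rootX by (auto simp: R_an_iff)
    moreover have "B (coroot (g \<alpha>)) u = 0" using orth[OF \<alpha>] B_commute by metis
    ultimately show ?thesis using B_t uK(2) by (simp add: coroot_def B_scale_left)
  qed
  have gS: "g \<xi> u = 0" if "\<xi> \<in> S" for \<xi>
    using root_or_half_indivisible[OF that]
  proof
    assume "scY (1/2) \<xi> \<in> S_ind"
    from ind[OF this] show ?thesis by (simp add: g_scale S_Y[OF that])
  qed (rule ind)
  have "br u y = 0" if \<beta>: "\<beta> \<in> R_an" and y: "y \<in> E \<beta>" for \<beta> y
  proof -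
    have "\<beta> u = g (f \<beta>) u + (\<beta> - g (f \<beta>)) u" by simp
    also have "\<dots> = 0"
    proof -
      have "f \<beta> \<in> S \<and> \<beta> - g (f \<beta>) \<in> \<Lambda>" using root_decomposition \<beta> R_an_iff by blast
      then show ?thesis using gS[of "f \<beta>"] uK(3)[of "\<beta> - g (f \<beta>)"] by simp
    qed
    finally show ?thesis using weight[OF y uK(2)] by simp
  qed
  then show ?thesis using core_centralized uK(1) by (auto simp: centre_def)
qed

theorem invariant_root_graded_L: "invariant_root_graded scL L brL scY S Y sS \<Lambda> G BL"
proof -
  have L: "\<exists>x\<in>K. u = \<pi> x" if "u \<in> L" for u using that \<pi>_image by blast
  have "bilinear_form_on scL L BL"
    unfolding bilinear_form_on_def linear_on_def
  proof (intro conjI ballI allI)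
    fix u v w c assume "u \<in> L" "v \<in> L" "w \<in> L"
    then obtain x y z where "x \<in> K" "u = \<pi> x" "y \<in> K" "v = \<pi> y" "z \<in> K" "w = \<pi> z" using L by metis
    then show "BL u (v + w) = BL u v + BL u w" "BL (v + w) u = BL v u + BL w u"
      using BL_\<pi>[of x "y + z"] BL_\<pi>[of "y + z" x] by (simp_all add: \<pi>_add K_add BL_\<pi> B_add_left B_add_right)
  next
    fix u v c assume "u \<in> L" "v \<in> L"
    then obtain x y where "x \<in> K" "u = \<pi> x" "y \<in> K" "v = \<pi> y" using L by blast
    then show "BL u (scL c v) = c * BL u v" "BL (scL c v) u = c * BL v u"
      using BL_\<pi>[of x "sc c y"] BL_\<pi>[of "sc c y" x] by (simp_all add: \<pi>_scale K_scale BL_\<pi> B_scale_left B_scale_right)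
  qed
  moreover have "symmetric_on L BL"
    unfolding symmetric_on_def using L BL_\<pi> B_commute by metis
  moreover have "invariant_on L brL BL"
    unfolding invariant_on_def
  proof (intro ballI)
    fix u v w assume "u \<in> L" "v \<in> L" "w \<in> L"
    then obtain x y z where "x \<in> K" "u = \<pi> x" "y \<in> K" "v = \<pi> y" "z \<in> K" "w = \<pi> z" using L by metis
    then show "BL (brL u v) w = BL u (brL v w)" by (simp add: \<pi>_br BL_\<pi> K_br B_invariant)
  qed
  moreover have "nondegenerate_on L BL"
    unfolding nondegenerate_on_def
  proof (intro ballI impI)
    fix u assume "u \<in> L" and orth: "\<forall>v\<in>L. BL u v = 0"
    then obtain x where x: "x \<in> K" "u = \<pi> x" using L by blast
    have "B x y = 0" if "y \<in> K" for y using orth x that \<pi>_image BL_\<pi> by (metis image_eqI)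
    then show "u = 0" using orthogonal_to_core_central x \<pi>_zero_iff by blast
  qed
  moreover have "BL x y = 0" if \<nu>: "\<nu> \<in> \<Lambda>" "\<mu> \<in> \<Lambda>" "\<nu> + \<mu> \<noteq> 0"
    and xy: "x \<in> lambda_component scL S G \<nu>" "y \<in> lambda_component scL S G \<mu>" for \<nu> \<mu> x y
  proof -
    have lam: "lambda_component scL S G \<kappa> = \<pi> ` span (\<Union>q\<in>Lat. comp q \<kappa>)"
      "span (\<Union>q\<in>Lat. comp q \<kappa>) \<subseteq> K" if "\<kappa> \<in> \<Lambda>" for \<kappa>
    proof -
      have K: "(\<Union>q\<in>Lat. comp q \<kappa>) \<subseteq> K" using comp_K that by blast
      show "span (\<Union>q\<in>Lat. comp q \<kappa>) \<subseteq> K" by (rule span_minimal[OF K K_subspace])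
      show "lambda_component scL S G \<kappa> = \<pi> ` span (\<Union>q\<in>Lat. comp q \<kappa>)"
        using \<pi>_span[OF K] by (simp add: lambda_component_def image_UN)
    qed
    obtain x' y' where x'y': "x' \<in> span (\<Union>q\<in>Lat. comp q \<nu>)" "y' \<in> span (\<Union>q\<in>Lat. comp q \<mu>)"
      "x = \<pi> x'" "y = \<pi> y'" using xy lam \<nu> by auto
    have "B x' y' = 0"
    proof (rule span_B_orthogonal[OF _ x'y'(1,2)])
      fix a c assume "a \<in> (\<Union>q\<in>Lat. comp q \<nu>)" "c \<in> (\<Union>q\<in>Lat. comp q \<mu>)"
      then obtain p q where p: "p \<in> Lat" "a \<in> comp p \<nu>" and q: "q \<in> Lat" "c \<in> comp q \<mu>" by blast
      have Y: "p \<in> Y" "q \<in> Y" "p + q \<in> Y" using Lat_Y p q Y_closed by auto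
      have eq: "(g p + \<nu>) + (g q + \<mu>) = g (p + q) + (\<nu> + \<mu>)" using Y by (simp add: g_add algebra_simps)
      \<comment> \<open>opposite weights would force \<open>p + q = 0\<close>, by applying \<open>f\<close>, and then \<open>\<nu> + \<mu> = 0\<close>\<close>
      have "(g p + \<nu>) + (g q + \<mu>) \<noteq> 0"
      proof
        assume "(g p + \<nu>) + (g q + \<mu>) = 0"
        then have *: "g (p + q) + (\<nu> + \<mu>) = g 0 + 0" using eq by (simp add: g_zero)
        show False
          using wt_inj[OF Lat_add[OF p(1) q(1)] S_Lat[OF zero_S] \<Lambda>_add[OF \<nu>(1,2)] \<Lambda>_zero *] \<nu>(3) by simp
      qed
      then show "B a c = 0"
        using B_weight_orthogonal[of a "g p + \<nu>" c "g q + \<mu>"] p q comp_weight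
          X_dual[OF wt_X[OF Y(1) \<nu>(1)]] X_dual[OF wt_X[OF Y(2) \<nu>(2)]] by blast
    qed
    then show ?thesis using x'y' lam(2)[OF \<nu>(1)] lam(2)[OF \<nu>(2)] BL_\<pi>[of x' y'] by auto
  qed
  moreover have "\<exists>e f'. (\<forall>\<alpha>\<in>S_ind - {0}. invertible_pair scL brL scY S Y sS \<Lambda> G \<alpha> 0 (e \<alpha>) (f' \<alpha>)) \<and>
      nondegenerate_on (W.span {brL (e \<alpha>) (f' \<alpha>) | \<alpha>. \<alpha> \<in> S_ind - {0}}) BL"
  proof -
    have "\<forall>\<alpha>\<in>S_ind - {0}. \<exists>e f'. invertible_pair scL brL scY S Y sS \<Lambda> G \<alpha> 0 e f' \<and>
        brL e f' = \<pi> (- coroot (g \<alpha>))"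
      using invertible_indivisible by blast
    then obtain e f' where ef: "\<And>\<alpha>. \<alpha> \<in> S_ind - {0} \<Longrightarrow>
        invertible_pair scL brL scY S Y sS \<Lambda> G \<alpha> 0 (e \<alpha>) (f' \<alpha>) \<and> brL (e \<alpha>) (f' \<alpha>) = \<pi> (- coroot (g \<alpha>))"
      by metis
    let ?H = "{- coroot (g \<alpha>) | \<alpha>. \<alpha> \<in> S_ind - {0}}"
    have HK: "- coroot (g \<alpha>) \<in> K \<and> coroot (g \<alpha>) \<in> K" if "\<alpha> \<in> S_ind - {0}" for \<alpha>
      using coroot_K[OF section_anisotropic[OF that]] K_neg by blast
    then have H: "?H \<subseteq> K" by blast
    have "{brL (e \<alpha>) (f' \<alpha>) | \<alpha>. \<alpha> \<in> S_ind - {0}} = \<pi> ` ?H"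
      using ef by (auto simp: image_iff) (metis Diff_iff singletonD)+
    then have span: "W.span {brL (e \<alpha>) (f' \<alpha>) | \<alpha>. \<alpha> \<in> S_ind - {0}} = \<pi> ` span ?H"
      using \<pi>_span[OF H] by simp
    have HspanK: "span ?H \<subseteq> K" by (rule span_minimal[OF H K_subspace])
    have "nondegenerate_on (\<pi> ` span ?H) BL"
      unfolding nondegenerate_on_def
    proof (intro ballI impI)
      fix x assume x: "x \<in> \<pi> ` span ?H" and orth: "\<forall>y\<in>\<pi> ` span ?H. BL x y = 0"
      then obtain u where u: "u \<in> span ?H" "x = \<pi> u" by blast
      have "B u (coroot (g \<alpha>)) = 0" if "\<alpha> \<in> S_ind - {0}" for \<alpha>
      proof -
        have "- coroot (g \<alpha>) \<in> span ?H" using that by (intro span_base) blast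
        then have "BL x (\<pi> (- coroot (g \<alpha>))) = 0" using orth by blast
        then have "B u (- coroot (g \<alpha>)) = 0" using BL_\<pi>[of u] u HspanK HK[OF that] by auto
        then show ?thesis by (simp add: B_minus)
      qed
      then show "x = 0" using coroot_span_orthogonal_central[OF u(1)] u \<pi>_zero_iff by blast
    qed
    then show ?thesis using ef span by (intro exI[of _ e] exI[of _ f']) simp
  qed
  ultimately show ?thesis by (simp add: invariant_root_graded_def)
qed

end

section \<open>Roots and centreless core of an invariant affine reflection algebra\<close>

theorem theorem6p8:
  fixes sc :: "'k::field_char_0 \<Rightarrow> 'e::ab_group_add \<Rightarrow> 'e"
    and br :: "'e \<Rightarrow> 'e \<Rightarrow> 'e" and T :: "'e set" and B :: "'e \<Rightarrow> 'e \<Rightarrow> 'k"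
    and R X Ran R0 :: "('e \<Rightarrow> 'k) set" and s :: "('e \<Rightarrow> 'k) \<Rightarrow> ('e \<Rightarrow> 'k) \<Rightarrow> ('e \<Rightarrow> 'k)"
    and K :: "'e set"
  assumes "invariant_affine_reflection_algebra sc br T B"
    and "R = roots sc br T"
    and "X = module.span fun_sc R"
    and "Ran = anisotropic_roots sc br T B"
    and "R0 = null_roots sc br T B"
    and "s = root_reflection sc br T B"
    and "K = core sc br T B"
  shows
    "(\<forall>\<alpha>\<in>Ran. \<exists>e h f. integrable_sl2_triple sc br T \<alpha> e h f \<and>
        (\<forall>\<beta>\<in>R. form_X T B \<beta> \<alpha> = form_X T B \<alpha> \<alpha> / 2 * \<beta> h)) \<and>
     (\<forall>\<alpha>\<in>R0. \<exists>e\<in>weight_space sc br T \<alpha>. \<exists>t\<in>T. \<exists>f\<in>weight_space sc br T (- \<alpha>).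
        br e f = - t \<and> (\<forall>\<beta>\<in>R. form_X T B \<beta> \<alpha> = \<beta> t)) \<and>
     affine_reflection_system fun_sc R X s \<and> symmetric_roots R \<and>
     real_roots R X s = Ran \<and> Ran = int_roots sc br T \<and> R0 = imag_roots R X s \<and>
     (tame_algebra sc br T B \<longrightarrow> tame_roots R X s) \<and>
     (\<forall>(scY :: 'k \<Rightarrow> 'y::ab_group_add \<Rightarrow> 'y) S Y sS f g
        (scL :: 'k \<Rightarrow> 'l::ab_group_add \<Rightarrow> 'l) L brL \<pi> \<Lambda> G.
        locally_finite_root_system scY S Y sS \<and>
        reflection_extension fun_sc R X s scY S Y sS f \<and>
        partial_section fun_sc R X s scY S Y sS f g \<and>
        \<Lambda> = Lambda R X S f g \<and>
        lie_quotient sc K br (centre br K) scL L brL \<pi> \<and>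
        (\<forall>q \<nu>. G q \<nu> = \<pi> ` core_component sc br T S g \<Lambda> q \<nu>) \<longrightarrow>
        predivision_graded scL L brL scY S Y sS \<Lambda> G \<and>
        (\<exists>BL. (\<forall>x\<in>K. \<forall>y\<in>K. BL (\<pi> x) (\<pi> y) = B x y) \<and>
          invariant_root_graded scL L brL scY S Y sS \<Lambda> G BL))"
proof -
  interpret I: iara sc br T B by unfold_locales (rule assms(1))
  have "predivision_graded scL L brL scY S Y sS \<Lambda> G \<and>
      (\<exists>BL. (\<forall>x\<in>K. \<forall>y\<in>K. BL (\<pi> x) (\<pi> y) = B x y) \<and>
        invariant_root_graded scL L brL scY S Y sS \<Lambda> G BL)"
    if S: "locally_finite_root_system scY S Y sS"
      and f: "reflection_extension fun_sc R X s scY S Y sS f"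
      and g: "partial_section fun_sc R X s scY S Y sS f g"
      and \<Lambda>: "\<Lambda> = Lambda R X S f g"
      and \<pi>: "lie_quotient sc K br (centre br K) scL L brL \<pi>"
      and G: "\<And>q \<nu>. G q \<nu> = \<pi> ` core_component sc br T S g \<Lambda> q \<nu>"
    for scY :: "'k \<Rightarrow> 'y::ab_group_add \<Rightarrow> 'y" and S Y sS f g
      and scL :: "'k \<Rightarrow> 'l::ab_group_add \<Rightarrow> 'l" and L brL \<pi> \<Lambda> G
  proof -
    interpret C: centreless_core sc br T B scY S Y sS f g scL L brL \<pi>
      using S f g \<pi> unfolding assms(2-7) by unfold_locales
    have \<Lambda>_eq: "\<Lambda> = C.\<Lambda>" unfolding \<Lambda> C.\<Lambda>_def assms(2,3) ..
    have G_eq: "G = (\<lambda>q \<nu>. \<pi> ` core_component sc br T S g C.\<Lambda> q \<nu>)"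
      using G unfolding \<Lambda>_eq by blast
    show ?thesis
      unfolding G_eq \<Lambda>_eq assms(7)
      using C.predivision_graded_L C.invariant_root_graded_L C.BL_\<pi> by blast
  qed
  note graded = this
  show ?thesis
  proof (intro conjI)
    show "\<forall>\<alpha>\<in>Ran. \<exists>e h f. integrable_sl2_triple sc br T \<alpha> e h f \<and>
        (\<forall>\<beta>\<in>R. form_X T B \<beta> \<alpha> = form_X T B \<alpha> \<alpha> / 2 * \<beta> h)"
      using I.integrable_triple_form_X unfolding assms(2,4) by blast
    show "\<forall>\<alpha>\<in>R0. \<exists>e\<in>weight_space sc br T \<alpha>. \<exists>t\<in>T. \<exists>f\<in>weight_space sc br T (- \<alpha>).
        br e f = - t \<and> (\<forall>\<beta>\<in>R. form_X T B \<beta> \<alpha> = \<beta> t)"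
      using I.isotropic_triple_form_X unfolding assms(2,5) by blast
    show "affine_reflection_system fun_sc R X s"
      unfolding assms(2,3,6) by (rule I.affine_reflection_system_roots)
    show "symmetric_roots R" unfolding assms(2) by (rule I.symmetric_roots_R)
    show "real_roots R X s = Ran" unfolding assms(2-6) by (rule I.real_roots_eq)
    show "Ran = int_roots sc br T" unfolding assms(4) by (rule I.int_roots_eq[symmetric])
    show "R0 = imag_roots R X s" unfolding assms(2-6) by (rule I.imag_roots_eq[symmetric])
    show "tame_algebra sc br T B \<longrightarrow> tame_roots R X s"
      unfolding assms(2,3,6) using I.tame_algebra_imp_tame_roots by blast
  qed (intro allI impI, elim conjE, rule graded, assumption+, simp)
qed

end
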